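(* Let $\bar M\in\mathbb R$ be such that $T_n[\bar M]$ satisfies property $(T_d)$ in $X_S^E$, and suppose that $S$–$E$ satisfy $(N_a)$. Then: (1) If $n-k$ is even and $T_n[M]$ is inverse negative in $X_S^E$, then $M\in[\bar M-\lambda_3,\bar M-\lambda_1)$, where $\lambda_1>0$ is the least positive eigenvalue of $T_n[\bar M]$ in $X_S^E$ and $\lambda_3>0$ is the minimum between $\lambda_3'>0$, the least positive eigenvalue of $T_n[\bar M]$ in $X_{(S\setminus\{\sigma_k\})\cup\{\alpha\}}^{E}$, and $\lambda_3''>0$, the least positive eigenvalue of $T_n[\bar M]$ in $X_S^{(E\setminus\{\varepsilon_{n-k}\})\cup\{\beta\}}$. (2) If $n-k$ is odd and $T_n[M]$ is inverse positive in $X_S^E$, then $M\in(\bar M-\lambda_1,\bar M-\lambda_3]$, where $\lambda_1<0$ is the biggest negative eigenvalue of $T_n[\bar M]$ in $X_S^E$ and $\lambda_3<0$ is the maximum between $\lambda_3'<0$, the biggest negative eigenvalue of $T_n[\bar M]$ in $X_{(S\setminus\{\sigma_k\})\cup\{\alpha\}}^{E}$, and $\lambda_3''<0$, the biggest negative eigenvalue of $T_n[\bar M]$ in $X_S^{(E\setminus\{\varepsilon_{n-k}\})\cup\{\beta\}}$.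
   Context: Let $n\ge 2$, $k\in\{1,\dots,n-1\}$, and $I=[a,b]$ with $a<b$. Let $S=\{\sigma_1<\dots<\sigma_k\}\subset\{0,\dots,n-1\}$ and $E=\{\varepsilon_1<\dots<\varepsilon_{n-k}\}\subset\{0,\dots,n-1\}$. For $M\in\mathbb R$ let $$T_n[M]u=u^{(n)}+p_1u^{(n-1)}+\dots+p_{n-1}u'+(p_n+M)u,\qquad p_j\in C^{n-j}(I)\text{ real-valued}.$$ For finite sets $A,B\subset\{0,\dots,n-1\}$ put $X_A^B=\{u\in C^n(I):u^{(i)}(a)=0\ \forall i\in A,\ u^{(i)}(b)=0\ \forall i\in B\}$. Let $\alpha=\min(\{0,\dots,n-1\}\setminus S)$ and $\beta=\min(\{0,\dots,n-1\}\setminus E)$. $S$–$E$ satisfy $(N_a)$ if $\#\{j:\sigma_j<h\}+\#\{j:\varepsilon_j<h\}\ge h$ for all $h\in\{1,\dots,n-1\}$. $T_n[M]$ satisfies property $(T_d)$ in $X_S^E$ if there are functions $v_1,\dots,v_n\in C^n(I)$, positive on $I$, such that, with $T_0u=u$ and $T_\ell u=\frac{d}{dt}\left(\frac{T_{\ell-1}u}{v_\ell}\right)$ for $\ell=1,\dots,n$, one has $T_n[M]u=v_1\cdots v_n\,T_nu$ on $I$, and for every $u\in X_S^E$: $T_{\sigma}u(a)=0$ for all $\sigma\in S$ and $T_{\varepsilon}u(b)=0$ for all $\varepsilon\in E$. A real $\lambda$ is an eigenvalue of $T_n[\bar M]$ in $X_A^B$ if there is a nontrivial $u\in X_A^B$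 with $T_n[\bar M]u=\lambda u$ on $I$. $T_n[M]$ is inverse positive (resp. inverse negative) in $X_S^E$ if every $u\in X_S^E$ with $T_n[M]u\ge 0$ on $I$ satisfies $u\ge 0$ (resp. $u\le 0$) on $I$. *)

theory Defs
  imports "HOL-Analysis.Analysis"
begin

text \<open>A function on \<open>I = [a, b]\<close> is represented by a total function \<open>real \<Rightarrow> real\<close> of which
  only the values on \<open>I\<close> matter. Derivatives are taken within \<open>I\<close>, hence one-sided at the two
  end points.\<close>

primrec nderiv_on :: "real set \<Rightarrow> nat \<Rightarrow> (real \<Rightarrow> real) \<Rightarrow> real \<Rightarrow> real" where
  "nderiv_on I 0 u = u"
| "nderiv_on I (Suc i) u = (\<lambda>t. vector_derivative (nderiv_on I i u) (at t within I))"

definition C_n :: "real set \<Rightarrow> nat \<Rightarrow> (real \<Rightarrow> real) set" where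
  "C_n I n = {u. (\<forall>i<n. \<forall>t\<in>I. nderiv_on I i u differentiable (at t within I))
                 \<and> continuous_on I (nderiv_on I n u)}"

text \<open>The coefficients are \<open>p 1, \<dots>, p n\<close>; other values of \<open>p\<close> are not used.\<close>

definition T_op :: "real set \<Rightarrow> nat \<Rightarrow> (nat \<Rightarrow> real \<Rightarrow> real) \<Rightarrow> real \<Rightarrow> (real \<Rightarrow> real) \<Rightarrow> real \<Rightarrow> real"
  where
  "T_op I n p M u t =
     nderiv_on I n u t + (\<Sum>j=1..n. p j t * nderiv_on I (n - j) u t) + M * u t"

definition X_space :: "real \<Rightarrow> real \<Rightarrow> nat \<Rightarrow> nat set \<Rightarrow> nat set \<Rightarrow> (real \<Rightarrow> real) set" where
  "X_space a b n A B = {u \<in> C_n {a..b} n.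
     (\<forall>i\<in>A. nderiv_on {a..b} i u a = 0) \<and> (\<forall>i\<in>B. nderiv_on {a..b} i u b = 0)}"

definition cond_Na :: "nat \<Rightarrow> nat set \<Rightarrow> nat set \<Rightarrow> bool" where
  "cond_Na n S E \<longleftrightarrow>
     (\<forall>h\<in>{1..n - 1}. card {s \<in> S. s < h} + card {e \<in> E. e < h} \<ge> h)"

primrec T_fac :: "real set \<Rightarrow> (nat \<Rightarrow> real \<Rightarrow> real) \<Rightarrow> nat \<Rightarrow> (real \<Rightarrow> real) \<Rightarrow> real \<Rightarrow> real" where
  "T_fac I v 0 u = u"
| "T_fac I v (Suc l) u =
     (\<lambda>t. vector_derivative (\<lambda>s. T_fac I v l u s / v (Suc l) s) (at t within I))"

definition property_Td ::
  "real \<Rightarrow> real \<Rightarrow> nat \<Rightarrow> (nat \<Rightarrow> real \<Rightarrow> real) \<Rightarrow> real \<Rightarrow> nat set \<Rightarrow> nat set \<Rightarrow> bool" where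
  "property_Td a b n p M S E \<longleftrightarrow>
     (\<exists>v :: nat \<Rightarrow> real \<Rightarrow> real.
        (\<forall>l\<in>{1..n}. v l \<in> C_n {a..b} n \<and> (\<forall>t\<in>{a..b}. v l t > 0)) \<and>
        (\<forall>u\<in>C_n {a..b} n. \<forall>t\<in>{a..b}.
            T_op {a..b} n p M u t = (\<Prod>l=1..n. v l t) * T_fac {a..b} v n u t) \<and>
        (\<forall>u\<in>X_space a b n S E.
            (\<forall>s\<in>S. T_fac {a..b} v s u a = 0) \<and> (\<forall>e\<in>E. T_fac {a..b} v e u b = 0)))"

definition is_eigenvalue ::
  "real \<Rightarrow> real \<Rightarrow> nat \<Rightarrow> (nat \<Rightarrow> real \<Rightarrow> real) \<Rightarrow> real \<Rightarrow> nat set \<Rightarrow> nat set \<Rightarrow> real \<Rightarrow> bool" where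
  "is_eigenvalue a b n p M A B lam \<longleftrightarrow>
     (\<exists>u\<in>X_space a b n A B. (\<exists>t\<in>{a..b}. u t \<noteq> 0) \<and>
        (\<forall>t\<in>{a..b}. T_op {a..b} n p M u t = lam * u t))"

definition least_positive_eigenvalue ::
  "real \<Rightarrow> real \<Rightarrow> nat \<Rightarrow> (nat \<Rightarrow> real \<Rightarrow> real) \<Rightarrow> real \<Rightarrow> nat set \<Rightarrow> nat set \<Rightarrow> real \<Rightarrow> bool" where
  "least_positive_eigenvalue a b n p M A B lam \<longleftrightarrow>
     lam > 0 \<and> is_eigenvalue a b n p M A B lam \<and>
     (\<forall>\<mu>>0. is_eigenvalue a b n p M A B \<mu> \<longrightarrow> lam \<le> \<mu>)"

definition biggest_negative_eigenvalue ::
  "real \<Rightarrow> real \<Rightarrow> nat \<Rightarrow> (nat \<Rightarrow> real \<Rightarrow> real) \<Rightarrow> real \<Rightarrow> nat set \<Rightarrow> nat set \<Rightarrow> real \<Rightarrow> bool" where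
  "biggest_negative_eigenvalue a b n p M A B lam \<longleftrightarrow>
     lam < 0 \<and> is_eigenvalue a b n p M A B lam \<and>
     (\<forall>\<mu><0. is_eigenvalue a b n p M A B \<mu> \<longrightarrow> \<mu> \<le> lam)"

definition inverse_positive ::
  "real \<Rightarrow> real \<Rightarrow> nat \<Rightarrow> (nat \<Rightarrow> real \<Rightarrow> real) \<Rightarrow> real \<Rightarrow> nat set \<Rightarrow> nat set \<Rightarrow> bool" where
  "inverse_positive a b n p M S E \<longleftrightarrow>
     (\<forall>u\<in>X_space a b n S E.
        (\<forall>t\<in>{a..b}. T_op {a..b} n p M u t \<ge> 0) \<longrightarrow> (\<forall>t\<in>{a..b}. u t \<ge> 0))"

definition inverse_negative ::
  "real \<Rightarrow> real \<Rightarrow> nat \<Rightarrow> (nat \<Rightarrow> real \<Rightarrow> real) \<Rightarrow> real \<Rightarrow> nat set \<Rightarrow> nat set \<Rightarrow> bool" where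
  "inverse_negative a b n p M S E \<longleftrightarrow>
     (\<forall>u\<in>X_space a b n S E.
        (\<forall>t\<in>{a..b}. T_op {a..b} n p M u t \<ge> 0) \<longrightarrow> (\<forall>t\<in>{a..b}. u t \<le> 0))"

definition least_missing :: "nat \<Rightarrow> nat set \<Rightarrow> nat" where
  "least_missing n A = Min ({0..<n} - A)"

text \<open>With \<open>A = S\<close> this is the set \<open>S\<close> with \<open>\<sigma>\<^sub>k\<close> replaced by \<open>\<alpha>\<close>, and with \<open>A = E\<close> the set \<open>E\<close> with
  its largest element replaced by \<open>\<beta>\<close>. The least missing index is that of \<open>A\<close> itself, not of \<open>A\<close>
  without its maximum.\<close>

definition swap_max :: "nat \<Rightarrow> nat set \<Rightarrow> nat set" where
  "swap_max n A = (A - {Max A}) \<union> {least_missing n A}"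

end

theory Submission
  imports Defs "HOL-Complex_Analysis.Great_Picard"
begin

text \<open>
  Property \<open>(T\<^sub>d)\<close> turns the equation into a cyclic first order system. With
  \<open>y\<^sub>i = T\<^sub>i u / v\<^sub>i\<^sub>+\<^sub>1\<close> for \<open>i < n\<close> and \<open>y\<^sub>n = T\<^sub>n[Mbar] u / v\<^sub>1\<close> one has \<open>y\<^sub>i' = w\<^sub>i y\<^sub>i\<^sub>+\<^sub>1\<close> with positive
  weights \<open>w\<^sub>i\<close>; such a sequence is called a chain below. The boundary conditions of \<open>X\<^sub>S\<^sup>E\<close> become
  \<open>y\<^sub>i(a) = 0\<close> for \<open>i \<in> S\<close> and \<open>y\<^sub>i(b) = 0\<close> for \<open>i \<in> E\<close>. Put \<open>rho = (-1)\<^sup>n\<^sup>-\<^sup>k\<close> and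
  \<open>lam = rho (Mbar - M)\<close>; both parts of the theorem then say where \<open>lam\<close> lies if
  \<open>rho y\<^sub>n - lam y\<^sub>0 \<ge> 0\<close> implies \<open>y\<^sub>0 \<le> 0\<close>.

  The central tool is Rolle's theorem with signs (\<open>chain_alternations\<close>): an alternation is
  lost in each of the \<open>n\<close> steps from \<open>y\<^sub>0\<close> to \<open>y\<^sub>n\<close> and one is regained at each boundary condition.
  There are \<open>n\<close> boundary conditions, and \<open>(N\<^sub>a)\<close> says that the balance never drops to zero on the
  way. So a value of \<open>y\<^sub>0\<close> of one sign forces a value of \<open>rho y\<^sub>n\<close> of the same sign, which
  is inverse positivity for \<open>Mbar\<close>. An additional boundary condition or an interior double
  zero would even force \<open>y\<^sub>n\<close> to change sign; so solutions with a nonnegative source are strongly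
  positive, and every chain that satisfies the boundary conditions is bounded by a multiple of any
  of them (\<open>comparability\<close>). It follows that an eigenfunction of constant sign can only
  belong to the least positive eigenvalue (\<open>no_eigenvalue_below_positive_eigenchain\<close>). Such an
  eigenfunction exists by a blow-up argument in the style of Krein and Rutman
  (\<open>principal_eigenvalue_exists\<close>).

  Testing inverse negativity with the principal eigenfunction gives \<open>lam > lam\<^sub>1\<close>. For the other
  bound, let \<open>y\<close> be the homogeneous solution for \<open>lam\<close> that violates only the condition of highest
  index at \<open>a\<close>. It is a limit of solutions with nonnegative sources near \<open>a\<close>, so inverse negativity
  fixes its sign (\<open>boundary_solution_sign\<close>). If \<open>S = {0, \<dots>, k - 1}\<close>, then this sign contradicts the
  leading term of \<open>y\<close> at \<open>a\<close>, so that inverse negativity fails. Otherwise let \<open>z \<ge> 0\<close> be the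
  principal eigenfunction for the modified set of conditions at \<open>a\<close>, with eigenvalue \<open>lam\<^sub>3\<close>. If
  \<open>lam\<^sub>3 < lam\<close>, then inverse negativity gives \<open>0 \<le> d y\<^sub>0 \<le> z\<^sub>0\<close> for a number \<open>d \<noteq> 0\<close>. Thus
  \<open>d y\<close> vanishes at \<open>a\<close> to the order of \<open>z\<close> and is itself an eigenfunction of constant sign of the
  modified problem, now for the eigenvalue \<open>lam\<close>; this is impossible for \<open>lam > lam\<^sub>3\<close>. The bound
  that comes from the end point \<open>b\<close> follows by reflection.\<close>

section \<open>Calculus on a compact interval\<close>

lemma mvt_within:
  fixes g g' :: "real \<Rightarrow> real"
  assumes der: "\<And>t. t \<in> {a..b} \<Longrightarrow> (g has_real_derivative g' t) (at t within {a..b})"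
    and "a \<le> x" "x < y" "y \<le> b"
  shows "\<exists>z. x < z \<and> z < y \<and> g y - g x = g' z * (y - x)"
proof -
  have "\<exists>z\<in>{x<..<y}. g y - g x = (\<lambda>h. g' z * h) (y - x)"
  proof (rule mvt[OF \<open>x < y\<close>])
    have "continuous_on {a..b} g"
      using der by (meson DERIV_continuous_on)
    then show "continuous_on {x..y} g"
      by (rule continuous_on_subset) (use assms in auto)
    fix t assume "x < t" "t < y"
    then have "(g has_real_derivative g' t) (at t within {a..b})" "t \<in> interior {a..b}"
      using der assms by auto
    then have "(g has_real_derivative g' t) (at t)"
      by (metis at_within_interior)
    then show "(g has_derivative (\<lambda>h. g' t * h)) (at t)"
      by (simp add: has_field_derivative_def)
  qed auto
  then show ?thesis by fastforce
qed

lemma nondecreasing_within: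
  fixes g g' :: "real \<Rightarrow> real"
  assumes der: "\<And>t. t \<in> {a..b} \<Longrightarrow> (g has_real_derivative g' t) (at t within {a..b})"
    and "\<And>t. t \<in> {a..b} \<Longrightarrow> g' t \<ge> 0" and "a \<le> x" "x \<le> y" "y \<le> b"
  shows "g x \<le> g y"
proof (cases "x = y")
  case False
  then obtain z where "x < z" "z < y" "g y - g x = g' z * (y - x)"
    using mvt_within[OF der, of x y] assms by force
  then show ?thesis using assms
    by (smt (verit, best) atLeastAtMost_iff mult_nonneg_nonneg)
qed simp

lemma abs_le_of_derivative_le:
  fixes g g' h h' :: "real \<Rightarrow> real"
  assumes g: "\<And>t. t \<in> {a..b} \<Longrightarrow> (g has_real_derivative g' t) (at t within {a..b})"
    and h: "\<And>t. t \<in> {a..b} \<Longrightarrow> (h has_real_derivative h' t) (at t within {a..b})"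
    and le: "\<And>t. t \<in> {a..b} \<Longrightarrow> \<bar>g' t\<bar> \<le> h' t" and a: "\<bar>g a\<bar> \<le> h a" and t: "t \<in> {a..b}"
  shows "\<bar>g t\<bar> \<le> h t"
proof -
  have "h a - g a \<le> h t - g t"
    by (rule nondecreasing_within[where g = "\<lambda>t. h t - g t" and g' = "\<lambda>t. h' t - g' t" and a = a and b = b])
       (use t le in \<open>auto intro!: DERIV_diff g h simp: abs_le_iff\<close>)
  moreover have "h a + g a \<le> h t + g t"
  proof (rule nondecreasing_within[where g = "\<lambda>t. h t + g t" and g' = "\<lambda>t. h' t + g' t" and a = a and b = b])
    fix t assume "t \<in> {a..b}"
    then show "0 \<le> h' t + g' t" using le[of t] by linarith
  qed (use t in \<open>auto intro!: DERIV_add g h\<close>)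
  ultimately show ?thesis using a by linarith
qed

lemma continuous_on_Icc_bounded:
  fixes f :: "real \<Rightarrow> real"
  assumes "continuous_on {a..b} f"
  shows "\<exists>K>0. \<forall>t\<in>{a..b}. \<bar>f t\<bar> \<le> K"
proof -
  have "bounded (f ` {a..b})"
    by (intro compact_imp_bounded compact_continuous_image assms compact_Icc)
  then show ?thesis by (auto simp: bounded_pos)
qed

section \<open>Counting alternations\<close>

text \<open>Only the increments between neighbouring points have prescribed signs. Hence the values in
  between may vanish, so that a double zero counts as much as two sign changes.\<close>

definition zigzag :: "real \<Rightarrow> real \<Rightarrow> (nat \<Rightarrow> real) \<Rightarrow> nat \<Rightarrow> real \<Rightarrow> (real \<Rightarrow> real) \<Rightarrow> bool" where
  "zigzag a b x m s g \<longleftrightarrow> (\<forall>j\<le>m. x j \<in> {a..b}) \<and> (\<forall>j<m. x j < x (Suc j)) \<and>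
     (\<forall>j<m. s * (-1) ^ j * (g (x (Suc j)) - g (x j)) > 0)"

definition alternates :: "real \<Rightarrow> real \<Rightarrow> nat \<Rightarrow> real \<Rightarrow> (real \<Rightarrow> real) \<Rightarrow> bool" where
  "alternates a b m s g \<longleftrightarrow> (\<exists>x. (\<forall>j<m. x j \<in> {a..b}) \<and> (\<forall>j. Suc j < m \<longrightarrow> x j < x (Suc j)) \<and>
     (\<forall>j<m. s * (-1) ^ j * g (x j) > 0))"

definition weakly_alternates :: "real \<Rightarrow> real \<Rightarrow> nat \<Rightarrow> real \<Rightarrow> (real \<Rightarrow> real) \<Rightarrow> bool" where
  "weakly_alternates a b m s g \<longleftrightarrow> (\<exists>x. zigzag a b x (m - 1) (-s) g \<and>
     s * g (x 0) > 0 \<and> s * (-1) ^ (m - 1) * g (x (m - 1)) > 0)"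

lemma alternates_imp_weakly_alternates:
  assumes "alternates a b m s g" "m \<ge> 1"
  shows "weakly_alternates a b m s g"
proof -
  obtain x where x: "\<forall>j<m. x j \<in> {a..b}" "\<forall>j. Suc j < m \<longrightarrow> x j < x (Suc j)"
    "\<forall>j<m. s * (-1) ^ j * g (x j) > 0"
    using assms by (auto simp: alternates_def)
  have "- s * (-1) ^ j * (g (x (Suc j)) - g (x j)) > 0" if "j < m - 1" for j
  proof -
    have "s * (-1) ^ j * g (x j) > 0" "s * (-1) ^ Suc j * g (x (Suc j)) > 0"
      using x(3)[rule_format, of j] x(3)[rule_format, of "Suc j"] that by auto
    then show ?thesis by (simp add: algebra_simps)
  qed
  then have "zigzag a b x (m - 1) (-s) g"
    using x assms(2) by (auto simp: zigzag_def)
  moreover have "s * g (x 0) > 0" "s * (-1) ^ (m - 1) * g (x (m - 1)) > 0"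
    using x(3)[rule_format, of 0] x(3)[rule_format, of "m - 1"] assms(2) by auto
  ultimately show ?thesis by (auto simp: weakly_alternates_def)
qed

lemma zigzag_prepend:
  assumes "zigzag a b x m (-s) g" "s * (g (x 0) - g a) > 0"
  shows "zigzag a b (case_nat a x) (Suc m) s g"
proof -
  have "x 0 \<in> {a..b}" "x 0 \<noteq> a" using assms by (auto simp: zigzag_def)
  then have "a < x 0" "a \<le> b" by auto
  have "s * (-1) ^ j * (g (case_nat a x (Suc j)) - g (case_nat a x j)) > 0" if "j < Suc m" for j
    using assms that by (cases j) (auto simp: zigzag_def)
  moreover have "case_nat a x j < case_nat a x (Suc j)" if "j < Suc m" for j
    using assms that \<open>a < x 0\<close> by (cases j) (auto simp: zigzag_def)
  moreover have "case_nat a x j \<in> {a..b}" if "j \<le> Suc m" for j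
    using assms that \<open>a \<le> b\<close> by (cases j) (auto simp: zigzag_def)
  ultimately show ?thesis unfolding zigzag_def by blast
qed

lemma zigzag_append:
  assumes "zigzag a b x m s g" "s * (-1) ^ m * (g b - g (x m)) > 0"
  shows "zigzag a b (x(Suc m := b)) (Suc m) s g"
proof -
  have "x m \<in> {a..b}" "x m \<noteq> b" using assms by (auto simp: zigzag_def)
  then have "x m < b" "a \<le> b" by auto
  then show ?thesis using assms unfolding zigzag_def
    by (auto simp: less_Suc_eq le_Suc_eq)
qed

lemma zigzag_imp_alternates_derivative:
  assumes zz: "zigzag a b x m s g"
    and der: "\<And>t. t \<in> {a..b} \<Longrightarrow> (g has_real_derivative w t * h t) (at t within {a..b})"
    and w: "\<And>t. t \<in> {a..b} \<Longrightarrow> w t > 0"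
  shows "alternates a b m s h"
proof -
  have "\<exists>z. x j < z \<and> z < x (Suc j) \<and> s * (-1) ^ j * h z > 0" if "j < m" for j
  proof -
    have xj: "a \<le> x j" "x j < x (Suc j)" "x (Suc j) \<le> b"
      "s * (-1) ^ j * (g (x (Suc j)) - g (x j)) > 0"
      using zz that by (auto simp: zigzag_def)
    then obtain z where z: "x j < z" "z < x (Suc j)"
      "g (x (Suc j)) - g (x j) = w z * h z * (x (Suc j) - x j)"
      using mvt_within[OF der, of "x j" "x (Suc j)"] by auto
    have "(s * (-1) ^ j * h z) * (w z * (x (Suc j) - x j)) > 0"
      using xj(4) z(3) by (simp add: algebra_simps)
    moreover have "w z * (x (Suc j) - x j) > 0"
      using w[of z] xj z by auto
    ultimately have "s * (-1) ^ j * h z > 0"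
      by (simp add: zero_less_mult_iff)
    then show ?thesis using z by blast
  qed
  then obtain z where z: "\<And>j. j < m \<Longrightarrow> x j < z j \<and> z j < x (Suc j) \<and> s * (-1) ^ j * h (z j) > 0"
    by metis
  have "z j \<in> {a..b}" if "j < m" for j
    using z[OF that] zz that unfolding zigzag_def
    by (metis (no_types, lifting) Suc_leI atLeastAtMost_iff less_imp_le order_trans)
  moreover have "z j < z (Suc j)" if "Suc j < m" for j
    using z[of j] z[of "Suc j"] that by auto
  ultimately show ?thesis using z unfolding alternates_def by blast
qed

text \<open>This is Rolle's theorem with signs: passing to the derivative costs one alternation, and each
  end point at which the function does not have the sign of the nearest alternation point gives
  one back, since the function must move between the two.\<close>

lemma weakly_alternates_step:
  assumes wa: "weakly_alternates a b m s g" and m: "m \<ge> 1"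
    and der: "\<And>t. t \<in> {a..b} \<Longrightarrow> (g has_real_derivative w t * h t) (at t within {a..b})"
    and w: "\<And>t. t \<in> {a..b} \<Longrightarrow> w t > 0"
    and pa: "pa \<Longrightarrow> s * g a \<le> 0" and pb: "pb \<Longrightarrow> s * (-1) ^ (m - 1) * g b \<le> 0"
  shows "alternates a b (m - 1 + of_bool pa + of_bool pb) (if pa then s else - s) h"
proof -
  obtain x where x: "zigzag a b x (m - 1) (-s) g" "s * g (x 0) > 0"
    "s * (-1) ^ (m - 1) * g (x (m - 1)) > 0"
    using wa by (auto simp: weakly_alternates_def)
  define m' where "m' = m - 1 + of_bool pa"
  define x' where "x' = (if pa then case_nat a x else x)"
  define s' where "s' = (if pa then s else - s)"
  have z1: "zigzag a b x' m' s' g"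
  proof (cases pa)
    case True
    then have "s * (g (x 0) - g a) > 0" using pa x(2) by (simp add: algebra_simps)
    from zigzag_prepend[OF x(1) this] show ?thesis using True by (simp add: x'_def m'_def s'_def)
  qed (use x in \<open>simp add: x'_def m'_def s'_def\<close>)
  have last: "x' m' = x (m - 1)" by (simp add: x'_def m'_def)
  have sgn: "s' * (-1) ^ m' = - (s * (-1) ^ (m - 1))" by (simp add: s'_def m'_def)
  have "\<exists>x''. zigzag a b x'' (m' + of_bool pb) s' g"
  proof (cases pb)
    case True
    then have "s' * (-1) ^ m' * (g b - g (x' m')) > 0"
      using pb x(3) by (simp add: last sgn algebra_simps)
    from zigzag_append[OF z1 this] show ?thesis using True by auto
  qed (use z1 in auto)
  then show ?thesis
    using zigzag_imp_alternates_derivative[OF _ der w] unfolding m'_def s'_def by blast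
qed

definition count_below :: "nat set \<Rightarrow> nat \<Rightarrow> nat" where
  "count_below A h = card {i \<in> A. i < h}"

lemma count_below_0 [simp]: "count_below A 0 = 0"
  by (simp add: count_below_def)

lemma count_below_Suc: "count_below A (Suc h) = count_below A h + of_bool (h \<in> A)"
proof (cases "h \<in> A")
  case True
  then have "{i \<in> A. i < Suc h} = insert h {i \<in> A. i < h}" by auto
  moreover have "finite {i \<in> A. i < h}" by (rule finite_subset[of _ "{..<h}"]) auto
  ultimately show ?thesis using True by (simp add: count_below_def)
next
  case False
  then have "{i \<in> A. i < Suc h} = {i \<in> A. i < h}" by (auto simp: less_Suc_eq)
  then show ?thesis using False by (simp add: count_below_def)
qed

lemma count_below_eq_card: "A \<subseteq> {..<n} \<Longrightarrow> count_below A n = card A"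
  unfolding count_below_def by (rule arg_cong[where f = card]) auto

lemma count_below_mono: "A \<subseteq> A' \<Longrightarrow> count_below A h \<le> count_below A' h"
  unfolding count_below_def
  by (rule card_mono) (auto intro: finite_subset[of _ "{..<h}"])

text \<open>This is condition \<open>(N\<^sub>a)\<close>, here for arbitrary sets of conditions at the two ends: after \<open>h\<close>
  differentiations at least as many alternations have been regained as were lost.\<close>

definition nonresonant :: "nat \<Rightarrow> nat set \<Rightarrow> nat set \<Rightarrow> bool" where
  "nonresonant n A B \<longleftrightarrow> (\<forall>h\<in>{1..n-1}. count_below A h + count_below B h \<ge> h)"

lemma nonresonant_mono:
  "nonresonant n A B \<Longrightarrow> A \<subseteq> A' \<Longrightarrow> B \<subseteq> B' \<Longrightarrow> nonresonant n A' B'"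
  unfolding nonresonant_def
  by (meson add_mono count_below_mono order_trans)

section \<open>Chains of quasi-derivatives\<close>

text \<open>A chain \<open>y 0, \<dots>, y n\<close> consists of the successive quasi-derivatives of a function; the last
  one plays the role of the differential operator applied to it.\<close>

locale quasi_chain =
  fixes a b :: real and n :: nat and w :: "nat \<Rightarrow> real \<Rightarrow> real"
  assumes ab: "a < b" and n_pos: "0 < n"
    and w_cont: "\<And>i. i < n \<Longrightarrow> continuous_on {a..b} (w i)"
    and w_pos: "\<And>i t. i < n \<Longrightarrow> t \<in> {a..b} \<Longrightarrow> w i t > 0"
begin

definition chain :: "(nat \<Rightarrow> real \<Rightarrow> real) \<Rightarrow> bool" where
  "chain y \<longleftrightarrow> (\<forall>i<n. \<forall>t\<in>{a..b}.
       (y i has_real_derivative w i t * y (Suc i) t) (at t within {a..b})) \<and>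
     continuous_on {a..b} (y n)"

definition bc :: "nat set \<Rightarrow> nat set \<Rightarrow> (nat \<Rightarrow> real \<Rightarrow> real) \<Rightarrow> bool" where
  "bc A B y \<longleftrightarrow> (\<forall>i\<in>A. y i a = 0) \<and> (\<forall>i\<in>B. y i b = 0)"

lemma chain_deriv:
  "chain y \<Longrightarrow> i < n \<Longrightarrow> t \<in> {a..b} \<Longrightarrow>
     (y i has_real_derivative w i t * y (Suc i) t) (at t within {a..b})"
  by (auto simp: chain_def)

lemma chain_cont: "chain y \<Longrightarrow> i \<le> n \<Longrightarrow> continuous_on {a..b} (y i)"
  by (cases "i = n") (auto simp: chain_def intro!: DERIV_continuous_on[of _ _ "\<lambda>t. w i t * y (Suc i) t"])

lemma chain_lincomb:
  assumes "chain y" "chain z"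
  shows "chain (\<lambda>i t. c * y i t + d * z i t)"
  unfolding chain_def
proof (intro conjI allI impI ballI)
  fix i t assume "i < n" "t \<in> {a..b}"
  then have "((\<lambda>t. c * y i t + d * z i t) has_real_derivative
      c * (w i t * y (Suc i) t) + d * (w i t * z (Suc i) t)) (at t within {a..b})"
    by (intro DERIV_add DERIV_cmult chain_deriv assms)
  then show "((\<lambda>t. c * y i t + d * z i t) has_real_derivative
      w i t * (c * y (Suc i) t + d * z (Suc i) t)) (at t within {a..b})"
    by (simp add: algebra_simps)
qed (intro continuous_intros chain_cont assms order_refl)

lemma chain_scale: "chain y \<Longrightarrow> chain (\<lambda>i t. c * y i t)"
  using chain_lincomb[of y y c 0] by simp

lemma bc_lincomb: "bc A B y \<Longrightarrow> bc A B z \<Longrightarrow> bc A B (\<lambda>i t. c * y i t + d * z i t)"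
  by (simp add: bc_def)

lemma bc_scale: "bc A B y \<Longrightarrow> bc A B (\<lambda>i t. c * y i t)"
  by (simp add: bc_def)

text \<open>The weights do not vanish, so each quasi-derivative is determined by the one before.\<close>

lemma chain_zero_on:
  assumes y: "chain y" and "a \<le> c" "c < d" "d \<le> b" and z: "\<And>t. t \<in> {c..d} \<Longrightarrow> y 0 t = 0"
    and "i \<le> n" "t \<in> {c..d}"
  shows "y i t = 0"
  using assms(6,7)
proof (induction i arbitrary: t)
  case (Suc i)
  have "(y i has_real_derivative w i t * y (Suc i) t) (at t within {c..d})"
    by (rule DERIV_subset[OF chain_deriv[OF y, of i t]]) (use Suc assms(2-4) in auto)
  then have "((\<lambda>_. 0) has_real_derivative w i t * y (Suc i) t) (at t within {c..d})"
    by (rule has_field_derivative_transform_within[OF _ zero_less_one]) (use Suc in auto)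
  moreover have "((\<lambda>_. 0) has_real_derivative 0) (at t within {c..d})" by simp
  ultimately have "w i t * y (Suc i) t = 0"
    using vector_derivative_unique_within[of t "{c..d}"] assms(3) Suc.prems
    by (metis has_real_derivative_iff_has_vector_derivative islimpt_Icc trivial_limit_within)
  then show ?case using w_pos[of i t] Suc.prems assms by auto
qed (use z in auto)

lemma chain_zero: "chain y \<Longrightarrow> (\<And>t. t \<in> {a..b} \<Longrightarrow> y 0 t = 0) \<Longrightarrow> i \<le> n \<Longrightarrow> t \<in> {a..b} \<Longrightarrow> y i t = 0"
  using chain_zero_on[of y a b] ab by auto

text \<open>The balance of alternations after \<open>h\<close> steps. Condition \<open>nonresonant\<close> keeps it positive, so
  that every step can be carried out. At \<open>a\<close> a weak sign condition on \<open>y i a\<close> does the same service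
  as a zero; this is used to determine the sign of a boundary value that does not vanish.\<close>

lemma chain_alternations:
  assumes y: "chain y" and wa: "weakly_alternates a b m s (y 0)" and m: "m \<ge> 1"
    and nr: "nonresonant n A B"
    and A: "\<And>i. i \<in> A \<Longrightarrow> s * (-1) ^ (i + count_below A i) * y i a \<le> 0"
    and B: "\<And>i. i \<in> B \<Longrightarrow> y i b = 0"
    and "1 \<le> h" "h \<le> n"
  shows "alternates a b (m + count_below A h + count_below B h - h)
     (s * (-1) ^ (h + count_below A h)) (y h)"
  using assms(7,8)
proof (induction h rule: dec_induct)
  case base
  let ?pa = "0 \<in> A" and ?pb = "0 \<in> B"
  have "alternates a b (m - 1 + of_bool ?pa + of_bool ?pb) (if ?pa then s else - s) (y (Suc 0))"
    by (rule weakly_alternates_step[OF wa m, where w = "w 0"])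
       (use chain_deriv[OF y n_pos] w_pos[OF n_pos] A[of 0] B[of 0] in auto)
  then show ?case using m by (cases ?pa; cases ?pb) (auto simp: count_below_Suc)
next
  case (step h)
  let ?m = "m + count_below A h + count_below B h - h"
  let ?s = "s * (-1) ^ (h + count_below A h)"
  have "count_below A h + count_below B h \<ge> h"
    using nr step by (auto simp: nonresonant_def)
  then have m1: "?m \<ge> 1" using m by linarith
  have hn: "h < n" using step by simp
  have "alternates a b (?m - 1 + of_bool (h \<in> A) + of_bool (h \<in> B)) (if h \<in> A then ?s else - ?s) (y (Suc h))"
    by (rule weakly_alternates_step[where w = "w h"], rule alternates_imp_weakly_alternates)
       (use step m1 chain_deriv[OF y hn] w_pos[OF hn] A[of h] B[of h] in auto)
  moreover have "?m - 1 + of_bool (h \<in> A) + of_bool (h \<in> B)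
      = m + count_below A (Suc h) + count_below B (Suc h) - Suc h"
    using m1 by (simp add: count_below_Suc)
  moreover have "(if h \<in> A then ?s else - ?s) = s * (-1) ^ (Suc h + count_below A (Suc h))"
    by (simp add: count_below_Suc)
  ultimately show ?case by simp
qed

end

section \<open>Positivity of the Green operator\<close>

lemma weakly_alternates_1:
  "t \<in> {a..b} \<Longrightarrow> s * g t > 0 \<Longrightarrow> weakly_alternates a b 1 s g"
  unfolding weakly_alternates_def zigzag_def by (rule exI[of _ "\<lambda>_. t"]) auto

lemma alternates_both_signs:
  assumes "alternates a b m s g" "m \<ge> 2"
  shows "\<exists>t\<in>{a..b}. g t > 0" "\<exists>t\<in>{a..b}. g t < 0"
proof -
  obtain x where x: "\<forall>j<m. x j \<in> {a..b}" "\<forall>j<m. s * (-1) ^ j * g (x j) > 0"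
    using assms by (auto simp: alternates_def)
  have "s * g (x 0) > 0" "s * g (x 1) < 0" "x 0 \<in> {a..b}" "x 1 \<in> {a..b}"
    using x(1)[rule_format, of 0] x(1)[rule_format, of 1]
      x(2)[rule_format, of 0] x(2)[rule_format, of 1] assms(2) by auto
  then show "\<exists>t\<in>{a..b}. g t > 0" "\<exists>t\<in>{a..b}. g t < 0"
    by (cases "s > 0"; force simp: zero_less_mult_iff mult_less_0_iff)+
qed

context quasi_chain
begin

definition poised :: "nat set \<Rightarrow> nat set \<Rightarrow> bool" where
  "poised A B \<longleftrightarrow> A \<subseteq> {..<n} \<and> B \<subseteq> {..<n} \<and> A \<noteq> {} \<and> B \<noteq> {} \<and> card A + card B = n \<and>
     nonresonant n A B"

text \<open>With \<open>card A\<close> conditions at \<open>a\<close> and \<open>n - card A\<close> at \<open>b\<close>, this is the sign of the Green function: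
  in \<open>chain_alternations\<close> the sign of the first alternation flips once for each index outside \<open>A\<close>.\<close>

definition rho :: "nat set \<Rightarrow> real" where
  "rho A = (-1) ^ (n + card A)"

lemma rho_sq [simp]: "rho A * rho A = 1" "rho A * (rho A * x) = x"
  by (auto simp: rho_def simp flip: mult.assoc power_add)

lemma rho_neq_0 [simp]: "rho A \<noteq> 0"
  by (simp add: rho_def)

text \<open>With exactly \<open>n\<close> conditions the balance of alternations returns to its initial value \<open>1\<close>, so a
  negative value of \<open>y 0\<close> forces a negative value of the source.\<close>

lemma inverse_positivity:
  assumes P: "poised A B" and y: "chain y" "bc A B y"
    and pos: "\<And>t. t \<in> {a..b} \<Longrightarrow> rho A * y n t \<ge> 0" and t: "t \<in> {a..b}"
  shows "y 0 t \<ge> 0"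
proof (rule ccontr)
  assume "\<not> y 0 t \<ge> 0"
  then have wa: "weakly_alternates a b 1 (-1) (y 0)"
    using t by (intro weakly_alternates_1[of t]) auto
  have AB: "count_below A n = card A" "count_below B n = card B" "card A + card B = n" "nonresonant n A B"
    using P by (auto simp: poised_def count_below_eq_card)
  have "alternates a b (1 + count_below A n + count_below B n - n) (-1 * (-1) ^ (n + count_below A n)) (y n)"
    by (rule chain_alternations[OF y(1) wa]) (use y(2) AB n_pos in \<open>auto simp: bc_def\<close>)
  then have "alternates a b 1 (- rho A) (y n)"
    using AB by (simp add: rho_def)
  then obtain t where "t \<in> {a..b}" "rho A * y n t < 0"
    by (auto simp: alternates_def)
  with pos show False by (meson not_le)
qed

lemma no_alternation_of_nonneg_source:
  assumes "alternates a b m s (y n)" "m \<ge> 2" "\<And>t. t \<in> {a..b} \<Longrightarrow> rho A * y n t \<ge> 0"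
  shows False
proof -
  obtain t1 t2 where "t1 \<in> {a..b}" "y n t1 > 0" "t2 \<in> {a..b}" "y n t2 < 0"
    using alternates_both_signs[OF assms(1,2)] by blast
  then show False using assms(3)[of t1] assms(3)[of t2]
    by (auto simp: zero_le_mult_iff)
qed

text \<open>One condition more and the balance would end at \<open>2\<close>: the source would change sign.\<close>

lemma no_extra_condition:
  assumes P: "poised A B" and y: "chain y" "bc A' B' y"
    and pos: "\<And>t. t \<in> {a..b} \<Longrightarrow> rho A * y n t \<ge> 0" and nz: "\<exists>t\<in>{a..b}. y 0 t \<noteq> 0"
    and AB: "A \<subseteq> A'" "B \<subseteq> B'" "A' \<subseteq> {..<n}" "B' \<subseteq> {..<n}"
    and c: "n < card A' + card B'"
  shows False
proof -
  obtain t where t: "t \<in> {a..b}" "y 0 t \<noteq> 0" using nz by blast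
  then have wa: "weakly_alternates a b 1 (sgn (y 0 t)) (y 0)"
    by (intro weakly_alternates_1[of t]) (auto simp: sgn_if)
  have nr: "nonresonant n A' B'"
    using P AB nonresonant_mono by (auto simp: poised_def)
  have "alternates a b (1 + count_below A' n + count_below B' n - n)
      (sgn (y 0 t) * (-1) ^ (n + count_below A' n)) (y n)"
    by (rule chain_alternations[OF y(1) wa _ nr]) (use y(2) n_pos in \<open>auto simp: bc_def\<close>)
  moreover have "1 + count_below A' n + count_below B' n - n \<ge> 2"
    using c AB by (simp add: count_below_eq_card)
  ultimately show False using pos by (rule no_alternation_of_nonneg_source)
qed

lemma nonvanishing_at_ends:
  assumes P: "poised A B" and y: "chain y" "bc A B y"
    and pos: "\<And>t. t \<in> {a..b} \<Longrightarrow> rho A * y n t \<ge> 0" and nz: "\<exists>t\<in>{a..b}. y 0 t \<noteq> 0"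
    and i: "i < n"
  shows "i \<notin> A \<Longrightarrow> y i a \<noteq> 0" "i \<notin> B \<Longrightarrow> y i b \<noteq> 0"
proof -
  have fin: "finite A" "finite B" "card A + card B = n" "A \<subseteq> {..<n}" "B \<subseteq> {..<n}"
    using P by (auto simp: poised_def intro: finite_subset)
  show "i \<notin> A \<Longrightarrow> y i a \<noteq> 0"
    using no_extra_condition[OF P y(1) _ pos nz, of "insert i A" B] fin i y(2) by (auto simp: bc_def)
  show "i \<notin> B \<Longrightarrow> y i b \<noteq> 0"
    using no_extra_condition[OF P y(1) _ pos nz, of A "insert i B"] fin i y(2) by (auto simp: bc_def)
qed

lemma least_free_index:
  assumes "A \<subseteq> {..<n}" "card A < n"
  obtains m where "m < n" "m \<notin> A" "\<And>i. i < m \<Longrightarrow> i \<in> A"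
proof -
  have "\<exists>i<n. i \<notin> A"
  proof (rule ccontr)
    assume "\<not> ?thesis"
    then have "A = {..<n}" using assms(1) by auto
    then show False using assms(2) by simp
  qed
  then obtain i where "i < n" "i \<notin> A" by blast
  then show thesis using that[of "LEAST i. i \<notin> A"]
    by (metis (mono_tags, lifting) LeastI Least_le not_less_Least le_less_trans)
qed

lemma poised_card_less:
  assumes "poised A B" shows "card A < n" "card B < n"
proof -
  have "finite A" "finite B" using assms by (auto simp: poised_def intro: finite_subset)
  then have "card A > 0" "card B > 0" using assms by (auto simp: poised_def card_gt_0_iff)
  then show "card A < n" "card B < n" using assms by (auto simp: poised_def)
qed

text \<open>An interior zero of a nonnegative function is a double zero: the values \<open>+, 0, +\<close> around it
  count as three alternations.\<close>

lemma interior_positivity: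
  assumes P: "poised A B" and y: "chain y" "bc A B y"
    and pos: "\<And>t. t \<in> {a..b} \<Longrightarrow> rho A * y n t \<ge> 0" and nz: "\<exists>t\<in>{a..b}. y 0 t \<noteq> 0"
    and x: "a < x" "x < b"
  shows "y 0 x > 0"
proof (rule ccontr)
  assume "\<not> y 0 x > 0"
  have nn: "y 0 t \<ge> 0" if "t \<in> {a..b}" for t
    using inverse_positivity[OF P y pos that] .
  then have "y 0 x \<ge> 0" using x by simp
  then have x0: "y 0 x = 0" using \<open>\<not> y 0 x > 0\<close> by linarith
  have fin: "card A + card B = n" "A \<subseteq> {..<n}" "B \<subseteq> {..<n}" "nonresonant n A B"
    using P by (auto simp: poised_def)
  have "\<exists>t\<in>{a..x}. y 0 t \<noteq> 0"
  proof (rule ccontr)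
    assume "\<not> ?thesis"
    moreover obtain m where "m < n" "m \<notin> A"
      using least_free_index[OF fin(2) poised_card_less(1)[OF P]] by blast
    ultimately show False
      using chain_zero_on[OF y(1), of a x m a] nonvanishing_at_ends(1)[OF P y pos nz, of m] x by auto
  qed
  moreover have "\<exists>t\<in>{x..b}. y 0 t \<noteq> 0"
  proof (rule ccontr)
    assume "\<not> ?thesis"
    moreover obtain m where "m < n" "m \<notin> B"
      using least_free_index[OF fin(3) poised_card_less(2)[OF P]] by blast
    ultimately show False
      using chain_zero_on[OF y(1), of x b m b] nonvanishing_at_ends(2)[OF P y pos nz, of m] x by auto
  qed
  ultimately obtain l r where l: "l \<in> {a..x}" "y 0 l \<noteq> 0" and r: "r \<in> {x..b}" "y 0 r \<noteq> 0"
    by blast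
  have lr: "a \<le> l" "l < x" "x < r" "r \<le> b" "y 0 l > 0" "y 0 r > 0"
    using l r x x0 nn[of l] nn[of r] by (auto simp: less_le)
  \<comment> \<open>The three alternation points, with the zero in the middle.\<close>
  let ?x = "\<lambda>j. if j = 0 then l else if j = 1 then x else r"
  have "zigzag a b ?x 2 (-1) (y 0)"
    unfolding zigzag_def using lr x0 by (auto simp: less_2_cases_iff numeral_2_eq_2 less_Suc_eq)
  then have wa: "weakly_alternates a b 3 1 (y 0)"
    unfolding weakly_alternates_def using lr by (intro exI[of _ ?x]) auto
  have "alternates a b (3 + count_below A n + count_below B n - n)
      (1 * (-1) ^ (n + count_below A n)) (y n)"
    by (rule chain_alternations[OF y(1) wa _ fin(4)]) (use y(2) n_pos in \<open>auto simp: bc_def\<close>)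
  moreover have "3 + count_below A n + count_below B n - n \<ge> 2"
    using fin by (simp add: count_below_eq_card)
  ultimately show False using pos by (rule no_alternation_of_nonneg_source)
qed

lemma chain_bounded:
  assumes "chain y" "i \<le> n"
  obtains K where "K > 0" "\<And>t. t \<in> {a..b} \<Longrightarrow> \<bar>y i t\<bar> \<le> K"
  using continuous_on_Icc_bounded[OF chain_cont[OF assms]] by blast

text \<open>At the common order \<open>m\<close> of vanishing the comparison is one of nonzero numbers; integrating
  the inequality \<open>m\<close> times brings it down to the functions.\<close>

lemma chain_comparable_near_left:
  assumes y: "chain y" and z: "chain z" and m: "m < n"
    and zero: "\<And>i. i < m \<Longrightarrow> y i a = 0 \<and> z i a = 0" and nz: "z m a \<noteq> 0"
  shows "\<exists>c C. a < c \<and> c \<le> b \<and> C \<ge> 0 \<and> (\<forall>t\<in>{a..c}. \<bar>y 0 t\<bar> \<le> C * \<bar>z 0 t\<bar>)"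
proof -
  define s where "s = sgn (z m a)"
  define e where "e = \<bar>z m a\<bar> / 2"
  have e: "e > 0" using nz by (simp add: e_def)
  obtain K where K: "K > 0" "\<And>t. t \<in> {a..b} \<Longrightarrow> \<bar>y m t\<bar> \<le> K"
    using chain_bounded[OF y, of m] m by auto
  have "continuous_on {a..b} (z m)" using chain_cont[OF z] m by simp
  then obtain d where d: "d > 0" "\<And>t. t \<in> {a..b} \<Longrightarrow> \<bar>t - a\<bar> < d \<Longrightarrow> \<bar>z m t - z m a\<bar> < e"
    using e ab unfolding continuous_on_iff dist_real_def by (metis atLeastAtMost_iff less_imp_le order_refl)
  define c where "c = min b (a + d / 2)"
  have c: "a < c" "c \<le> b" using d ab by (auto simp: c_def)
  have sz: "s * z m t \<ge> e" if "t \<in> {a..c}" for t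
  proof -
    have "\<bar>z m t - z m a\<bar> < e" using that d by (intro d) (auto simp: c_def)
    then show ?thesis unfolding s_def e_def
      by (cases "z m a > 0") (auto simp: sgn_if abs_if split: if_splits)
  qed
  define C where "C = K / e"
  have C: "C \<ge> 0" using K e by (simp add: C_def)
  have "\<forall>t\<in>{a..c}. \<bar>y (m - j) t\<bar> \<le> C * (s * z (m - j) t)" if "j \<le> m" for j
    using that
  proof (induction j)
    case 0
    show ?case
    proof
      fix t assume t: "t \<in> {a..c}"
      have "\<bar>y m t\<bar> \<le> K" using t c by (intro K) auto
      also have "K \<le> C * (s * z m t)"
        using sz[OF t] K e by (simp add: C_def field_simps)
      finally show "\<bar>y (m - 0) t\<bar> \<le> C * (s * z (m - 0) t)" by simp
    qed
  next
    case (Suc j)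
    define i where "i = m - Suc j"
    have i: "m - j = Suc i" "i < n" "i < m" using Suc m by (auto simp: i_def)
    have IH: "\<bar>y (Suc i) t\<bar> \<le> C * (s * z (Suc i) t)" if "t \<in> {a..c}" for t
      using Suc that i by auto
    show ?case unfolding i_def[symmetric]
    proof
      fix t assume t: "t \<in> {a..c}"
      show "\<bar>y i t\<bar> \<le> C * (s * z i t)"
      proof (rule abs_le_of_derivative_le[OF _ _ _ _ t, where g' = "\<lambda>t. w i t * y (Suc i) t"
            and h' = "\<lambda>t. C * (s * (w i t * z (Suc i) t))"])
        fix t assume t: "t \<in> {a..c}"
        then have t': "t \<in> {a..b}" using c by auto
        show "(y i has_real_derivative w i t * y (Suc i) t) (at t within {a..c})"
          by (rule DERIV_subset[OF chain_deriv[OF y i(2) t']]) (use c in auto)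
        have "(z i has_real_derivative w i t * z (Suc i) t) (at t within {a..c})"
          by (rule DERIV_subset[OF chain_deriv[OF z i(2) t']]) (use c in auto)
        then show "((\<lambda>t. C * (s * z i t)) has_real_derivative C * (s * (w i t * z (Suc i) t))) (at t within {a..c})"
          by (intro DERIV_cmult)
        have "\<bar>w i t * y (Suc i) t\<bar> \<le> w i t * (C * (s * z (Suc i) t))"
          using IH[OF t] w_pos[OF i(2) t'] by (simp add: abs_mult)
        then show "\<bar>w i t * y (Suc i) t\<bar> \<le> C * (s * (w i t * z (Suc i) t))"
          by (simp add: mult_ac)
      next
        show "\<bar>y i a\<bar> \<le> C * (s * z i a)" using zero[OF i(3)] by simp
      qed
    qed
  qed
  from this[of m] have main: "\<forall>t\<in>{a..c}. \<bar>y 0 t\<bar> \<le> C * (s * z 0 t)" by simp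
  have "C * (s * z 0 t) \<le> C * \<bar>z 0 t\<bar>" for t
    by (rule mult_left_mono[OF _ C]) (auto simp: s_def sgn_if)
  then show ?thesis using main c C by (meson order_trans)
qed

text \<open>The sign \<open>(-1) ^ i\<close> compensates the sign that each differentiation picks up, so that the
  weights of the reflected chain are again positive.\<close>

definition reflected :: "(nat \<Rightarrow> real \<Rightarrow> real) \<Rightarrow> nat \<Rightarrow> real \<Rightarrow> real" where
  "reflected y = (\<lambda>i t. (-1) ^ i * y i (- t))"

lemma quasi_chain_reflected: "quasi_chain (-b) (-a) n (\<lambda>i t. w i (- t))"
proof
  fix i assume "i < n"
  have "uminus ` {-b..-a} \<subseteq> {a..b}" by auto
  then show "continuous_on {-b..-a} (\<lambda>t. w i (- t))"
    using continuous_on_compose2[OF w_cont[OF \<open>i < n\<close>], of "{-b..-a}" uminus]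
    by (simp add: continuous_on_minus)
  fix t assume "t \<in> {-b..-a}"
  then show "w i (-t) > 0" using w_pos[OF \<open>i < n\<close>, of "-t"] by auto
qed (use ab n_pos in auto)

lemma chain_reflected:
  assumes "chain y"
  shows "quasi_chain.chain (-b) (-a) n (\<lambda>i t. w i (- t)) (reflected y)"
proof -
  interpret R: quasi_chain "-b" "-a" n "\<lambda>i t. w i (- t)" by (rule quasi_chain_reflected)
  have im: "uminus ` {-b..-a} = {a..b}" by (auto simp: image_iff intro: bexI[of _ "- x" for x])
  show ?thesis unfolding R.chain_def
  proof (intro conjI allI impI ballI)
    fix i t assume i: "i < n" and t: "t \<in> {-b..-a}"
    have "((y i \<circ> uminus) has_real_derivative (w i (- t) * y (Suc i) (- t)) * (-1)) (at t within {-b..-a})"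
      by (rule DERIV_image_chain) (use chain_deriv[OF assms i, of "-t"] t im in \<open>auto intro!: derivative_eq_intros\<close>)
    then have "((\<lambda>t. (-1) ^ i * (y i \<circ> uminus) t) has_real_derivative (-1) ^ i * ((w i (- t) * y (Suc i) (- t)) * (-1))) (at t within {-b..-a})"
      by (rule DERIV_cmult)
    then show "(reflected y i has_real_derivative w i (- t) * reflected y (Suc i) t) (at t within {-b..-a})"
      by (simp add: reflected_def o_def mult_ac)
  next
    have "continuous_on {-b..-a} (\<lambda>t. y n (- t))"
      using continuous_on_compose2[OF chain_cont[OF assms order_refl], of "{-b..-a}" uminus] im
      by (simp add: continuous_on_minus)
    then show "continuous_on {-b..-a} (reflected y n)"
      unfolding reflected_def by (intro continuous_intros)
  qed
qed

text \<open>Strong positivity in quantitative form: near the end points \<open>z\<close> has the smallest order of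
  vanishing that the boundary conditions allow, and in between it is bounded below.\<close>

lemma comparability:
  assumes P: "poised A B" and z: "chain z" "bc A B z"
    and pos: "\<And>t. t \<in> {a..b} \<Longrightarrow> rho A * z n t \<ge> 0" and nz: "\<exists>t\<in>{a..b}. z 0 t \<noteq> 0"
    and y: "chain y" "bc A B y"
  obtains C where "C > 0" "\<And>t. t \<in> {a..b} \<Longrightarrow> \<bar>y 0 t\<bar> \<le> C * z 0 t"
proof -
  interpret R: quasi_chain "-b" "-a" n "\<lambda>i t. w i (- t)" by (rule quasi_chain_reflected)
  have nn: "z 0 t \<ge> 0" if "t \<in> {a..b}" for t
    using inverse_positivity[OF P z pos that] .
  have AB: "A \<subseteq> {..<n}" "B \<subseteq> {..<n}" using P by (auto simp: poised_def)
  obtain m where m: "m < n" "m \<notin> A" "\<And>i. i < m \<Longrightarrow> i \<in> A"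
    using least_free_index[OF AB(1) poised_card_less(1)[OF P]] by blast
  have "\<exists>c C. a < c \<and> c \<le> b \<and> C \<ge> 0 \<and> (\<forall>t\<in>{a..c}. \<bar>y 0 t\<bar> \<le> C * \<bar>z 0 t\<bar>)"
    by (rule chain_comparable_near_left[OF y(1) z(1) m(1)])
       (use m y z nonvanishing_at_ends(1)[OF P z pos nz m(1,2)] in \<open>auto simp: bc_def\<close>)
  then obtain c1 C1 where c1: "a < c1" "c1 \<le> b" "C1 \<ge> 0" "\<And>t. t \<in> {a..c1} \<Longrightarrow> \<bar>y 0 t\<bar> \<le> C1 * \<bar>z 0 t\<bar>"
    by blast
  obtain l where l: "l < n" "l \<notin> B" "\<And>i. i < l \<Longrightarrow> i \<in> B"
    using least_free_index[OF AB(2) poised_card_less(2)[OF P]] by blast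
  have "\<exists>c C. -b < c \<and> c \<le> -a \<and> C \<ge> 0 \<and> (\<forall>t\<in>{-b..c}. \<bar>reflected y 0 t\<bar> \<le> C * \<bar>reflected z 0 t\<bar>)"
    by (rule R.chain_comparable_near_left[OF chain_reflected[OF y(1)] chain_reflected[OF z(1)] l(1)])
       (use l y z nonvanishing_at_ends(2)[OF P z pos nz l(1,2)] in \<open>auto simp: bc_def reflected_def\<close>)
  then obtain c2' C2 where c2': "-b < c2'" "c2' \<le> -a" "C2 \<ge> 0"
      "\<forall>t\<in>{-b..c2'}. \<bar>reflected y 0 t\<bar> \<le> C2 * \<bar>reflected z 0 t\<bar>"
    by blast
  define c2 where "c2 = - c2'"
  have c2: "c2 < b" "a \<le> c2" "C2 \<ge> 0" "\<bar>y 0 t\<bar> \<le> C2 * \<bar>z 0 t\<bar>" if "t \<in> {c2..b}" for t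
    using c2'(1-3) c2'(4)[rule_format, of "-t"] that by (auto simp: c2_def reflected_def)
  have "\<exists>e>0. \<forall>t\<in>{c1..c2}. z 0 t \<ge> e"
  proof (cases "c1 \<le> c2")
    case True
    have "continuous_on {c1..c2} (z 0)"
      by (rule continuous_on_subset[OF chain_cont[OF z(1)]]) (use c1 c2'(1) in \<open>auto simp: c2_def\<close>)
    then obtain x where x: "x \<in> {c1..c2}" "\<forall>t\<in>{c1..c2}. z 0 x \<le> z 0 t"
      using continuous_attains_inf[of "{c1..c2}" "z 0"] True by auto
    moreover have "z 0 x > 0"
      using interior_positivity[OF P z pos nz, of x] x c1 c2'(1) by (auto simp: c2_def)
    ultimately show ?thesis by blast
  qed (auto intro!: exI[of _ 1])
  then obtain e where e: "e > 0" "\<And>t. t \<in> {c1..c2} \<Longrightarrow> z 0 t \<ge> e" by blast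
  obtain K where K: "K > 0" "\<And>t. t \<in> {a..b} \<Longrightarrow> \<bar>y 0 t\<bar> \<le> K"
    using chain_bounded[OF y(1), of 0] by auto
  define C where "C = C1 + C2 + K / e"
  have "C > 0" using c1 c2'(3) K e by (simp add: C_def add_nonneg_pos)
  moreover have "\<bar>y 0 t\<bar> \<le> C * z 0 t" if t: "t \<in> {a..b}" for t
  proof -
    have z0: "z 0 t \<ge> 0" by (rule nn[OF t])
    have n1: "C1 * z 0 t \<ge> 0" "C2 * z 0 t \<ge> 0" "K / e * z 0 t \<ge> 0"
      using z0 c1 c2'(3) K e by auto
    consider "t \<in> {a..c1}" | "t \<in> {c2..b}" | "t \<in> {c1..c2}" using t by force
    then have "\<bar>y 0 t\<bar> \<le> C1 * z 0 t \<or> \<bar>y 0 t\<bar> \<le> C2 * z 0 t \<or> \<bar>y 0 t\<bar> \<le> K / e * z 0 t"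
    proof cases
      case 3
      then have "K \<le> K / e * z 0 t" using e K by (simp add: field_simps)
      then show ?thesis using K(2)[OF t] by linarith
    qed (use c1(4)[of t] c2(4)[of t] z0 in auto)
    then show ?thesis using n1 unfolding C_def by (auto simp: distrib_right)
  qed
  ultimately show thesis using that by blast
qed

definition eigenchain :: "nat set \<Rightarrow> nat set \<Rightarrow> real \<Rightarrow> (nat \<Rightarrow> real \<Rightarrow> real) \<Rightarrow> bool" where
  "eigenchain A B lam y \<longleftrightarrow> chain y \<and> bc A B y \<and> (\<exists>t\<in>{a..b}. y 0 t \<noteq> 0) \<and>
     (\<forall>t\<in>{a..b}. rho A * y n t = lam * y 0 t)"

text \<open>If \<open>y\<close> were an eigenfunction for a smaller eigenvalue, then \<open>\<bar>y\<bar> \<le> C z\<close> would imply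
  \<open>\<bar>y\<bar> \<le> (mu / lam) C z\<close> by inverse positivity, and iteration would give \<open>y = 0\<close>.\<close>

lemma no_eigenvalue_below_positive_eigenchain:
  assumes P: "poised A B" and z: "eigenchain A B lam z" and zpos: "\<And>t. t \<in> {a..b} \<Longrightarrow> z 0 t \<ge> 0"
    and y: "eigenchain A B mu y" and mu: "0 < mu" "mu < lam"
  shows False
proof -
  have z': "chain z" "bc A B z" "\<exists>t\<in>{a..b}. z 0 t \<noteq> 0" "\<And>t. t \<in> {a..b} \<Longrightarrow> rho A * z n t = lam * z 0 t"
    and y': "chain y" "bc A B y" "\<exists>t\<in>{a..b}. y 0 t \<noteq> 0" "\<And>t. t \<in> {a..b} \<Longrightarrow> rho A * y n t = mu * y 0 t"
    using z y by (auto simp: eigenchain_def)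
  have "rho A * z n t \<ge> 0" if "t \<in> {a..b}" for t
    using z'(4)[OF that] zpos[OF that] mu by auto
  from comparability[OF P z'(1,2) this z'(3) y'(1,2)]
  obtain C where C: "C > 0" "\<And>t. t \<in> {a..b} \<Longrightarrow> \<bar>y 0 t\<bar> \<le> C * z 0 t" by blast
  define q where "q = mu / lam"
  have q: "0 \<le> q" "q < 1" using mu by (auto simp: q_def)
  \<comment> \<open>Applying the Green operator to the bound improves it by the factor \<open>q\<close>.\<close>
  have step: "\<forall>t\<in>{a..b}. \<bar>y 0 t\<bar> \<le> q * D * z 0 t" if D: "\<forall>t\<in>{a..b}. \<bar>y 0 t\<bar> \<le> D * z 0 t" for D
  proof
    fix t assume t: "t \<in> {a..b}"
    have "0 \<le> q * D * z 0 t + s * y 0 t" if s: "\<bar>s\<bar> = 1" for s :: real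
    proof (rule inverse_positivity[OF P chain_lincomb[OF z'(1) y'(1)] bc_lincomb[OF z'(2) y'(2)] _ t])
      fix t assume t: "t \<in> {a..b}"
      have "rho A * (q * D * z n t + s * y n t) = q * D * (rho A * z n t) + s * (rho A * y n t)"
        by (simp add: algebra_simps)
      also have "\<dots> = mu * (D * z 0 t + s * y 0 t)"
        using z'(4)[OF t] y'(4)[OF t] mu by (simp add: q_def field_simps)
      also have "\<dots> \<ge> 0"
      proof -
        have "\<bar>s * y 0 t\<bar> \<le> D * z 0 t" using D t s by (auto simp: abs_mult)
        then show ?thesis using mu by auto
      qed
      finally show "0 \<le> rho A * (q * D * z n t + s * y n t)" .
    qed
    from this[of 1] this[of "-1"] show "\<bar>y 0 t\<bar> \<le> q * D * z 0 t" by auto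
  qed
  have it: "\<forall>t\<in>{a..b}. \<bar>y 0 t\<bar> \<le> q ^ j * C * z 0 t" for j
  proof (induction j)
    case (Suc j)
    from step[OF this] show ?case by (simp add: mult.assoc)
  qed (use C in auto)
  obtain t where t: "t \<in> {a..b}" "y 0 t \<noteq> 0" using y'(3) by blast
  have "(\<lambda>j. q ^ j * C * z 0 t) \<longlonglongrightarrow> 0 * C * z 0 t"
    by (intro tendsto_intros LIMSEQ_power_zero) (use q in auto)
  then have "\<bar>y 0 t\<bar> \<le> 0 * C * z 0 t"
    by (rule LIMSEQ_le_const) (use it t in auto)
  then show False using t by simp
qed

text \<open>If neither end point carries a condition on \<open>y h\<close>, then the balance of alternations is at
  least \<open>2\<close> after \<open>h\<close> steps, because the next step regains nothing and must still leave one.\<close>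

lemma chain_has_zero:
  assumes P: "poised A B" and y: "chain y" "bc A B y" and h: "h < n"
  shows "\<exists>t\<in>{a..b}. y h t = 0"
proof (rule ccontr)
  assume no: "\<not> ?thesis"
  have fin: "card A + card B = n" "A \<subseteq> {..<n}" "B \<subseteq> {..<n}" "nonresonant n A B"
    using P by (auto simp: poised_def)
  have "h \<notin> A" "h \<notin> B" using no y(2) ab by (auto simp: bc_def)
  then have "count_below A h + count_below B h = count_below A (Suc h) + count_below B (Suc h)"
    by (simp add: count_below_Suc)
  also have "\<dots> \<ge> Suc h"
  proof (cases "Suc h = n")
    case True
    then show ?thesis using fin by (simp add: count_below_eq_card)
  qed (use fin(4) h in \<open>auto simp: nonresonant_def\<close>)
  finally have cnt: "count_below A h + count_below B h \<ge> Suc h" .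
  then have h1: "1 \<le> h" by (cases h) auto
  have "\<exists>t\<in>{a..b}. y 0 t \<noteq> 0"
    using no chain_zero[OF y(1), of h a] h ab by (metis atLeastAtMost_iff less_imp_le order_refl)
  then obtain t where t: "t \<in> {a..b}" "y 0 t \<noteq> 0" by blast
  then have wa: "weakly_alternates a b 1 (sgn (y 0 t)) (y 0)"
    by (intro weakly_alternates_1[of t]) (auto simp: sgn_if)
  have "alternates a b (1 + count_below A h + count_below B h - h)
      (sgn (y 0 t) * (-1) ^ (h + count_below A h)) (y h)"
    by (rule chain_alternations[OF y(1) wa _ fin(4)]) (use y(2) h1 h in \<open>auto simp: bc_def\<close>)
  moreover have "1 + count_below A h + count_below B h - h \<ge> 2"
    using cnt by linarith
  ultimately obtain t1 t2 where t12: "t1 \<in> {a..b}" "y h t1 > 0" "t2 \<in> {a..b}" "y h t2 < 0"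
    using alternates_both_signs by meson
  have "connected (y h ` {a..b})"
    by (intro connected_continuous_image chain_cont[OF y(1)]) (use h in auto)
  then have "0 \<in> y h ` {a..b}"
    using t12 unfolding connected_iff_interval by (meson image_eqI less_imp_le)
  then show False using no by auto
qed

text \<open>The Green operator is bounded, also into spaces with derivatives: every quasi-derivative
  has a zero, from which it is recovered by integrating the next one.\<close>

lemma chain_norm_bound:
  assumes P: "poised A B" and "i \<le> n"
  shows "\<exists>C\<ge>0. \<forall>y K. chain y \<longrightarrow> bc A B y \<longrightarrow> (\<forall>t\<in>{a..b}. \<bar>y n t\<bar> \<le> K) \<longrightarrow> (\<forall>t\<in>{a..b}. \<bar>y i t\<bar> \<le> C * K)"
  using \<open>i \<le> n\<close>
proof (induction i rule: inc_induct)
  case base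
  then show ?case by (intro exI[of _ 1]) auto
next
  case (step i)
  then obtain C where C: "C \<ge> 0" "\<And>y K t. chain y \<Longrightarrow> bc A B y \<Longrightarrow> (\<forall>t\<in>{a..b}. \<bar>y n t\<bar> \<le> K) \<Longrightarrow>
      t \<in> {a..b} \<Longrightarrow> \<bar>y (Suc i) t\<bar> \<le> C * K" by blast
  obtain W where W: "W > 0" "\<forall>t\<in>{a..b}. \<bar>w i t\<bar> \<le> W"
    using continuous_on_Icc_bounded[OF w_cont, of i] step by blast
  show ?case
  proof (intro exI[of _ "W * C * (b - a)"] conjI allI impI ballI)
    show "0 \<le> W * C * (b - a)" using W C ab by auto
    fix y K t assume y: "chain y" "bc A B y" "\<forall>t\<in>{a..b}. \<bar>y n t\<bar> \<le> K" and t: "t \<in> {a..b}"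
    have K: "K \<ge> 0" using y(3)[rule_format, of a] ab by auto
    obtain x where x: "x \<in> {a..b}" "y i x = 0"
      using chain_has_zero[OF P y(1,2)] step by blast
    have "norm (y i t - y i x) \<le> W * (C * K) * norm (t - x)"
    proof (rule field_differentiable_bound[OF convex_real_interval(5)])
      fix s assume s: "s \<in> {a..b}"
      show "(y i has_real_derivative w i s * y (Suc i) s) (at s within {a..b})"
        by (rule chain_deriv[OF y(1) _ s]) (use step in auto)
      show "norm (w i s * y (Suc i) s) \<le> W * (C * K)"
        unfolding norm_mult by (rule mult_mono) (use W C(2)[OF y s] s C(1) K in auto)
    qed (use x t in auto)
    also have "\<dots> \<le> W * (C * K) * (b - a)"
      by (rule mult_left_mono) (use x t W C(1) K in auto)
    finally show "\<bar>y i t\<bar> \<le> W * C * (b - a) * K" using x by (simp add: mult_ac)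
  qed
qed

end

section \<open>Initial and boundary value problems\<close>

text \<open>Gaussian elimination, for index sets of arbitrary finite size.\<close>

lemma nontrivial_solution_of_underdetermined_system:
  fixes M :: "'i \<Rightarrow> 'j \<Rightarrow> real"
  assumes "finite I" "finite J" "card I < card J"
  shows "\<exists>x. (\<exists>j\<in>J. x j \<noteq> 0) \<and> (\<forall>i\<in>I. (\<Sum>j\<in>J. M i j * x j) = 0)"
  using assms
proof (induction I arbitrary: J M rule: finite_induct)
  case empty
  then have "J \<noteq> {}" by auto
  then show ?case by (auto intro!: exI[of _ "\<lambda>_. 1"])
next
  case (insert i I)
  show ?case
  proof (cases "\<forall>j\<in>J. M i j = 0")
    case True
    obtain x where "\<exists>j\<in>J. x j \<noteq> 0" "\<forall>i\<in>I. (\<Sum>j\<in>J. M i j * x j) = 0"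
      using insert.IH[of J M] insert.prems insert.hyps by auto
    then show ?thesis using True by (intro exI[of _ x]) auto
  next
    case False
    then obtain q where q: "q \<in> J" "M i q \<noteq> 0" by blast
    define M' where "M' = (\<lambda>r j. M r j - M r q * M i j / M i q)"
    have "card I < card (J - {q})"
      using insert q by (simp add: card_Diff_singleton)
    then obtain x where x: "\<exists>j\<in>J - {q}. x j \<noteq> 0" "\<forall>r\<in>I. (\<Sum>j\<in>J - {q}. M' r j * x j) = 0"
      using insert.IH[of "J - {q}" M'] insert.prems by auto
    define S where "S r = (\<Sum>j\<in>J - {q}. M r j * x j)" for r
    \<comment> \<open>The eliminated unknown is chosen to satisfy equation \<open>i\<close>.\<close>
    define x' where "x' = x(q := - S i / M i q)"
    have sum: "(\<Sum>j\<in>J. M r j * x' j) = S r - M r q * S i / M i q" for r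
    proof -
      have "(\<Sum>j\<in>J. M r j * x' j) = M r q * x' q + (\<Sum>j\<in>J - {q}. M r j * x' j)"
        by (rule sum.remove) (use insert q in auto)
      also have "(\<Sum>j\<in>J - {q}. M r j * x' j) = S r"
        unfolding S_def by (rule sum.cong) (auto simp: x'_def)
      finally show ?thesis by (simp add: x'_def)
    qed
    have "(\<Sum>j\<in>J. M r j * x' j) = 0" if "r \<in> insert i I" for r
    proof (cases "r = i")
      case True
      then show ?thesis using q by (simp add: sum)
    next
      case False
      then have "0 = (\<Sum>j\<in>J - {q}. M' r j * x j)" using that x by auto
      also have "\<dots> = S r - M r q * S i / M i q"
        unfolding S_def M'_def
        by (simp add: algebra_simps sum_subtractf sum_distrib_left sum_divide_distrib)
      finally show ?thesis by (simp add: sum)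
    qed
    moreover have "\<exists>j\<in>J. x' j \<noteq> 0" using x(1) by (auto simp: x'_def)
    ultimately show ?thesis by blast
  qed
qed

context quasi_chain
begin

text \<open>The chain with initial values \<open>x\<close> and source \<open>f\<close>, counted from the source downwards: entry \<open>j\<close>
  is the quasi-derivative of index \<open>n - j\<close>.\<close>

primrec iterated_integral :: "(nat \<Rightarrow> real) \<Rightarrow> (real \<Rightarrow> real) \<Rightarrow> nat \<Rightarrow> real \<Rightarrow> real" where
  "iterated_integral x f 0 = f"
| "iterated_integral x f (Suc j) =
     (\<lambda>t. x (n - Suc j) + integral {a..t} (\<lambda>s. w (n - Suc j) s * iterated_integral x f j s))"

definition chain_of :: "(nat \<Rightarrow> real) \<Rightarrow> (real \<Rightarrow> real) \<Rightarrow> nat \<Rightarrow> real \<Rightarrow> real" where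
  "chain_of x f i = iterated_integral x f (n - i)"

lemma chain_of_n [simp]: "chain_of x f n = f"
  by (simp add: chain_of_def)

lemma chain_of_init: "i < n \<Longrightarrow> chain_of x f i a = x i"
  unfolding chain_of_def by (cases "n - i") (auto simp: Suc_diff_Suc intro!: arg_cong[of _ _ x])

lemma chain_chain_of:
  assumes f: "continuous_on {a..b} f"
  shows "chain (chain_of x f)"
proof -
  have der: "(iterated_integral x f (Suc j) has_real_derivative
      w (n - Suc j) t * iterated_integral x f j t) (at t within {a..b})"
    if "continuous_on {a..b} (iterated_integral x f j)" "j < n" "t \<in> {a..b}" for j t
    using that n_pos w_cont[of "n - Suc j"]
    by (auto intro!: derivative_eq_intros integral_has_real_derivative continuous_intros)
  have cont: "continuous_on {a..b} (iterated_integral x f j)" if "j \<le> n" for j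
    using that
  proof (induction j)
    case (Suc j)
    then show ?case using DERIV_continuous_on[OF der, of j] by auto
  qed (use f in auto)
  show ?thesis unfolding chain_def
  proof (intro conjI allI impI ballI)
    fix i t assume i: "i < n" "t \<in> {a..b}"
    then have "n - i = Suc (n - Suc i)" "n - Suc (n - Suc i) = i" by auto
    then show "(chain_of x f i has_real_derivative w i t * chain_of x f (Suc i) t) (at t within {a..b})"
      using der[of "n - Suc i" t] cont[of "n - Suc i"] i n_pos unfolding chain_of_def by auto
  qed (use f in auto)
qed

lemma chain_sum:
  assumes "finite J" "\<And>j. j \<in> J \<Longrightarrow> chain (Y j)"
  shows "chain (\<lambda>i t. \<Sum>j\<in>J. c j * Y j i t)"
  using assms
proof (induction J rule: finite_induct)
  case empty
  then show ?case by (simp add: chain_def)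
next
  case (insert j J)
  then have "chain (\<lambda>i t. c j * Y j i t + 1 * (\<Sum>j\<in>J. c j * Y j i t))"
    by (intro chain_lincomb) auto
  then show ?case using insert by simp
qed

lemma weights_bounded:
  obtains W where "W > 0" "\<And>i t. i < n \<Longrightarrow> t \<in> {a..b} \<Longrightarrow> w i t \<le> W"
proof -
  have "\<exists>W>0. \<forall>t\<in>{a..b}. w i t \<le> W" if "i < n" for i
    using continuous_on_Icc_bounded[OF w_cont[OF that]] by (meson abs_le_D1)
  then obtain W where W: "\<And>i. i < n \<Longrightarrow> W i > 0 \<and> (\<forall>t\<in>{a..b}. w i t \<le> W i)" by metis
  have "w i t \<le> (\<Sum>i<n. W i)" if "i < n" "t \<in> {a..b}" for i t
  proof -
    have "w i t \<le> W i" using W[OF that(1)] that(2) by blast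
    also have "W i \<le> (\<Sum>i<n. W i)"
      by (rule member_le_sum) (use W that in \<open>auto intro: less_imp_le\<close>)
    finally show ?thesis .
  qed
  moreover have "(\<Sum>i<n. W i) > 0" using W n_pos by (intro sum_pos) auto
  ultimately show thesis using that by blast
qed

text \<open>In the norm with weight \<open>exp (K (t - a))\<close> each integration is small if \<open>K\<close> is large. This makes
  the series for the initial value problem converge on the whole interval.\<close>

lemma chain_exponential_bound:
  assumes y: "chain y" and zero: "\<And>i. i < n \<Longrightarrow> y i a = 0"
    and W: "\<And>i t. i < n \<Longrightarrow> t \<in> {a..b} \<Longrightarrow> w i t \<le> W" "W > 0" and K: "K > 0" and D: "D \<ge> 0"
    and le: "\<And>t. t \<in> {a..b} \<Longrightarrow> \<bar>y n t\<bar> \<le> D * exp (K * (t - a))"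
    and "i \<le> n" "t \<in> {a..b}"
  shows "\<bar>y i t\<bar> \<le> (W / K) ^ (n - i) * D * exp (K * (t - a))"
  using assms(8,9)
proof (induction i arbitrary: t rule: inc_induct)
  case (step i)
  define c where "c = (W / K) ^ (n - Suc i) * D"
  have c: "c \<ge> 0" using W K D by (simp add: c_def)
  have ni: "n - i = Suc (n - Suc i)" using step by auto
  have "\<bar>y i t\<bar> \<le> (W / K) * c * exp (K * (t - a))"
  proof (rule abs_le_of_derivative_le[OF _ _ _ _ step.prems, where g' = "\<lambda>t. w i t * y (Suc i) t"
        and h' = "\<lambda>t. W * c * exp (K * (t - a))"])
    fix t assume t: "t \<in> {a..b}"
    show "(y i has_real_derivative w i t * y (Suc i) t) (at t within {a..b})"
      using chain_deriv[OF y _ t] step by simp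
    show "((\<lambda>t. W / K * c * exp (K * (t - a))) has_real_derivative W * c * exp (K * (t - a))) (at t within {a..b})"
      using K by (auto intro!: derivative_eq_intros)
    have "\<bar>w i t * y (Suc i) t\<bar> \<le> W * (c * exp (K * (t - a)))"
      unfolding abs_mult
      by (rule mult_mono) (use W(1)[of i t] W(2) w_pos[of i t] step.hyps step.IH[OF t] t in \<open>auto simp: c_def\<close>)
    then show "\<bar>w i t * y (Suc i) t\<bar> \<le> W * c * exp (K * (t - a))" by (simp add: mult_ac)
  next
    show "\<bar>y i a\<bar> \<le> W / K * c * exp (K * (a - a))"
      using zero[of i] step.hyps c W K by simp
  qed
  then show ?case unfolding ni by (simp add: c_def mult_ac)
qed (use le in auto)

text \<open>The solution is the chain with the given data and source \<open>f + kappa u\<close>, where \<open>u\<close> is the sum of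
  the Neumann series whose terms \<open>z j\<close> are obtained by feeding \<open>kappa\<close> times the function of the
  previous chain back in as source.\<close>

lemma initial_value_problem:
  assumes f: "continuous_on {a..b} f"
  obtains y where "chain y" "\<And>t. t \<in> {a..b} \<Longrightarrow> y n t = kappa * y 0 t + f t" "\<And>i. i < n \<Longrightarrow> y i a = x i"
proof -
  obtain W where W: "W > 0" "\<And>i t. i < n \<Longrightarrow> t \<in> {a..b} \<Longrightarrow> w i t \<le> W"
    using weights_bounded by blast
  \<comment> \<open>Large enough for the ratio \<open>q\<close> of the series to be less than \<open>1\<close>.\<close>
  define K where "K = W * (1 + 2 * \<bar>kappa\<bar>)"
  define q where "q = \<bar>kappa\<bar> * (W / K) ^ n"
  have K: "K > 0" using W by (simp add: K_def add_pos_nonneg)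
  have WK: "W / K = 1 / (1 + 2 * \<bar>kappa\<bar>)" using W by (simp add: K_def)
  have "(W / K) ^ n \<le> (W / K) ^ 1"
    unfolding WK by (rule power_decreasing) (use n_pos in auto)
  then have "q \<le> \<bar>kappa\<bar> * (W / K)" unfolding q_def by (intro mult_left_mono) auto
  also have "\<dots> < 1" unfolding WK by (simp add: field_simps)
  finally have q1: "q < 1" .
  have q0: "q \<ge> 0" using W K by (simp add: q_def)
  \<comment> \<open>Only \<open>z 0\<close> carries the initial values, so that all later terms fall under the exponential bound.\<close>
  define z where "z = rec_nat (chain_of x f) (\<lambda>_ y. chain_of (\<lambda>_. 0) (\<lambda>t. kappa * y 0 t))"
  have z0: "z 0 = chain_of x f" and zS: "z (Suc j) = chain_of (\<lambda>_. 0) (\<lambda>t. kappa * z j 0 t)" for j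
    by (auto simp: z_def)
  have zc: "chain (z j)" for j
    by (induction j) (auto simp: z0 zS intro!: chain_chain_of f continuous_on_mult_left chain_cont[where i = 0])
  obtain D where D: "D > 0" "\<And>t. t \<in> {a..b} \<Longrightarrow> \<bar>z 0 0 t\<bar> \<le> D"
    using chain_bounded[OF zc, of 0 0] by auto
  define E where "E = D * exp (K * (b - a))"
  have zb: "\<forall>t\<in>{a..b}. \<bar>z j 0 t\<bar> \<le> q ^ j * D * exp (K * (t - a))" for j
  proof (induction j)
    case 0
    show ?case
    proof
      fix t assume t: "t \<in> {a..b}"
      have "\<bar>z 0 0 t\<bar> \<le> D * 1" using D t by simp
      also have "\<dots> \<le> D * exp (K * (t - a))"
        by (rule mult_left_mono) (use D K t in auto)
      finally show "\<bar>z 0 0 t\<bar> \<le> q ^ 0 * D * exp (K * (t - a))" by simp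
    qed
  next
    case (Suc j)
    show ?case
    proof
      fix t assume t: "t \<in> {a..b}"
      have "\<bar>z (Suc j) 0 t\<bar> \<le> (W / K) ^ (n - 0) * (\<bar>kappa\<bar> * (q ^ j * D)) * exp (K * (t - a))"
      proof (rule chain_exponential_bound[OF zc _ W(2,1) K _ _ _ t])
        show "z (Suc j) i a = 0" if "i < n" for i using that by (simp add: zS chain_of_init)
        show "0 \<le> \<bar>kappa\<bar> * (q ^ j * D)" using q0 D by simp
        fix t assume t: "t \<in> {a..b}"
        have "\<bar>z (Suc j) n t\<bar> = \<bar>kappa\<bar> * \<bar>z j 0 t\<bar>" by (simp add: zS abs_mult)
        also have "\<dots> \<le> \<bar>kappa\<bar> * (q ^ j * D * exp (K * (t - a)))"
          by (rule mult_left_mono) (use Suc t in auto)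
        finally show "\<bar>z (Suc j) n t\<bar> \<le> \<bar>kappa\<bar> * (q ^ j * D) * exp (K * (t - a))" by (simp add: mult_ac)
      qed auto
      then show "\<bar>z (Suc j) 0 t\<bar> \<le> q ^ Suc j * D * exp (K * (t - a))"
        by (simp add: q_def mult_ac)
    qed
  qed
  have zbE: "norm (z j 0 t) \<le> q ^ j * E" if t: "t \<in> {a..b}" for j t
  proof -
    have "\<bar>z j 0 t\<bar> \<le> q ^ j * D * exp (K * (t - a))" using zb t by blast
    also have "\<dots> \<le> q ^ j * D * exp (K * (b - a))"
      by (rule mult_left_mono) (use q0 D K t in auto)
    finally show ?thesis by (simp add: E_def mult_ac)
  qed
  define u where "u = (\<lambda>t. \<Sum>j. z j 0 t)"
  have ul: "uniform_limit {a..b} (\<lambda>N t. \<Sum>j<N. z j 0 t) u sequentially"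
    unfolding u_def
    by (rule Weierstrass_m_test[where M = "\<lambda>j. q ^ j * E"])
       (use zbE q0 q1 in \<open>auto intro!: summable_mult2 summable_geometric\<close>)
  have uc: "continuous_on {a..b} u"
    by (rule uniform_limit_theorem[OF _ ul])
       (auto intro!: always_eventually continuous_intros chain_cont zc)
  define y where "y = chain_of x (\<lambda>t. f t + kappa * u t)"
  have yc: "chain y" unfolding y_def by (intro chain_chain_of continuous_intros f uc)
  define S where "S N = (\<lambda>i t. \<Sum>j<N. 1 * z j i t)" for N
  have Sc: "chain (S N)" for N unfolding S_def by (rule chain_sum) (use zc in auto)
  have yu: "y 0 t = u t" if t: "t \<in> {a..b}" for t
  proof -
    have "(\<lambda>N. S (Suc N) 0 t) \<longlonglongrightarrow> y 0 t"
    proof (rule LIMSEQ_I)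
      fix r :: real assume r: "r > 0"
      define e where "e = r / (2 * (\<bar>kappa\<bar> + 1) * exp (K * (b - a)))"
      have e: "e > 0" using r by (simp add: e_def add_nonneg_pos)
      obtain N0 where N0: "\<And>N t. N \<ge> N0 \<Longrightarrow> t \<in> {a..b} \<Longrightarrow> dist (\<Sum>j<N. z j 0 t) (u t) < e"
        using uniform_limitD[OF ul e] unfolding eventually_sequentially by blast
      show "\<exists>N0. \<forall>N\<ge>N0. norm (S (Suc N) 0 t - y 0 t) < r"
      proof (intro exI[of _ N0] allI impI)
        fix N assume N: "N \<ge> N0"
        define v where "v = (\<lambda>i t. 1 * S (Suc N) i t + (-1) * y i t)"
        have vc: "chain v" unfolding v_def by (rule chain_lincomb[OF Sc yc])
        have "\<bar>v 0 t\<bar> \<le> (W / K) ^ (n - 0) * (\<bar>kappa\<bar> * e) * exp (K * (t - a))"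
        proof (rule chain_exponential_bound[OF vc _ W(2,1) K _ _ _ t])
          show "v i a = 0" if "i < n" for i
          proof -
            have "(\<Sum>j<Suc N. 1 * z j i a) = z 0 i a"
              using that by (simp add: sum.lessThan_Suc_shift zS chain_of_init del: sum.lessThan_Suc)
            then show ?thesis using that by (simp add: v_def S_def y_def z0 chain_of_init)
          qed
          show "0 \<le> \<bar>kappa\<bar> * e" using e by simp
          fix t assume t: "t \<in> {a..b}"
          have "v n t = kappa * ((\<Sum>j<N. z j 0 t) - u t)"
            by (simp add: v_def S_def y_def z0 zS sum.lessThan_Suc_shift sum_distrib_left algebra_simps del: sum.lessThan_Suc)
          then have "\<bar>v n t\<bar> \<le> \<bar>kappa\<bar> * e * 1"
            using N0[OF N t] by (auto simp: abs_mult dist_real_def intro!: mult_left_mono)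
          also have "\<dots> \<le> \<bar>kappa\<bar> * e * exp (K * (t - a))"
            by (rule mult_left_mono) (use e K t in auto)
          finally show "\<bar>v n t\<bar> \<le> \<bar>kappa\<bar> * e * exp (K * (t - a))" .
        qed auto
        also have "\<dots> = q * (e * exp (K * (t - a)))" by (simp add: q_def)
        also have "\<dots> \<le> 1 * (e * exp (K * (b - a)))"
          by (rule mult_mono) (use q1 e K t in auto)
        also have "\<dots> = r / (2 * (\<bar>kappa\<bar> + 1))" by (simp add: e_def)
        also have "\<dots> < r / 1" using r by (intro divide_strict_left_mono) auto
        also have "\<dots> = r" by simp
        finally show "norm (S (Suc N) 0 t - y 0 t) < r" by (simp add: v_def)
      qed
    qed
    moreover have "(\<lambda>N. S N 0 t) \<longlonglongrightarrow> u t"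
      using tendsto_uniform_limitI[OF ul t] by (simp add: S_def)
    then have "(\<lambda>N. S (Suc N) 0 t) \<longlonglongrightarrow> u t" by (rule LIMSEQ_Suc)
    ultimately show ?thesis by (rule LIMSEQ_unique)
  qed
  show thesis
  proof (rule that[of y])
    show "y n t = kappa * y 0 t + f t" if "t \<in> {a..b}" for t
      using yu[OF that] by (simp add: y_def)
    show "y i a = x i" if "i < n" for i using that by (simp add: y_def chain_of_init)
  qed (rule yc)
qed

text \<open>Injectivity implies surjectivity: the initial values and the amplitude of the data are
  \<open>n + 1\<close> unknowns for \<open>n\<close> linear equations, and uniqueness excludes the amplitude \<open>0\<close>.\<close>

lemma boundary_value_problem:
  assumes AB: "A \<subseteq> {..<n}" "B \<subseteq> {..<n}" "card A + card B = n"
    and uniq: "\<And>y t. chain y \<Longrightarrow> bc A B y \<Longrightarrow> (\<And>t. t \<in> {a..b} \<Longrightarrow> y n t = kappa * y 0 t) \<Longrightarrow>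
        t \<in> {a..b} \<Longrightarrow> y 0 t = 0"
    and f: "continuous_on {a..b} f"
  obtains y where "chain y" "\<And>t. t \<in> {a..b} \<Longrightarrow> y n t = kappa * y 0 t + f t"
    "\<And>i. i \<in> A \<Longrightarrow> y i a = c i" "\<And>i. i \<in> B \<Longrightarrow> y i b = 0"
proof -
  have "\<exists>y. chain y \<and> (\<forall>t\<in>{a..b}. y n t = kappa * y 0 t + of_bool (j = n) * f t) \<and>
      (\<forall>i<n. y i a = of_bool (i = j))" for j
  proof -
    have "continuous_on {a..b} (\<lambda>t. of_bool (j = n) * f t)" by (intro continuous_intros f)
    then obtain y where "chain y" "\<And>t. t \<in> {a..b} \<Longrightarrow> y n t = kappa * y 0 t + of_bool (j = n) * f t"
      "\<And>i. i < n \<Longrightarrow> y i a = of_bool (i = j)"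
      by (rule initial_value_problem[where kappa = kappa and x = "\<lambda>i. of_bool (i = j)"]) iprover
    then show ?thesis by (intro exI[of _ y]) simp
  qed
  then obtain Y where Y: "\<And>j. chain (Y j)" "\<And>j i. i < n \<Longrightarrow> Y j i a = of_bool (i = j)"
    "\<And>j t. t \<in> {a..b} \<Longrightarrow> Y j n t = kappa * Y j 0 t + of_bool (j = n) * f t"
    by metis
  \<comment> \<open>The unknown of index \<open>n\<close> is the amplitude of the data.\<close>
  define M where "M = (\<lambda>e j. case e of Inl i \<Rightarrow> Y j i a - of_bool (j = n) * c i | Inr i \<Rightarrow> Y j i b)"
  have fin: "finite A" "finite B" using AB finite_subset by blast+
  have "card (A <+> B) < card {..n}" using fin AB(3) by (simp add: card_Plus)
  then obtain x where x: "\<exists>j\<in>{..n}. x j \<noteq> 0" "\<forall>e\<in>A <+> B. (\<Sum>j\<le>n. M e j * x j) = 0"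
    using nontrivial_solution_of_underdetermined_system[of "A <+> B" "{..n}" M] fin by auto
  define y where "y = (\<lambda>i t. \<Sum>j\<le>n. x j * Y j i t)"
  have yc: "chain y" unfolding y_def by (rule chain_sum) (use Y in auto)
  have yn: "y n t = kappa * y 0 t + x n * f t" if t: "t \<in> {a..b}" for t
  proof -
    have "y n t = (\<Sum>j\<le>n. kappa * (x j * Y j 0 t) + (if j = n then x n * f t else 0))"
      unfolding y_def by (rule sum.cong) (use Y(3)[OF t] in \<open>auto simp: algebra_simps\<close>)
    then show ?thesis by (simp add: sum.distrib y_def sum_distrib_left)
  qed
  have ya: "y i a = x n * c i" if "i \<in> A" for i
  proof -
    have "0 = (\<Sum>j\<le>n. M (Inl i) j * x j)" using x that by auto
    also have "\<dots> = (\<Sum>j\<le>n. x j * Y j i a - (if j = n then x n * c i else 0))"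
      unfolding M_def by (rule sum.cong) (auto simp: algebra_simps)
    also have "\<dots> = y i a - x n * c i" by (simp add: sum_subtractf y_def)
    finally show ?thesis by simp
  qed
  have yb: "y i b = 0" if "i \<in> B" for i
    using x(2)[rule_format, OF InrI[OF that]] by (simp add: M_def y_def mult.commute)
  have init: "y i a = x i" if "i < n" for i
  proof -
    have "y i a = (\<Sum>j\<le>n. if j = i then x i else 0)"
      unfolding y_def by (rule sum.cong) (use Y(2)[OF that] in auto)
    then show ?thesis using that by simp
  qed
  have "x n \<noteq> 0"
  proof
    assume xn: "x n = 0"
    have bcy: "bc A B y" using ya yb xn by (simp add: bc_def)
    have "y 0 t = 0" if "t \<in> {a..b}" for t
      by (rule uniq[OF yc bcy _ that]) (simp add: yn xn)
    then have "y i a = 0" if "i < n" for i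
      by (rule chain_zero[OF yc]) (use that ab in simp_all)
    then have "x j = 0" if "j \<le> n" for j
      using init xn that by (cases "j = n") auto
    then show False using x(1) by auto
  qed
  then show thesis
    by (intro that[of "\<lambda>i t. (1 / x n) * y i t"] chain_scale yc)
       (auto simp: yn ya yb field_simps)
qed

lemma uniqueness:
  assumes P: "poised A B" and y: "chain y" "bc A B y" and z: "\<And>t. t \<in> {a..b} \<Longrightarrow> y n t = 0"
    and t: "t \<in> {a..b}"
  shows "y 0 t = 0"
  using inverse_positivity[OF P y, of t]
    inverse_positivity[OF P chain_scale[OF y(1), of "-1"] bc_scale[OF y(2), of "-1"], of t] z t by auto

lemma green:
  assumes P: "poised A B" and f: "continuous_on {a..b} f"
  obtains y where "chain y" "bc A B y" "\<And>t. t \<in> {a..b} \<Longrightarrow> rho A * y n t = f t"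
proof -
  have AB: "A \<subseteq> {..<n}" "B \<subseteq> {..<n}" "card A + card B = n" using P by (auto simp: poised_def)
  obtain y where "chain y" "\<And>t. t \<in> {a..b} \<Longrightarrow> y n t = 0 * y 0 t + rho A * f t"
    "\<And>i. i \<in> A \<Longrightarrow> y i a = 0" "\<And>i. i \<in> B \<Longrightarrow> y i b = 0"
  proof (rule boundary_value_problem[OF AB, of 0 "\<lambda>t. rho A * f t" "\<lambda>_. 0"])
    show "continuous_on {a..b} (\<lambda>t. rho A * f t)" by (intro continuous_intros f)
  qed (use uniqueness[OF P] in auto)
  then show thesis by (intro that[of y]) (auto simp: bc_def)
qed

lemma green_mono:
  assumes P: "poised A B" and y: "chain y" "bc A B y" and z: "chain z" "bc A B z"
    and le: "\<And>t. t \<in> {a..b} \<Longrightarrow> rho A * y n t \<le> rho A * z n t" and t: "t \<in> {a..b}"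
  shows "y 0 t \<le> z 0 t"
proof -
  have "0 \<le> 1 * z 0 t + (-1) * y 0 t"
    by (rule inverse_positivity[OF P chain_lincomb[OF z(1) y(1)] bc_lincomb[OF z(2) y(2)] _ t])
       (use le in \<open>auto simp: algebra_simps\<close>)
  then show ?thesis by simp
qed

lemma green_limit:
  assumes P: "poised A B" and Y: "\<And>m. chain (Y m)" "\<And>m. bc A B (Y m)"
    and g: "continuous_on {a..b} g"
    and lim: "\<And>m t. t \<in> {a..b} \<Longrightarrow> \<bar>rho A * Y m n t - g t\<bar> \<le> d m" "d \<longlonglongrightarrow> 0"
  obtains y where "chain y" "bc A B y" "\<And>t. t \<in> {a..b} \<Longrightarrow> rho A * y n t = g t"
    "\<And>t. t \<in> {a..b} \<Longrightarrow> (\<lambda>m. Y m 0 t) \<longlonglongrightarrow> y 0 t"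
proof -
  obtain y where y: "chain y" "bc A B y" "\<And>t. t \<in> {a..b} \<Longrightarrow> rho A * y n t = g t"
    using green[OF P g] by blast
  obtain C where C: "C \<ge> 0" "\<And>y K t. chain y \<Longrightarrow> bc A B y \<Longrightarrow> (\<forall>t\<in>{a..b}. \<bar>y n t\<bar> \<le> K) \<Longrightarrow>
      t \<in> {a..b} \<Longrightarrow> \<bar>y 0 t\<bar> \<le> C * K" using chain_norm_bound[OF P, of 0] by blast
  have "(\<lambda>m. Y m 0 t) \<longlonglongrightarrow> y 0 t" if t: "t \<in> {a..b}" for t
  proof (rule LIM_zero_cancel, rule Lim_null_comparison)
    show "\<forall>\<^sub>F m in sequentially. norm (Y m 0 t - y 0 t) \<le> C * d m"
    proof (intro always_eventually allI)
      fix m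
      have "\<bar>1 * Y m 0 t + (-1) * y 0 t\<bar> \<le> C * d m"
      proof (rule C(2)[OF chain_lincomb[OF Y(1) y(1)] bc_lincomb[OF Y(2) y(2)] _ t], rule ballI)
        fix t assume t: "t \<in> {a..b}"
        have "\<bar>1 * Y m n t + (-1) * y n t\<bar> = \<bar>rho A\<bar> * \<bar>Y m n t - y n t\<bar>" by (simp add: rho_def)
        also have "\<dots> = \<bar>rho A * Y m n t - g t\<bar>"
          using y(3)[OF t] by (simp add: algebra_simps flip: abs_mult)
        finally show "\<bar>1 * Y m n t + (-1) * y n t\<bar> \<le> d m" using lim(1)[OF t, of m] by simp
      qed
      then show "norm (Y m 0 t - y 0 t) \<le> C * d m" by simp
    qed
    show "(\<lambda>m. C * d m) \<longlonglongrightarrow> 0" using tendsto_mult_left[OF lim(2), of C] by simp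
  qed
  with y show thesis using that by blast
qed

text \<open>The first quasi-derivatives are uniformly bounded, so the functions are equicontinuous. The
  majorant \<open>d\<close> expresses uniform convergence in the form that \<open>green_limit\<close> takes as input.\<close>

lemma green_compact:
  assumes P: "poised A B" and Y: "\<And>m. chain (Y m)" "\<And>m. bc A B (Y m)"
    and bd: "\<And>m t. t \<in> {a..b} \<Longrightarrow> \<bar>Y m n t\<bar> \<le> K"
  obtains g r d where "continuous_on {a..b} g" "strict_mono (r :: nat \<Rightarrow> nat)" "d \<longlonglongrightarrow> 0"
    "\<And>m t. t \<in> {a..b} \<Longrightarrow> \<bar>Y (r m) 0 t - g t\<bar> \<le> d m"
proof -
  obtain C where C: "C \<ge> 0" "\<And>y K t. chain y \<Longrightarrow> bc A B y \<Longrightarrow> (\<forall>t\<in>{a..b}. \<bar>y n t\<bar> \<le> K) \<Longrightarrow>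
      t \<in> {a..b} \<Longrightarrow> \<bar>y 0 t\<bar> \<le> C * K" using chain_norm_bound[OF P, of 0] by blast
  obtain C' where C': "C' \<ge> 0" "\<And>y K t. chain y \<Longrightarrow> bc A B y \<Longrightarrow> (\<forall>t\<in>{a..b}. \<bar>y n t\<bar> \<le> K) \<Longrightarrow>
      t \<in> {a..b} \<Longrightarrow> \<bar>y 1 t\<bar> \<le> C' * K" using chain_norm_bound[OF P, of 1] n_pos by auto
  obtain W where W: "W > 0" "\<And>i t. i < n \<Longrightarrow> t \<in> {a..b} \<Longrightarrow> w i t \<le> W"
    using weights_bounded by blast
  have K: "K \<ge> 0" using bd[of a 0] ab by auto
  define L where "L = W * (C' * K) + 1"
  have L: "L > 0" using W C' K by (simp add: L_def add_nonneg_pos)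
  have lip: "norm (Y m 0 x - Y m 0 y) \<le> L * norm (x - y)" if xy: "x \<in> {a..b}" "y \<in> {a..b}" for m x y
  proof (rule field_differentiable_bound[OF convex_real_interval(5)])
    fix s assume s: "s \<in> {a..b}"
    show "(Y m 0 has_real_derivative w 0 s * Y m 1 s) (at s within {a..b})"
      using chain_deriv[OF Y(1) n_pos s] by simp
    have "\<bar>w 0 s\<bar> * \<bar>Y m 1 s\<bar> \<le> W * (C' * K)"
      by (rule mult_mono) (use W s n_pos w_pos[OF n_pos s] C'(2)[OF Y] bd in auto)
    then show "norm (w 0 s * Y m 1 s) \<le> L" by (simp add: L_def abs_mult)
  qed (use xy in auto)
  obtain g r where g: "continuous_on {a..b} g" "strict_mono (r :: nat \<Rightarrow> nat)"
    "\<And>e. 0 < e \<Longrightarrow> \<exists>N. \<forall>m x. m \<ge> N \<and> x \<in> {a..b} \<longrightarrow> norm (Y (r m) 0 x - g x) < e"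
  proof (rule Arzela_Ascoli[of "{a..b}" "\<lambda>m. Y m 0" "C * K"])
    show "norm (Y m 0 x) \<le> C * K" if "x \<in> {a..b}" for m x
      using C(2)[OF Y _ that] bd by auto
    fix x e :: real assume x: "x \<in> {a..b}" "0 < e"
    show "\<exists>d>0. \<forall>m y. y \<in> {a..b} \<and> norm (x - y) < d \<longrightarrow> norm (Y m 0 x - Y m 0 y) < e"
    proof (intro exI[of _ "e / L"] conjI allI impI)
      fix m y assume y: "y \<in> {a..b} \<and> norm (x - y) < e / L"
      have "norm (Y m 0 x - Y m 0 y) \<le> L * norm (x - y)" using lip x y by blast
      also have "\<dots> < e" using y L by (simp add: field_simps)
      finally show "norm (Y m 0 x - Y m 0 y) < e" .
    qed (use x L in auto)
  qed auto
  define d where "d m = (SUP t\<in>{a..b}. \<bar>Y (r m) 0 t - g t\<bar>)" for m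
  have bdd: "bdd_above ((\<lambda>t. \<bar>Y (r m) 0 t - g t\<bar>) ` {a..b})" for m
    by (intro bounded_imp_bdd_above compact_imp_bounded compact_continuous_image continuous_intros
        chain_cont Y g compact_Icc) auto
  have le: "\<bar>Y (r m) 0 t - g t\<bar> \<le> d m" if "t \<in> {a..b}" for m t
    unfolding d_def using bdd that by (rule cSUP_upper2[OF _ _ order_refl])
  have "d \<longlonglongrightarrow> 0"
  proof (rule LIMSEQ_I)
    fix e :: real assume e: "e > 0"
    then obtain N where N: "\<And>m x. m \<ge> N \<Longrightarrow> x \<in> {a..b} \<Longrightarrow> norm (Y (r m) 0 x - g x) < e / 2"
      using g(3)[of "e / 2"] by auto
    show "\<exists>N. \<forall>m\<ge>N. norm (d m - 0) < e"
    proof (intro exI[of _ N] allI impI)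
      fix m assume m: "m \<ge> N"
      have "d m \<le> e / 2"
        unfolding d_def by (rule cSUP_least) (use N[OF m] ab in \<open>auto intro: less_imp_le\<close>)
      moreover have "0 \<le> d m" using le[of a m] ab by auto
      ultimately show "norm (d m - 0) < e" using e by simp
    qed
  qed
  then show thesis using that g le by blast
qed

section \<open>The principal eigenvalue\<close>

text \<open>A nonnegative solution of the equation with spectral parameter \<open>lam\<close> and source \<open>1\<close>. Such a
  solution exists for \<open>lam = 0\<close>, and the principal eigenvalue is where it ceases to exist.\<close>

definition resolvent_one :: "nat set \<Rightarrow> nat set \<Rightarrow> real \<Rightarrow> (nat \<Rightarrow> real \<Rightarrow> real) \<Rightarrow> bool" where
  "resolvent_one A B lam u \<longleftrightarrow> chain u \<and> bc A B u \<and> (\<forall>t\<in>{a..b}. u 0 t \<ge> 0) \<and>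
     (\<forall>t\<in>{a..b}. rho A * u n t = lam * u 0 t + 1)"

text \<open>For \<open>2 K e \<le> 1\<close> the function \<open>2 u\<close> is a supersolution for the parameter \<open>lam + e\<close>. The monotone
  iteration that starts at \<open>0\<close> stays below it and converges to a solution.\<close>

lemma resolvent_one_extends:
  assumes P: "poised A B" and u: "resolvent_one A B lam u" and K: "\<And>t. t \<in> {a..b} \<Longrightarrow> u 0 t \<le> K"
    and lam: "lam \<ge> 0" and e: "e \<ge> 0" "2 * K * e \<le> 1"
  shows "\<exists>v. resolvent_one A B (lam + e) v"
proof -
  have u': "chain u" "bc A B u" "\<And>t. t \<in> {a..b} \<Longrightarrow> u 0 t \<ge> 0"
    "\<And>t. t \<in> {a..b} \<Longrightarrow> rho A * u n t = lam * u 0 t + 1" using u by (auto simp: resolvent_one_def)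
  have "\<forall>f. \<exists>y. continuous_on {a..b} f \<longrightarrow> chain y \<and> bc A B y \<and> (\<forall>t\<in>{a..b}. rho A * y n t = f t)"
    using green[OF P] by metis
  then obtain G where G: "\<And>f. continuous_on {a..b} f \<Longrightarrow> chain (G f) \<and> bc A B (G f)"
    "\<And>f t. continuous_on {a..b} f \<Longrightarrow> t \<in> {a..b} \<Longrightarrow> rho A * G f n t = f t" by metis
  define l where "l = lam + e"
  have l: "l \<ge> 0" using lam e by (simp add: l_def)
  define v where "v = rec_nat (\<lambda>_ _. 0) (\<lambda>_ y. G (\<lambda>t. l * y 0 t + 1))"
  have v0: "v 0 = (\<lambda>_ _. 0)" and vS: "v (Suc j) = G (\<lambda>t. l * v j 0 t + 1)" for j
    by (auto simp: v_def)
  have vc: "chain (v j) \<and> bc A B (v j)" for j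
  proof (induction j)
    case 0
    then show ?case by (simp add: v0 chain_def bc_def)
  next
    case (Suc j)
    then show ?case unfolding vS by (intro G(1) continuous_on_add continuous_on_mult_left continuous_on_const chain_cont[where i = 0]) auto
  qed
  have vcont: "continuous_on {a..b} (v j 0)" for j using chain_cont[of "v j" 0] vc by simp
  have vn: "rho A * v (Suc j) n t = l * v j 0 t + 1" if "t \<in> {a..b}" for j t
    unfolding vS by (rule G(2)[OF _ that]) (intro continuous_on_add continuous_on_mult_left continuous_on_const vcont)
  have v_mono: "\<forall>t\<in>{a..b}. 0 \<le> v j 0 t \<and> v j 0 t \<le> v (Suc j) 0 t" for j
  proof (induction j)
    case 0
    have "v 1 0 t \<ge> 0" if "t \<in> {a..b}" for t
      by (rule inverse_positivity[OF P _ _ _ that]) (use vc[of 1] vn[of _ 0] in \<open>auto simp: v0\<close>)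
    then show ?case by (auto simp: v0)
  next
    case (Suc j)
    show ?case
    proof
      fix t assume t: "t \<in> {a..b}"
      have "v (Suc j) 0 t \<le> v (Suc (Suc j)) 0 t"
        by (rule green_mono[OF P _ _ _ _ _ t]) (use vc Suc l in \<open>auto simp: vn intro: mult_left_mono\<close>)
      then show "0 \<le> v (Suc j) 0 t \<and> v (Suc j) 0 t \<le> v (Suc (Suc j)) 0 t" using Suc t by (meson order_trans)
    qed
  qed
  have v_le: "\<forall>t\<in>{a..b}. v j 0 t \<le> 2 * u 0 t" for j
  proof (induction j)
    case 0
    then show ?case using u'(3) by (auto simp: v0)
  next
    case (Suc j)
    show ?case
    proof
      fix t assume t: "t \<in> {a..b}"
      show "v (Suc j) 0 t \<le> 2 * u 0 t"
      proof (rule green_mono[OF P _ _ chain_scale[OF u'(1)] bc_scale[OF u'(2)] _ t])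
        fix t assume t: "t \<in> {a..b}"
        have "l * v j 0 t \<le> l * (2 * u 0 t)" by (rule mult_left_mono) (use Suc t l in auto)
        also have "\<dots> = 2 * (lam * u 0 t) + e * 2 * u 0 t" by (simp add: l_def algebra_simps)
        also have "e * 2 * u 0 t \<le> e * 2 * K" by (rule mult_left_mono) (use K[OF t] e in auto)
        finally have "l * v j 0 t + 1 \<le> 2 * (lam * u 0 t + 1)" using e by (simp add: mult_ac)
        also have "\<dots> = rho A * (2 * u n t)" using u'(4)[OF t] by simp
        finally show "rho A * v (Suc j) n t \<le> rho A * (2 * u n t)" using vn[OF t] by simp
      qed (use vc in auto)
    qed
  qed
  have incr: "v i 0 t \<le> v j 0 t" if "i \<le> j" "t \<in> {a..b}" for i j t
    using that(1) by (rule lift_Suc_mono_le[where f = "\<lambda>j. v j 0 t", rotated]) (use v_mono that in auto)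
  have K0: "K \<ge> 0" using K[of a] u'(3)[of a] ab by force
  have bd: "\<bar>v j n t\<bar> \<le> l * (2 * K) + 1" if t: "t \<in> {a..b}" for j t
  proof (cases j)
    case 0
    then show ?thesis using l K0 by (simp add: v0)
  next
    case (Suc i)
    have "v i 0 t \<le> 2 * u 0 t" using v_le t by blast
    then have "v i 0 t \<le> 2 * K" using K[OF t] by linarith
    then have "l * v i 0 t \<le> l * (2 * K)" using l by (intro mult_left_mono)
    moreover have "0 \<le> l * v i 0 t" using v_mono t l by auto
    ultimately have "\<bar>rho A * v j n t\<bar> \<le> l * (2 * K) + 1" using vn[OF t] Suc by simp
    then show ?thesis by (simp add: abs_mult rho_def)
  qed
  obtain g r d where g: "continuous_on {a..b} g" "strict_mono (r :: nat \<Rightarrow> nat)" "d \<longlonglongrightarrow> 0"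
    "\<And>m t. t \<in> {a..b} \<Longrightarrow> \<bar>v (r m) 0 t - g t\<bar> \<le> d m"
    by (rule green_compact[OF P, of v "l * (2 * K) + 1"]) (use vc bd in auto)
  obtain y where y: "chain y" "bc A B y" "\<And>t. t \<in> {a..b} \<Longrightarrow> rho A * y n t = l * g t + 1"
    "\<And>t. t \<in> {a..b} \<Longrightarrow> (\<lambda>m. v (Suc (r m)) 0 t) \<longlonglongrightarrow> y 0 t"
  proof (rule green_limit[OF P, of "\<lambda>m. v (Suc (r m))" "\<lambda>t. l * g t + 1" "\<lambda>m. l * d m"])
    show "continuous_on {a..b} (\<lambda>t. l * g t + 1)" by (intro continuous_intros g)
    show "(\<lambda>m. l * d m) \<longlonglongrightarrow> 0" using tendsto_mult_left[OF g(3), of l] by simp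
    fix m t assume t: "t \<in> {a..b}"
    have "rho A * v (Suc (r m)) n t - (l * g t + 1) = l * (v (r m) 0 t - g t)"
      using vn[OF t] by (simp add: algebra_simps)
    then show "\<bar>rho A * v (Suc (r m)) n t - (l * g t + 1)\<bar> \<le> l * d m"
      using g(4)[OF t, of m] l by (simp add: abs_mult mult_left_mono)
  qed (use vc in auto)
  have gy: "g t = y 0 t" if t: "t \<in> {a..b}" for t
  proof -
    have lim: "(\<lambda>m. v (r m) 0 t) \<longlonglongrightarrow> g t"
    proof (rule LIM_zero_cancel, rule Lim_null_comparison[OF _ g(3)])
      show "\<forall>\<^sub>F m in sequentially. norm (v (r m) 0 t - g t) \<le> d m" using g(4)[OF t] by simp
    qed
    have "g t \<le> y 0 t"
      by (rule LIMSEQ_le[OF lim y(4)[OF t]]) (use incr t in auto)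
    moreover have "y 0 t \<le> g t"
    proof (rule LIMSEQ_le[OF y(4)[OF t] LIMSEQ_Suc[OF lim]])
      show "\<exists>N. \<forall>m\<ge>N. v (Suc (r m)) 0 t \<le> v (r (Suc m)) 0 t"
        using g(2) t by (auto intro!: incr simp: strict_mono_Suc_iff Suc_leI)
    qed
    ultimately show ?thesis by simp
  qed
  have "resolvent_one A B l y"
    unfolding resolvent_one_def
  proof (intro conjI ballI)
    fix t assume t: "t \<in> {a..b}"
    show "rho A * y n t = l * y 0 t + 1" using y(3)[OF t] gy[OF t] by simp
    show "0 \<le> y 0 t"
      by (rule LIMSEQ_le_const[OF y(4)[OF t]]) (use v_mono t in auto)
  qed (use y in auto)
  then show ?thesis by (auto simp: l_def)
qed

text \<open>Let \<open>e\<close> be the solution with source \<open>1\<close> and \<open>h\<close> the one with source \<open>e\<close>, and let \<open>e \<le> C h\<close>.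
  From \<open>u \<ge> c e\<close> one gets \<open>u \<ge> lam c h \<ge> (lam / C) c e\<close>. For \<open>lam > C\<close> this could be iterated
  indefinitely.\<close>

lemma resolvent_one_bounded:
  assumes P: "poised A B"
  obtains C where "\<And>lam u. lam \<ge> 0 \<Longrightarrow> resolvent_one A B lam u \<Longrightarrow> lam \<le> C"
proof -
  obtain e where e: "chain e" "bc A B e" "\<And>t. t \<in> {a..b} \<Longrightarrow> rho A * e n t = 1"
    using green[OF P, of "\<lambda>_. 1"] by auto
  have e0: "e 0 t \<ge> 0" if "t \<in> {a..b}" for t
    by (rule inverse_positivity[OF P e(1,2) _ that]) (use e in auto)
  have ne: "\<exists>t\<in>{a..b}. e 0 t \<noteq> 0"
  proof (rule ccontr)
    assume "\<not> ?thesis"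
    then have "e n a = 0" using chain_zero[OF e(1), of n a] ab by auto
    then show False using e(3)[of a] ab by auto
  qed
  obtain h where h: "chain h" "bc A B h" "\<And>t. t \<in> {a..b} \<Longrightarrow> rho A * h n t = e 0 t"
    using green[OF P chain_cont[OF e(1)]] by auto
  have nh: "\<exists>t\<in>{a..b}. h 0 t \<noteq> 0"
  proof (rule ccontr)
    assume "\<not> ?thesis"
    then have "h n t = 0" if "t \<in> {a..b}" for t using chain_zero[OF h(1), of n t] that by auto
    then show False using h(3) ne by auto
  qed
  obtain C where C: "C > 0" "\<And>t. t \<in> {a..b} \<Longrightarrow> \<bar>e 0 t\<bar> \<le> C * h 0 t"
    using comparability[OF P h(1,2) _ nh e(1,2)] h(3) e0 by auto
  show thesis
  proof (rule that[of C], rule ccontr)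
    fix lam u assume lam: "lam \<ge> 0" and u: "resolvent_one A B lam u" and "\<not> lam \<le> C"
    then have lC: "lam > C" by simp
    define q where "q = lam / C"
    have q: "q > 1" using lC C by (simp add: q_def)
    have u': "chain u" "bc A B u" "\<And>t. t \<in> {a..b} \<Longrightarrow> u 0 t \<ge> 0"
      "\<And>t. t \<in> {a..b} \<Longrightarrow> rho A * u n t = lam * u 0 t + 1" using u by (auto simp: resolvent_one_def)
    have it: "\<forall>t\<in>{a..b}. q ^ j * e 0 t \<le> u 0 t" for j
    proof (induction j)
      case 0
      have "e 0 t \<le> u 0 t" if "t \<in> {a..b}" for t
        by (rule green_mono[OF P e(1,2) u'(1,2) _ that]) (use e u' lam in auto)
      then show ?case by simp
    next
      case (Suc j)
      show ?case
      proof
        fix t assume t: "t \<in> {a..b}"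
        have "q ^ Suc j * e 0 t = q ^ j * lam * (e 0 t / C)" by (simp add: q_def)
        also have "\<dots> \<le> q ^ j * lam * h 0 t"
          by (rule mult_left_mono) (use C(1) C(2)[OF t] q lam in \<open>auto simp: field_simps\<close>)
        also have "q ^ j * lam * h 0 t \<le> u 0 t"
        proof (rule green_mono[OF P chain_scale[OF h(1)] bc_scale[OF h(2)] u'(1,2) _ t])
          fix t assume t: "t \<in> {a..b}"
          have "rho A * (q ^ j * lam * h n t) = lam * (q ^ j * e 0 t)" using h(3)[OF t] by (simp add: algebra_simps)
          also have "\<dots> \<le> lam * u 0 t" by (rule mult_left_mono) (use Suc t lam in auto)
          also have "\<dots> \<le> rho A * u n t" using u'(4)[OF t] by simp
          finally show "rho A * (q ^ j * lam * h n t) \<le> rho A * u n t" .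
        qed
        finally show "q ^ Suc j * e 0 t \<le> u 0 t" .
      qed
    qed
    obtain t where t: "t \<in> {a..b}" "e 0 t > 0" using ne e0 by force
    obtain j where "q ^ j > u 0 t / e 0 t" using real_arch_pow[OF q] by blast
    then have "q ^ j * e 0 t > u 0 t" using t by (simp add: field_simps)
    then show False using it[of j] t by (meson not_le)
  qed
qed

text \<open>At the supremum \<open>ls\<close> of the parameters that admit a nonnegative solution with source \<open>1\<close>, these
  solutions blow up, since a bound \<open>K\<close> would allow an extension by \<open>1 / (2 K)\<close>. Normalised by their
  maxima they converge along a subsequence, and the source \<open>1\<close> disappears in the limit.\<close>

theorem principal_eigenvalue_exists:
  assumes P: "poised A B"
  obtains lam z where "lam > 0" "eigenchain A B lam z" "\<And>t. t \<in> {a..b} \<Longrightarrow> z 0 t \<ge> 0"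
proof -
  define L where "L = {lam. lam \<ge> 0 \<and> (\<exists>u. resolvent_one A B lam u)}"
  define ls where "ls = Sup L"
  have "0 \<in> L"
  proof -
    obtain e where e: "chain e" "bc A B e" "\<And>t. t \<in> {a..b} \<Longrightarrow> rho A * e n t = 1"
      using green[OF P, of "\<lambda>_. 1"] by auto
    have "e 0 t \<ge> 0" if "t \<in> {a..b}" for t
      by (rule inverse_positivity[OF P e(1,2) _ that]) (use e in auto)
    then have "resolvent_one A B 0 e" using e by (simp add: resolvent_one_def)
    then show ?thesis by (auto simp: L_def)
  qed
  obtain C where "\<And>lam u. lam \<ge> 0 \<Longrightarrow> resolvent_one A B lam u \<Longrightarrow> lam \<le> C"
    using resolvent_one_bounded[OF P] by blast
  then have bdd: "bdd_above L" by (auto simp: L_def bdd_above_def)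
  have ls0: "ls \<ge> 0" unfolding ls_def using \<open>0 \<in> L\<close> bdd by (rule cSup_upper)
  have "\<exists>lam u x. 0 \<le> lam \<and> lam \<le> ls \<and> ls - lam \<le> 1 / real (Suc m) \<and> resolvent_one A B lam u \<and>
      x \<in> {a..b} \<and> (\<forall>t\<in>{a..b}. u 0 t \<le> u 0 x) \<and> u 0 x > real (Suc m)" for m
  proof -
    \<comment> \<open>The admissible extension if \<open>u\<close> were bounded by \<open>Suc m\<close>.\<close>
    define e where "e = 1 / (2 * real (Suc m))"
    have e: "e > 0" "2 * real (Suc m) * e = 1" "e \<le> 1 / real (Suc m)" by (auto simp: e_def field_simps)
    obtain lam where lam: "lam \<in> L" "lam > ls - e"
      using less_cSup_iff[OF _ bdd, of "ls - e"] \<open>0 \<in> L\<close> e unfolding ls_def by fastforce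
    then obtain u where u: "resolvent_one A B lam u" "lam \<ge> 0" by (auto simp: L_def)
    then have "continuous_on {a..b} (u 0)" by (auto simp: resolvent_one_def intro: chain_cont)
    then obtain x where x: "x \<in> {a..b}" "\<forall>t\<in>{a..b}. u 0 t \<le> u 0 x"
      using continuous_attains_sup[of "{a..b}" "u 0"] ab by auto
    have "u 0 x > real (Suc m)"
    proof (rule ccontr)
      assume "\<not> ?thesis"
      then have "u 0 t \<le> real (Suc m)" if "t \<in> {a..b}" for t using x that by force
      then have "lam + e \<in> L"
        using resolvent_one_extends[OF P u(1) _ u(2), of "real (Suc m)" e] e u(2) by (simp add: L_def)
      then have "lam + e \<le> ls" unfolding ls_def using bdd by (rule cSup_upper)
      then show False using lam by simp
    qed
    moreover have "lam \<le> ls" unfolding ls_def using lam(1) bdd by (rule cSup_upper)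
    ultimately show ?thesis using u x lam(2) e(3) by (intro exI[of _ lam] exI[of _ u] exI[of _ x]) auto
  qed
  then obtain lam u x where lux: "\<And>m. 0 \<le> lam m \<and> lam m \<le> ls \<and> ls - lam m \<le> 1 / real (Suc m) \<and>
      resolvent_one A B (lam m) (u m) \<and> x m \<in> {a..b} \<and> (\<forall>t\<in>{a..b}. u m 0 t \<le> u m 0 (x m)) \<and>
      u m 0 (x m) > real (Suc m)"
    by metis
  define z where "z m = (\<lambda>i t. (1 / u m 0 (x m)) * u m i t)" for m
  have N: "u m 0 (x m) > real (Suc m)" "u m 0 (x m) > 0" "1 / u m 0 (x m) \<le> 1 / real (Suc m)" for m
  proof -
    show 1: "u m 0 (x m) > real (Suc m)" using lux by blast
    show 2: "u m 0 (x m) > 0" by (rule le_less_trans[OF _ 1]) simp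
    show "1 / u m 0 (x m) \<le> 1 / real (Suc m)"
      by (rule divide_left_mono) (use 1 2 in auto)
  qed
  have zc: "chain (z m)" "bc A B (z m)" for m
    unfolding z_def using lux[of m] by (auto simp only: resolvent_one_def intro!: chain_scale bc_scale)
  have z01: "0 \<le> z m 0 t" "z m 0 t \<le> 1" if t: "t \<in> {a..b}" for m t
  proof -
    have "0 \<le> u m 0 t" "u m 0 t \<le> u m 0 (x m)" using lux[of m] t by (auto simp: resolvent_one_def)
    then show "0 \<le> z m 0 t" "z m 0 t \<le> 1" using N(2)[of m] by (auto simp: z_def)
  qed
  have zx: "z m 0 (x m) = 1" for m using N(2)[of m] by (simp add: z_def)
  have zn: "rho A * z m n t = lam m * z m 0 t + 1 / u m 0 (x m)" if t: "t \<in> {a..b}" for m t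
  proof -
    have "rho A * u m n t = lam m * u m 0 t + 1" using lux[of m] t by (auto simp: resolvent_one_def)
    then have "(1 / u m 0 (x m)) * (rho A * u m n t) = (1 / u m 0 (x m)) * (lam m * u m 0 t + 1)" by (rule arg_cong)
    then show ?thesis by (simp add: z_def add_divide_distrib)
  qed
  have bd: "\<bar>z m n t\<bar> \<le> ls + 1" if t: "t \<in> {a..b}" for m t
  proof -
    have "lam m * z m 0 t \<le> ls * 1" by (rule mult_mono) (use lux[of m] z01[OF t] ls0 in auto)
    moreover have "0 \<le> lam m * z m 0 t" using lux[of m] z01[OF t] by auto
    moreover have "1 / u m 0 (x m) \<le> 1" using N(3)[of m] by (rule order_trans) simp
    moreover have "1 / u m 0 (x m) > 0" using N(2)[of m] by simp
    ultimately have "\<bar>rho A * z m n t\<bar> \<le> ls + 1" unfolding zn[OF t] by linarith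
    then show ?thesis by (simp add: abs_mult rho_def)
  qed
  obtain g r d where g: "continuous_on {a..b} g" "strict_mono (r :: nat \<Rightarrow> nat)" "d \<longlonglongrightarrow> 0"
    "\<And>m t. t \<in> {a..b} \<Longrightarrow> \<bar>z (r m) 0 t - g t\<bar> \<le> d m"
    by (rule green_compact[OF P, of z "ls + 1"]) (use zc bd in auto)
  obtain y where y: "chain y" "bc A B y" "\<And>t. t \<in> {a..b} \<Longrightarrow> rho A * y n t = ls * g t"
    "\<And>t. t \<in> {a..b} \<Longrightarrow> (\<lambda>m. z (r m) 0 t) \<longlonglongrightarrow> y 0 t"
  proof (rule green_limit[OF P, of "\<lambda>m. z (r m)" "\<lambda>t. ls * g t" "\<lambda>m. 2 * (1 / real (Suc m)) + ls * d m"])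
    show "continuous_on {a..b} (\<lambda>t. ls * g t)" by (intro continuous_intros g)
    have "(\<lambda>m. 2 * (1 / real (Suc m)) + ls * d m) \<longlonglongrightarrow> 2 * 0 + ls * 0"
      by (intro tendsto_intros g LIMSEQ_Suc[OF lim_1_over_n])
    then show "(\<lambda>m. 2 * (1 / real (Suc m)) + ls * d m) \<longlonglongrightarrow> 0" by simp
    fix m t assume t: "t \<in> {a..b}"
    have rm: "1 / real (Suc (r m)) \<le> 1 / real (Suc m)"
      using seq_suble[OF g(2), of m] by (intro divide_left_mono) auto
    have "rho A * z (r m) n t - ls * g t
        = (lam (r m) - ls) * z (r m) 0 t + ls * (z (r m) 0 t - g t) + 1 / u (r m) 0 (x (r m))"
      unfolding zn[OF t] by (simp add: algebra_simps)
    moreover have "\<bar>(lam (r m) - ls) * z (r m) 0 t\<bar> \<le> 1 / real (Suc (r m)) * 1"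
      unfolding abs_mult by (rule mult_mono) (use lux[of "r m"] z01[OF t] in auto)
    moreover have "\<bar>ls * (z (r m) 0 t - g t)\<bar> \<le> ls * d m"
      using g(4)[OF t, of m] ls0 by (simp add: abs_mult mult_left_mono)
    moreover have "\<bar>1 / u (r m) 0 (x (r m))\<bar> \<le> 1 / real (Suc (r m))"
      using N(2,3)[of "r m"] by simp
    ultimately show "\<bar>rho A * z (r m) n t - ls * g t\<bar> \<le> 2 * (1 / real (Suc m)) + ls * d m"
      using rm by linarith
  qed (use zc in auto)
  have gy: "g t = y 0 t" if t: "t \<in> {a..b}" for t
  proof (rule LIMSEQ_unique[OF _ y(4)[OF t]])
    show "(\<lambda>m. z (r m) 0 t) \<longlonglongrightarrow> g t"
    proof (rule LIM_zero_cancel, rule Lim_null_comparison[OF _ g(3)])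
      show "\<forall>\<^sub>F m in sequentially. norm (z (r m) 0 t - g t) \<le> d m" using g(4)[OF t] by simp
    qed
  qed
  have y0: "y 0 t \<ge> 0" if t: "t \<in> {a..b}" for t
    by (rule LIMSEQ_le_const[OF y(4)[OF t]]) (use z01 t in auto)
  have ny: "\<exists>t\<in>{a..b}. y 0 t \<noteq> 0"
  proof (rule ccontr)
    assume "\<not> ?thesis"
    then have "1 \<le> d m" for m
      using g(4)[of "x (r m)" m] gy[of "x (r m)"] lux[of "r m"] zx[of "r m"] by auto
    then have "1 \<le> (0::real)" using LIMSEQ_le_const[OF g(3), of 1] by auto
    then show False by simp
  qed
  have "ls \<noteq> 0"
  proof
    assume "ls = 0"
    then have "y n t = 0" if "t \<in> {a..b}" for t using y(3)[OF that] by simp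
    then show False using uniqueness[OF P y(1,2)] ny by auto
  qed
  moreover have "eigenchain A B ls y"
    unfolding eigenchain_def using y(1-3) gy ny by auto
  ultimately show thesis using that[of ls y] ls0 y0 by auto
qed

section \<open>The sign of the inverse beyond the principal eigenvalue\<close>

text \<open>Inverse negativity in terms of chains, after multiplication by the sign \<open>rho\<close>: it stands for
  inverse negativity if \<open>rho A = 1\<close> and for inverse positivity if \<open>rho A = -1\<close>.\<close>

definition inverse_neg :: "nat set \<Rightarrow> nat set \<Rightarrow> real \<Rightarrow> bool" where
  "inverse_neg A B lam \<longleftrightarrow> (\<forall>y. chain y \<longrightarrow> bc A B y \<longrightarrow>
     (\<forall>t\<in>{a..b}. rho A * y n t - lam * y 0 t \<ge> 0) \<longrightarrow> (\<forall>t\<in>{a..b}. y 0 t \<le> 0))"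

lemma inverse_negD:
  "inverse_neg A B lam \<Longrightarrow> chain y \<Longrightarrow> bc A B y \<Longrightarrow>
    (\<And>t. t \<in> {a..b} \<Longrightarrow> rho A * y n t - lam * y 0 t \<ge> 0) \<Longrightarrow> t \<in> {a..b} \<Longrightarrow> y 0 t \<le> 0"
  by (auto simp: inverse_neg_def)

lemma inverse_neg_injective:
  assumes neg: "inverse_neg A B lam" and y: "chain y" "bc A B y"
    and e: "\<And>t. t \<in> {a..b} \<Longrightarrow> rho A * y n t = lam * y 0 t" and t: "t \<in> {a..b}"
  shows "y 0 t = 0"
proof -
  have "y 0 t \<le> 0" by (rule inverse_negD[OF neg y _ t]) (simp add: e)
  moreover have "(-1) * y 0 t \<le> 0"
    by (rule inverse_negD[OF neg chain_scale[OF y(1)] bc_scale[OF y(2)] _ t]) (simp add: e)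
  ultimately show ?thesis by simp
qed

text \<open>For \<open>lam \<le> mu\<close> the eigenfunction \<open>z\<close> is an admissible test function, although it is nonnegative.\<close>

lemma inverse_neg_beyond_principal_eigenvalue:
  assumes neg: "inverse_neg A B lam" and z: "eigenchain A B mu z"
    and zpos: "\<And>t. t \<in> {a..b} \<Longrightarrow> z 0 t \<ge> 0"
  shows "mu < lam"
proof (rule ccontr)
  assume "\<not> mu < lam"
  have z': "chain z" "bc A B z" "\<exists>t\<in>{a..b}. z 0 t \<noteq> 0" "\<And>t. t \<in> {a..b} \<Longrightarrow> rho A * z n t = mu * z 0 t"
    using z by (auto simp: eigenchain_def)
  have "z 0 t \<le> 0" if "t \<in> {a..b}" for t
    by (rule inverse_negD[OF neg z'(1,2) _ that])
       (use z'(4) zpos \<open>\<not> mu < lam\<close> in \<open>auto simp: mult_right_mono\<close>)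
  then show False using z'(3) zpos by (metis order_antisym)
qed

lemma leading_term_positive:
  assumes y: "chain y" and m: "m \<le> n" and zero: "\<And>i. i < m \<Longrightarrow> y i a = 0" and pos: "y m a > 0"
  shows "\<exists>c. a < c \<and> c \<le> b \<and> (\<forall>t\<in>{a<..c}. y 0 t > 0)"
proof -
  have "continuous_on {a..b} (y m)" using chain_cont[OF y m] .
  then obtain d where d: "d > 0" "\<And>t. t \<in> {a..b} \<Longrightarrow> \<bar>t - a\<bar> < d \<Longrightarrow> \<bar>y m t - y m a\<bar> < y m a"
    using pos ab unfolding continuous_on_iff dist_real_def by (metis atLeastAtMost_iff less_imp_le order_refl)
  define c where "c = min b (a + d / 2)"
  have c: "a < c" "c \<le> b" using d ab by (auto simp: c_def)
  have "\<forall>t\<in>{a<..c}. y (m - j) t > 0" if "j \<le> m" for j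
    using that
  proof (induction j)
    case 0
    show ?case
    proof
      fix t assume t: "t \<in> {a<..c}"
      have "\<bar>y m t - y m a\<bar> < y m a" by (rule d(2)) (use t d(1) in \<open>auto simp: c_def\<close>)
      then show "y (m - 0) t > 0" by auto
    qed
  next
    case (Suc j)
    define i where "i = m - Suc j"
    have i: "m - j = Suc i" "i < n" "i < m" using Suc m by (auto simp: i_def)
    show ?case unfolding i_def[symmetric]
    proof
      fix t assume t: "t \<in> {a<..c}"
      obtain z where z: "a < z" "z < t" "y i t - y i a = w i z * y (Suc i) z * (t - a)"
        using mvt_within[OF chain_deriv[OF y i(2)], of a t] t c by auto
      have "w i z > 0" "y (Suc i) z > 0" using z t c w_pos[OF i(2), of z] Suc i by auto
      then have "w i z * y (Suc i) z * (t - a) > 0" using t by simp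
      then show "y i t > 0" using z zero[OF i(3)] by simp
    qed
  qed
  from this[of m] show ?thesis using c by auto
qed

text \<open>A chain driven by the source \<open>max 0 (t - c)\<close> from zero initial values. The last estimate makes
  each quasi-derivative small against the next one as \<open>c\<close> tends to \<open>b\<close>: the source is
  nondecreasing, hence so are all its iterated integrals.\<close>

lemma ramp_left:
  assumes c: "a \<le> c" "c < b" and W: "\<And>i t. i < n \<Longrightarrow> t \<in> {a..b} \<Longrightarrow> w i t \<le> W"
  obtains r where "chain r" "\<And>t. r n t = max 0 (t - c)" "\<And>i. i < n \<Longrightarrow> r i a = 0"
    "\<And>i t. i \<le> n \<Longrightarrow> t \<in> {a..c} \<Longrightarrow> r i t = 0" "\<And>i. i \<le> n \<Longrightarrow> r i b > 0"
    "\<And>i t. i \<le> n \<Longrightarrow> t \<in> {a..b} \<Longrightarrow> r i t \<ge> 0"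
    "\<And>i t. i < n \<Longrightarrow> t \<in> {a..b} \<Longrightarrow> r i t \<le> W * (b - c) * r (Suc i) t"
proof -
  define r where "r = chain_of (\<lambda>_. 0) (\<lambda>t. max 0 (t - c))"
  have rc: "chain r" unfolding r_def by (intro chain_chain_of continuous_intros)
  have rn: "r n = (\<lambda>t. max 0 (t - c))" by (simp add: r_def)
  have ra: "r i a = 0" if "i < n" for i using that by (simp add: r_def chain_of_init)
  have *: "(\<forall>t\<in>{a..c}. r i t = 0) \<and> (\<forall>t\<in>{c<..b}. r i t > 0) \<and> (\<forall>t\<in>{a..b}. \<forall>s\<in>{a..b}. t \<le> s \<longrightarrow> r i t \<le> r i s)"
    if "i \<le> n" for i
    using that
  proof (induction i rule: inc_induct)
    case base
    then show ?case by (auto simp: rn)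
  next
    case (step i)
    have i: "i < n" using step by simp
    have IH: "\<And>t. t \<in> {a..c} \<Longrightarrow> r (Suc i) t = 0" "\<And>t. t \<in> {c<..b} \<Longrightarrow> r (Suc i) t > 0"
      using step by auto
    have z: "r i t = 0" if "t \<in> {a..c}" for t
    proof (cases "t = a")
      case False
      then have "a < t" "t \<le> b" using that c by auto
      then obtain s where "a < s" "s < t" "r i t - r i a = w i s * r (Suc i) s * (t - a)"
        using mvt_within[OF chain_deriv[OF rc i], of a t] by auto
      then show ?thesis using IH(1)[of s] that ra[OF i] by auto
    qed (use ra i in auto)
    moreover have "r i t > 0" if t: "t \<in> {c<..b}" for t
    proof -
      obtain s where s: "c < s" "s < t" "r i t - r i c = w i s * r (Suc i) s * (t - c)"
        using mvt_within[OF chain_deriv[OF rc i], of c t] t c by auto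
      have "w i s * r (Suc i) s * (t - c) > 0"
        using IH(2)[of s] w_pos[OF i, of s] s t c by simp
      then show ?thesis using s z[of c] c by simp
    qed
    moreover have "r i t \<le> r i s" if "t \<in> {a..b}" "s \<in> {a..b}" "t \<le> s" for t s
    proof (rule nondecreasing_within[OF chain_deriv[OF rc i], of t s])
      fix x assume x: "x \<in> {a..b}"
      have "r (Suc i) x \<ge> 0" using IH(1)[of x] IH(2)[of x] x by (cases "x \<le> c") (auto simp: less_imp_le)
      then show "0 \<le> w i x * r (Suc i) x" using w_pos[OF i x] by simp
    qed (use that in auto)
    ultimately show ?case by blast
  qed
  have nn: "r i t \<ge> 0" if "i \<le> n" "t \<in> {a..b}" for i t
  proof (cases "t \<le> c")
    case True then show ?thesis using *[OF that(1)] that(2) by simp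
  next
    case False
    then have "t \<in> {c<..b}" using that by auto
    then show ?thesis using *[OF that(1)] by (auto intro: less_imp_le)
  qed
  show thesis
  proof (rule that[of r])
    fix i t assume i: "i < n" and t: "t \<in> {a..b}"
    have W0: "W \<ge> 0" using w_pos[OF i t] W[OF i t] by linarith
    show "r i t \<le> W * (b - c) * r (Suc i) t"
    proof (cases "t \<le> c")
      case True
      then show ?thesis using *[of i] *[of "Suc i"] i t by simp
    next
      case False
      obtain s where s: "c < s" "s < t" "r i t - r i c = w i s * r (Suc i) s * (t - c)"
        using mvt_within[OF chain_deriv[OF rc i], of c t] t c False by auto
      have s': "s \<in> {a..b}" using s t c by auto
      have "w i s * (r (Suc i) s * (t - c)) \<le> W * (r (Suc i) t * (b - c))"
      proof (intro mult_mono)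
        show "w i s \<le> W" by (rule W[OF i s'])
        show "r (Suc i) s \<le> r (Suc i) t" using *[of "Suc i"] i s s' t by auto
      qed (use t c s s' i nn[of "Suc i"] W0 False in auto)
      moreover have "r i c = 0" using *[of i] i c by auto
      ultimately show ?thesis using s by (simp add: mult_ac)
    qed
  qed (use rc rn ra * nn c in auto)
qed

text \<open>The mirror image of \<open>ramp_left\<close>, with the alternating signs written out so that all \<open>q i\<close> are
  nonnegative.\<close>

lemma ramp_right:
  assumes c: "a < c" "c \<le> b" and W: "\<And>i t. i < n \<Longrightarrow> t \<in> {a..b} \<Longrightarrow> w i t \<le> W"
  obtains q where "chain (\<lambda>i t. (-1) ^ i * q i t)" "\<And>i. i < n \<Longrightarrow> q i b = 0"
    "\<And>i t. i \<le> n \<Longrightarrow> t \<in> {c..b} \<Longrightarrow> q i t = 0" "\<And>i. i \<le> n \<Longrightarrow> q i a > 0"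
    "\<And>i t. i \<le> n \<Longrightarrow> t \<in> {a..b} \<Longrightarrow> q i t \<ge> 0"
    "\<And>i t. i < n \<Longrightarrow> t \<in> {a..b} \<Longrightarrow> q i t \<le> W * (c - a) * q (Suc i) t"
proof -
  interpret R: quasi_chain "-b" "-a" n "\<lambda>i t. w i (- t)" by (rule quasi_chain_reflected)
  obtain r where r: "R.chain r" "\<And>i. i < n \<Longrightarrow> r i (-b) = 0"
    "\<And>i t. i \<le> n \<Longrightarrow> t \<in> {-b..-c} \<Longrightarrow> r i t = 0" "\<And>i. i \<le> n \<Longrightarrow> r i (-a) > 0"
    "\<And>i t. i \<le> n \<Longrightarrow> t \<in> {-b..-a} \<Longrightarrow> r i t \<ge> 0"
    "\<And>i t. i < n \<Longrightarrow> t \<in> {-b..-a} \<Longrightarrow> r i t \<le> W * (-a - (-c)) * r (Suc i) t"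
    by (rule R.ramp_left[of "-c" W]) (use c W in auto)
  have "chain (\<lambda>i t. (-1) ^ i * r i (- t))"
    using R.chain_reflected[OF r(1)] by (simp add: R.reflected_def)
  then show thesis
    using that[of "\<lambda>i t. r i (- t)"] r(2) r(3)[of _ "- t" for t] r(4) r(5)[of _ "- t" for t] r(6)[of _ "- t" for t]
    by auto
qed

text \<open>Let a nonnegative source shrink to the end point \<open>a\<close>. Then the solutions of the boundary value
  problem, suitably scaled, converge to the homogeneous solution that violates only the condition
  of highest index at \<open>a\<close>. This transfers the sign of the inverse operator to that solution.
  Concretely, with \<open>p\<close> a ramp supported in \<open>[a, a + d]\<close>, the chain \<open>u = p - (\<Sum>j\<in>A. p j a * Y j)\<close>
  satisfies the boundary conditions. The coefficient with the largest index dominates the sum as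
  \<open>d\<close> tends to \<open>0\<close>.\<close>

lemma boundary_solution_sign:
  assumes P: "poised A B" and neg: "inverse_neg A B lam"
  defines "top_idx \<equiv> Max A"
  obtains y where "chain y" "\<And>t. t \<in> {a..b} \<Longrightarrow> rho A * y n t = lam * y 0 t"
    "\<And>i. i \<in> A \<Longrightarrow> i \<noteq> top_idx \<Longrightarrow> y i a = 0" "y top_idx a = 1" "\<And>i. i \<in> B \<Longrightarrow> y i b = 0"
    "\<And>t. t \<in> {a..b} \<Longrightarrow> (-1) ^ (top_idx + card A) * y 0 t \<ge> 0"
proof -
  have AB: "A \<subseteq> {..<n}" "B \<subseteq> {..<n}" "card A + card B = n" "A \<noteq> {}" using P by (auto simp: poised_def)
  have fin: "finite A" using AB finite_subset by blast
  have sA: "top_idx \<in> A" "\<And>i. i \<in> A \<Longrightarrow> i \<le> top_idx" using fin AB by (auto simp: top_idx_def)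
  then have sn: "top_idx < n" using AB by auto
  have "\<exists>y. chain y \<and> (\<forall>t\<in>{a..b}. rho A * y n t = lam * y 0 t) \<and>
      (\<forall>i\<in>A. y i a = of_bool (i = j)) \<and> (\<forall>i\<in>B. y i b = 0)" for j
  proof -
    obtain y where y: "chain y" "\<And>t. t \<in> {a..b} \<Longrightarrow> y n t = rho A * lam * y 0 t + 0"
      "\<And>i. i \<in> A \<Longrightarrow> y i a = of_bool (i = j)" "\<And>i. i \<in> B \<Longrightarrow> y i b = 0"
    proof (rule boundary_value_problem[OF AB(1-3), of "rho A * lam" "\<lambda>_. 0" "\<lambda>i. of_bool (i = j)"])
      fix y t assume y: "chain y" "bc A B y" "\<And>t. t \<in> {a..b} \<Longrightarrow> y n t = rho A * lam * y 0 t" and t: "t \<in> {a..b}"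
      show "y 0 t = 0" by (rule inverse_neg_injective[OF neg y(1,2) _ t]) (simp add: y(3) mult.assoc)
    qed auto
    then show ?thesis by (intro exI[of _ y]) (auto simp: mult.assoc)
  qed
  then obtain Y where Y: "\<And>j. chain (Y j)" "\<And>j t. t \<in> {a..b} \<Longrightarrow> rho A * Y j n t = lam * Y j 0 t"
    "\<And>j i. i \<in> A \<Longrightarrow> Y j i a = of_bool (i = j)" "\<And>j i. i \<in> B \<Longrightarrow> Y j i b = 0"
    by metis
  obtain W where W: "W > 0" "\<And>i t. i < n \<Longrightarrow> t \<in> {a..b} \<Longrightarrow> w i t \<le> W"
    using weights_bounded by blast
  define s :: real where "s = (-1) ^ (top_idx + card A)"
  have small: "- (W * d * (\<Sum>i\<in>A. \<bar>Y i 0 t\<bar>)) \<le> s * Y top_idx 0 t"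
    if t: "t \<in> {a<..b}" and d: "0 < d" "a + d \<le> t" "W * d \<le> 1" "\<bar>lam\<bar> * (W * d) \<le> 1" for t d
  proof -
    obtain q where q: "chain (\<lambda>i t. (-1) ^ i * q i t)" "\<And>i. i < n \<Longrightarrow> q i b = 0"
      "\<And>i t. i \<le> n \<Longrightarrow> t \<in> {a+d..b} \<Longrightarrow> q i t = 0" "\<And>i. i \<le> n \<Longrightarrow> q i a > 0"
      "\<And>i t. i \<le> n \<Longrightarrow> t \<in> {a..b} \<Longrightarrow> q i t \<ge> 0"
      "\<And>i t. i < n \<Longrightarrow> t \<in> {a..b} \<Longrightarrow> q i t \<le> W * (a + d - a) * q (Suc i) t"
      by (rule ramp_right[of "a + d" W]) (use t d W in auto)
    have q_step: "q i x \<le> W * d * q (Suc i) x" if "i < n" "x \<in> {a..b}" for i x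
      using q(6)[OF that] by simp
    have q_mono: "q i x \<le> q j x" if "i \<le> j" "j \<le> n" "x \<in> {a..b}" for i j x
      using that(1,2)
    proof (induction j rule: dec_induct)
      case (step j)
      then have "q i x \<le> q j x" by simp
      also have "\<dots> \<le> W * d * q (Suc j) x" using q_step[of j x] step that by simp
      also have "\<dots> \<le> 1 * q (Suc j) x"
        by (rule mult_right_mono) (use d q(5)[of "Suc j" x] step that in auto)
      finally show ?case by simp
    qed simp
    have q_small: "q i x \<le> W * d * q j x" if "i < j" "j \<le> n" "x \<in> {a..b}" for i j x
    proof -
      have "q i x \<le> W * d * q (Suc i) x" using q_step[of i x] that by simp
      also have "\<dots> \<le> W * d * q j x"
        by (rule mult_left_mono) (use q_mono[of "Suc i" j x] that W d in auto)
      finally show ?thesis .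
    qed
    define e where "e i = (-1::real) ^ (i + card A)" for i
    define p where "p = (\<lambda>i t. e i * q i t)"
    have pq: "p = (\<lambda>i t. (-1) ^ card A * ((-1) ^ i * q i t))"
      by (auto simp: p_def e_def power_add mult_ac)
    have pc: "chain p" unfolding pq by (rule chain_scale[OF q(1)])
    define u where "u = (\<lambda>i t. 1 * p i t + (-1) * (\<Sum>j\<in>A. p j a * Y j i t))"
    have uc: "chain u" unfolding u_def by (intro chain_lincomb pc chain_sum fin Y)
    have ubc: "bc A B u"
    proof -
      have "(\<Sum>j\<in>A. p j a * Y j i a) = p i a" if "i \<in> A" for i
      proof -
        have "(\<Sum>j\<in>A. p j a * Y j i a) = (\<Sum>j\<in>A. if j = i then p i a else 0)"
          by (rule sum.cong) (use Y(3)[OF that] in auto)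
        then show ?thesis using fin that by simp
      qed
      moreover have "p i b = 0" if "i \<in> B" for i using q(2)[of i] that AB(2) by (auto simp: p_def)
      ultimately show ?thesis using Y(4) by (auto simp: bc_def u_def)
    qed
    have un: "rho A * u n x - lam * u 0 x \<ge> 0" if x: "x \<in> {a..b}" for x
    proof -
      have "rho A * (\<Sum>j\<in>A. p j a * Y j n x) = lam * (\<Sum>j\<in>A. p j a * Y j 0 x)"
        unfolding sum_distrib_left
        by (rule sum.cong) (use Y(2)[OF x] in \<open>auto simp: mult.left_commute\<close>)
      then have "rho A * u n x - lam * u 0 x = rho A * p n x - lam * p 0 x"
        by (simp add: u_def algebra_simps)
      also have "rho A * p n x = q n x"
        by (simp add: p_def e_def rho_def flip: mult.assoc)
      finally have eq: "rho A * u n x - lam * u 0 x = q n x - lam * p 0 x" .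
      have "lam * p 0 x \<le> \<bar>lam\<bar> * q 0 x"
        using q(5)[of 0 x] x abs_ge_self[of "lam * p 0 x"] by (simp add: p_def e_def abs_mult)
      also have "\<dots> \<le> \<bar>lam\<bar> * (W * d * q n x)"
        by (rule mult_left_mono) (use q_small[of 0 n x] n_pos x in auto)
      also have "\<dots> = (\<bar>lam\<bar> * (W * d)) * q n x" by simp
      also have "\<dots> \<le> 1 * q n x" by (rule mult_right_mono) (use d q(5)[of n x] x in auto)
      finally show ?thesis using eq by simp
    qed
    have "u 0 t \<le> 0" by (rule inverse_negD[OF neg uc ubc un]) (use t in auto)
    moreover have "p 0 t = 0" using q(3)[of 0 t] t d by (simp add: p_def)
    ultimately have "0 \<le> (\<Sum>j\<in>A. p j a * Y j 0 t)" by (simp add: u_def)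
    also have "\<dots> = p top_idx a * Y top_idx 0 t + (\<Sum>j\<in>A - {top_idx}. p j a * Y j 0 t)"
      by (rule sum.remove[OF fin sA(1)])
    also have "(\<Sum>j\<in>A - {top_idx}. p j a * Y j 0 t) \<le> (\<Sum>j\<in>A - {top_idx}. W * d * q top_idx a * \<bar>Y j 0 t\<bar>)"
    proof (rule sum_mono)
      fix j assume j: "j \<in> A - {top_idx}"
      then have "j < top_idx" using sA(2)[of j] by auto
      have "p j a * Y j 0 t \<le> \<bar>p j a\<bar> * \<bar>Y j 0 t\<bar>"
        using abs_ge_self[of "p j a * Y j 0 t"] by (simp add: abs_mult)
      also have "\<bar>p j a\<bar> = q j a" using q(4)[of j] \<open>j < top_idx\<close> sn by (simp add: p_def e_def abs_mult)
      also have "q j a * \<bar>Y j 0 t\<bar> \<le> W * d * q top_idx a * \<bar>Y j 0 t\<bar>"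
        by (rule mult_right_mono) (use q_small[of j top_idx a] \<open>j < top_idx\<close> sn ab in auto)
      finally show "p j a * Y j 0 t \<le> W * d * q top_idx a * \<bar>Y j 0 t\<bar>" .
    qed
    also have "\<dots> \<le> (\<Sum>j\<in>A. W * d * q top_idx a * \<bar>Y j 0 t\<bar>)"
      by (rule sum_mono2) (use fin W d q(4)[of top_idx] sn in auto)
    also have "\<dots> = q top_idx a * (W * d * (\<Sum>j\<in>A. \<bar>Y j 0 t\<bar>))"
      by (simp add: sum_distrib_left mult_ac)
    also have "p top_idx a * Y top_idx 0 t = q top_idx a * (s * Y top_idx 0 t)"
      by (simp add: p_def e_def s_def)
    finally have "0 \<le> q top_idx a * (s * Y top_idx 0 t + W * d * (\<Sum>j\<in>A. \<bar>Y j 0 t\<bar>))"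
      by (simp add: distrib_left)
    then show ?thesis using q(4)[of top_idx] sn by (simp add: zero_le_mult_iff)
  qed
  have pos: "s * Y top_idx 0 t \<ge> 0" if t: "t \<in> {a<..b}" for t
  proof (rule tendsto_upperbound)
    define S where "S = (\<Sum>i\<in>A. \<bar>Y i 0 t\<bar>)"
    show "((\<lambda>d. - (W * d * S)) \<longlongrightarrow> 0) (at_right 0)"
      by (auto intro!: tendsto_eq_intros)
    \<comment> \<open>Below \<open>D\<close> the ramp ends before \<open>t\<close>, and the term with \<open>lam\<close> is dominated by the source.\<close>
    define D where "D = min (t - a) (min (1 / W) (1 / (W * (\<bar>lam\<bar> + 1))))"
    have "D > 0" using t W by (simp add: D_def add_nonneg_pos)
    then show "\<forall>\<^sub>F d in at_right 0. - (W * d * S) \<le> s * Y top_idx 0 t"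
      unfolding eventually_at_right_field
    proof (intro exI[of _ D] conjI allI impI)
      fix d assume d: "0 < d" "d < D"
      have "d \<le> 1 / (W * (\<bar>lam\<bar> + 1))" "d \<le> 1 / W" using d by (auto simp: D_def)
      then have 1: "d * (W * (\<bar>lam\<bar> + 1)) \<le> 1" "d * W \<le> 1" using W by (auto simp: pos_le_divide_eq)
      have "\<bar>lam\<bar> * (W * d) \<le> d * (W * (\<bar>lam\<bar> + 1))" using d W by (simp add: algebra_simps)
      then show "- (W * d * S) \<le> s * Y top_idx 0 t"
        unfolding S_def using 1 d t by (intro small) (auto simp: D_def mult.commute)
    qed
  qed simp
  have "s * Y top_idx 0 t \<ge> 0" if t: "t \<in> {a..b}" for t
  proof (cases "t = a")
    case True
    have "continuous_on {a..b} (\<lambda>t. s * Y top_idx 0 t)"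
      by (intro continuous_intros chain_cont Y) simp
    then have "((\<lambda>t. s * Y top_idx 0 t) \<longlongrightarrow> s * Y top_idx 0 a) (at_right a)"
      using ab by (rule continuous_on_Icc_at_rightD)
    then show ?thesis unfolding True
      by (rule tendsto_lowerbound) (use pos ab in \<open>auto simp: eventually_at_right_field intro!: exI[of _ b]\<close>)
  qed (use pos t in auto)
  then show thesis
    using that[of "Y top_idx"] Y sA(1) by (auto simp: s_def)
qed

lemma least_missing_props:
  assumes "A \<subseteq> {..<n}" "card A < n"
  shows "least_missing n A < n" "least_missing n A \<notin> A" "\<And>i. i < least_missing n A \<Longrightarrow> i \<in> A"
proof -
  obtain m where m: "m < n" "m \<notin> A" using least_free_index[OF assms] by blast
  have "least_missing n A \<in> {0..<n} - A"
    unfolding least_missing_def by (rule Min_in) (use m in auto)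
  then show 1: "least_missing n A < n" "least_missing n A \<notin> A" by auto
  fix i assume "i < least_missing n A"
  then have "i \<notin> {0..<n} - A" unfolding least_missing_def by (metis Min_le finite_Diff finite_atLeastLessThan leD)
  then show "i \<in> A" using 1 \<open>i < least_missing n A\<close> by auto
qed

text \<open>Replacing the largest index by a smaller one can only increase the counts in \<open>nonresonant\<close>.\<close>

lemma poised_swap_max:
  assumes P: "poised A B" and gap: "least_missing n A < Max A"
  shows "poised (swap_max n A) B" "card (swap_max n A) = card A" "swap_max n A \<subseteq> {..<Max A}"
    "insert (Max A) (swap_max n A) = insert (least_missing n A) A"
proof -
  have AB: "A \<subseteq> {..<n}" "B \<subseteq> {..<n}" "card A + card B = n" "A \<noteq> {}" "B \<noteq> {}" "nonresonant n A B"
    using P by (auto simp: poised_def)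
  have fin: "finite A" using AB finite_subset by blast
  have M: "Max A \<in> A" "\<And>i. i \<in> A \<Longrightarrow> i \<le> Max A" using fin AB by auto
  note lm = least_missing_props[OF AB(1) poised_card_less(1)[OF P]]
  let ?A = "swap_max n A"
  have A': "?A = insert (least_missing n A) (A - {Max A})" by (simp add: swap_max_def)
  have "0 < card A" using fin AB(4) by (simp add: card_gt_0_iff)
  then show card: "card ?A = card A" unfolding A' using fin M lm by (simp add: card_Diff_singleton)
  show sub: "?A \<subseteq> {..<Max A}" unfolding A' using M(2) gap by (force simp: less_le)
  show "insert (Max A) ?A = insert (least_missing n A) A" unfolding A' using M by auto
  have cb: "count_below ?A h \<ge> count_below A h" for h
  proof (cases "h \<le> Max A")
    case True
    show ?thesis unfolding count_below_def
      by (rule card_mono) (use True in \<open>auto simp: A' intro: finite_subset[of _ "{..<h}"]\<close>)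
  next
    case False
    then have "{i \<in> ?A. i < h} = ?A" using sub by auto
    then have "count_below ?A h = card A" unfolding count_below_def using card by simp
    moreover have "count_below A h \<le> card A"
      unfolding count_below_def by (rule card_mono) (use fin in auto)
    ultimately show ?thesis by simp
  qed
  have "Max A < n" using M(1) AB(1) by auto
  then have "?A \<subseteq> {..<n}" using sub by auto
  moreover have "nonresonant n ?A B"
    unfolding nonresonant_def
  proof
    fix h assume "h \<in> {1..n - 1}"
    then have "count_below A h + count_below B h \<ge> h" using AB(6) by (auto simp: nonresonant_def)
    then show "count_below ?A h + count_below B h \<ge> h" using cb[of h] by linarith
  qed
  moreover have "?A \<noteq> {}" by (simp add: A')
  ultimately show "poised ?A B" using AB card unfolding poised_def by metis
qed

text \<open>Without a gap \<open>A = {..card A - 1}\<close>, so that the solution of \<open>boundary_solution_sign\<close> is positive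
  near \<open>a\<close>, against the sign asserted there.\<close>

lemma inverse_neg_imp_gap:
  assumes P: "poised A B" and neg: "inverse_neg A B lam"
  shows "least_missing n A < Max A"
proof (rule ccontr)
  assume no: "\<not> ?thesis"
  have AB: "A \<subseteq> {..<n}" "A \<noteq> {}" using P by (auto simp: poised_def)
  have fin: "finite A" using AB finite_subset by blast
  have M: "Max A \<in> A" "\<And>i. i \<in> A \<Longrightarrow> i \<le> Max A" using fin AB by auto
  note lm = least_missing_props[OF AB(1) poised_card_less(1)[OF P]]
  have Aeq: "A = {..Max A}"
  proof (intro equalityI subsetI)
    fix i assume "i \<in> {..Max A}"
    moreover have "least_missing n A \<noteq> Max A" using lm(2) M(1) by metis
    ultimately show "i \<in> A" using lm(3)[of i] no by auto
  qed (use M in auto)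
  then have card: "card A = Suc (Max A)" by (metis card_atMost)
  obtain y where y: "chain y" "\<And>i. i \<in> A \<Longrightarrow> i \<noteq> Max A \<Longrightarrow> y i a = 0" "y (Max A) a = 1"
    "\<And>t. t \<in> {a..b} \<Longrightarrow> (-1) ^ (Max A + card A) * y 0 t \<ge> 0"
    using boundary_solution_sign[OF P neg] by metis
  have "\<exists>c. a < c \<and> c \<le> b \<and> (\<forall>t\<in>{a<..c}. y 0 t > 0)"
  proof (rule leading_term_positive[OF y(1)])
    show "y i a = 0" if "i < Max A" for i
    proof -
      have "i \<in> A" by (subst Aeq) (use that in auto)
      then show ?thesis using y(2) that by auto
    qed
    show "Max A \<le> n" using M(1) AB(1) by auto
  qed (use y in auto)
  then obtain c where "a < c" "c \<le> b" "y 0 c > 0" by force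
  then show False using y(4)[of c] by (simp add: card)
qed

text \<open>For \<open>mu < lam\<close> the difference \<open>z - d y\<close>, with \<open>y\<close> from \<open>boundary_solution_sign\<close> and
  \<open>d = z (Max A) a\<close>, satisfies all conditions and is nonnegative by inverse negativity. So \<open>d y\<close> lies
  between \<open>0\<close> and \<open>z\<close>, which makes it a nonnegative eigenfunction of the modified problem for the larger
  eigenvalue \<open>lam\<close>.\<close>

lemma inverse_neg_below_swapped_eigenvalue:
  assumes P: "poised A B" and neg: "inverse_neg A B lam"
    and z: "eigenchain (swap_max n A) B mu z" and zpos: "\<And>t. t \<in> {a..b} \<Longrightarrow> z 0 t \<ge> 0" and mu: "mu > 0"
  shows "lam \<le> mu"
proof (rule ccontr)
  assume "\<not> lam \<le> mu"
  then have lam: "mu < lam" by simp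
  note gap = inverse_neg_imp_gap[OF P neg]
  define top_idx where "top_idx = Max A"
  define alpha where "alpha = least_missing n A"
  define A' where "A' = swap_max n A"
  have AB: "A \<subseteq> {..<n}" "B \<subseteq> {..<n}" "card A + card B = n" "A \<noteq> {}" "nonresonant n A B"
    using P by (auto simp: poised_def)
  have fin: "finite A" using AB finite_subset by blast
  have sA: "top_idx \<in> A" using fin AB by (auto simp: top_idx_def)
  then have sn: "top_idx < n" using AB by auto
  note lm = least_missing_props[OF AB(1) poised_card_less(1)[OF P], folded alpha_def]
  note sw = poised_swap_max[OF P gap, folded top_idx_def alpha_def A'_def]
  have A'_eq: "A' = insert alpha (A - {top_idx})" by (simp add: A'_def swap_max_def alpha_def top_idx_def)
  have gap': "alpha < top_idx" using gap by (simp add: alpha_def top_idx_def)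
  have rho': "rho A' = rho A" by (simp add: rho_def sw(2))
  have z': "chain z" "bc A' B z" "\<exists>t\<in>{a..b}. z 0 t \<noteq> 0" "\<And>t. t \<in> {a..b} \<Longrightarrow> rho A * z n t = mu * z 0 t"
    using z rho' by (auto simp: eigenchain_def A'_def)
  obtain y where y: "chain y" "\<And>t. t \<in> {a..b} \<Longrightarrow> rho A * y n t = lam * y 0 t"
    "\<And>i. i \<in> A \<Longrightarrow> i \<noteq> top_idx \<Longrightarrow> y i a = 0" "y top_idx a = 1" "\<And>i. i \<in> B \<Longrightarrow> y i b = 0"
    "\<And>t. t \<in> {a..b} \<Longrightarrow> (-1) ^ (top_idx + card A) * y 0 t \<ge> 0"
    using boundary_solution_sign[OF P neg] unfolding top_idx_def by metis
  define d where "d = z top_idx a"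
  define s :: real where "s = (-1) ^ (top_idx + card A)"
  have ss: "s * s = 1" by (simp add: s_def flip: power_add)
  \<comment> \<open>With the other sign of \<open>d\<close> one more alternation would be regained at \<open>top_idx\<close>.\<close>
  have sd: "s * d > 0"
  proof (rule ccontr)
    assume sd: "\<not> s * d > 0"
    obtain t where t: "t \<in> {a..b}" "z 0 t > 0" using z'(3) zpos by (force simp: less_le)
    then have wa: "weakly_alternates a b 1 1 (z 0)" by (intro weakly_alternates_1[of t]) auto
    let ?I = "insert top_idx A'"
    have cs: "count_below ?I top_idx = card A"
    proof -
      have "{i \<in> ?I. i < top_idx} = A'" using sw(3) by auto
      then show ?thesis using sw(2) by (simp add: count_below_def)
    qed
    have sub: "?I \<subseteq> {..<n}" using sw(3) sn by auto
    have cI: "card ?I = Suc (card A)"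
    proof -
      have "top_idx \<notin> A'" "finite A'" using sw(3) finite_subset by blast+
      then show ?thesis using sw(2) by simp
    qed
    have nr: "nonresonant n ?I B" using nonresonant_mono[OF AB(5), of ?I B] sw(4) by auto
    have "alternates a b (1 + count_below ?I n + count_below B n - n) (1 * (-1) ^ (n + count_below ?I n)) (z n)"
    proof (rule chain_alternations[OF z'(1) wa _ nr])
      fix i assume "i \<in> ?I"
      then show "1 * (-1) ^ (i + count_below ?I i) * z i a \<le> 0"
        using sd cs z'(2) by (auto simp: s_def d_def bc_def)
    qed (use z'(2) n_pos in \<open>auto simp: bc_def\<close>)
    moreover have "1 + count_below ?I n + count_below B n - n \<ge> 2"
      using cI sub AB by (simp add: count_below_eq_card)
    moreover have "rho A * z n t \<ge> 0" if "t \<in> {a..b}" for t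
      using z'(4)[OF that] zpos[OF that] mu by simp
    ultimately show False by (rule no_alternation_of_nonneg_source)
  qed
  have dy0: "d * y 0 t \<ge> 0" if "t \<in> {a..b}" for t
  proof -
    have "(s * d) * (s * y 0 t) \<ge> 0" using sd y(6)[OF that] by (simp add: s_def)
    also have "(s * d) * (s * y 0 t) = (s * s) * (d * y 0 t)" by (simp only: mult_ac)
    finally show ?thesis by (simp add: ss)
  qed
  define v where "v = (\<lambda>i t. 1 * z i t + (- d) * y i t)"
  have vc: "chain v" unfolding v_def by (rule chain_lincomb[OF z'(1) y(1)])
  have vbc: "bc A B v" unfolding bc_def
  proof (intro conjI ballI)
    fix i assume "i \<in> A"
    then show "v i a = 0" using z'(2) y(3)[of i] y(4)
      by (cases "i = top_idx") (auto simp: v_def bc_def d_def A'_eq)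
  qed (use z'(2) y(5) in \<open>auto simp: v_def bc_def\<close>)
  have v0: "v 0 t \<ge> 0" if t: "t \<in> {a..b}" for t
  proof -
    have "(-1) * v 0 t \<le> 0"
    proof (rule inverse_negD[OF neg chain_scale[OF vc] bc_scale[OF vbc] _ t])
      fix t assume t: "t \<in> {a..b}"
      have "rho A * ((-1) * v n t) - lam * ((-1) * v 0 t)
          = d * (rho A * y n t) - rho A * z n t + lam * z 0 t - d * (lam * y 0 t)"
        by (simp add: v_def algebra_simps)
      also have "\<dots> = (lam - mu) * z 0 t" using y(2)[OF t] z'(4)[OF t] by (simp add: algebra_simps)
      also have "\<dots> \<ge> 0" using lam zpos[OF t] by simp
      finally show "0 \<le> rho A * ((-1) * v n t) - lam * ((-1) * v 0 t)" .
    qed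
    then show ?thesis by simp
  qed
  \<comment> \<open>Squeezed between \<open>0\<close> and \<open>z\<close>, the chain \<open>d y\<close> vanishes at \<open>a\<close> to the order of \<open>z\<close>.\<close>
  have order: "y' alpha a \<ge> 0" if y': "chain y'" "\<And>i. i < alpha \<Longrightarrow> y' i a = 0"
    "\<And>t. t \<in> {a..b} \<Longrightarrow> y' 0 t \<ge> 0" for y'
  proof (rule ccontr)
    assume "\<not> y' alpha a \<ge> 0"
    then have "\<exists>c. a < c \<and> c \<le> b \<and> (\<forall>t\<in>{a<..c}. (-1) * y' 0 t > 0)"
      using y'(2) lm(1) by (intro leading_term_positive[OF chain_scale[OF y'(1), of "-1"], of alpha]) auto
    then obtain c where "a < c" "c \<le> b" "y' 0 c < 0" by force
    then show False using y'(3)[of c] by simp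
  qed
  have low: "i \<in> A" "i \<in> A'" "i \<noteq> top_idx" if "i < alpha" for i
    using lm(3)[OF that] that gap' by (auto simp: A'_eq)
  have "d * y alpha a \<ge> 0"
    by (rule order[OF chain_scale[OF y(1)]]) (use dy0 low y(3) in auto)
  moreover have "v alpha a \<ge> 0"
    by (rule order[OF vc]) (use v0 low vbc in \<open>auto simp: bc_def\<close>)
  then have "d * y alpha a \<le> 0"
    using z'(2) by (simp add: v_def bc_def A'_eq)
  ultimately have ya: "d * y alpha a = 0" by simp
  have d0: "d \<noteq> 0" using sd by auto
  have ev: "eigenchain A' B lam (\<lambda>i t. d * y i t)"
    unfolding eigenchain_def
  proof (intro conjI ballI)
    show "chain (\<lambda>i t. d * y i t)" by (rule chain_scale[OF y(1)])
    show "bc A' B (\<lambda>i t. d * y i t)" using ya y(3,5) by (auto simp: bc_def A'_eq)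
    show "\<exists>t\<in>{a..b}. d * y 0 t \<noteq> 0"
    proof (rule ccontr)
      assume "\<not> ?thesis"
      then have "y 0 t = 0" if "t \<in> {a..b}" for t using d0 that by simp
      then have "y top_idx a = 0"
        by (rule chain_zero[OF y(1)]) (use sn ab in simp_all)
      then show False using y(4) by simp
    qed
    show "rho A' * (d * y n t) = lam * (d * y 0 t)" if "t \<in> {a..b}" for t
      using y(2)[OF that] by (simp add: rho' mult.left_commute)
  qed
  then show False
    using no_eigenvalue_below_positive_eigenchain[OF sw(1) ev _ z[folded A'_def] mu lam] dy0 by blast
qed

definition principal :: "nat set \<Rightarrow> nat set \<Rightarrow> real \<Rightarrow> bool" where
  "principal A B lam \<longleftrightarrow> lam > 0 \<and> (\<exists>z. eigenchain A B lam z) \<and>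
     (\<forall>mu y. mu > 0 \<longrightarrow> eigenchain A B mu y \<longrightarrow> lam \<le> mu)"

lemma principal_exists:
  assumes P: "poised A B"
  obtains lam z where "principal A B lam" "eigenchain A B lam z" "\<And>t. t \<in> {a..b} \<Longrightarrow> z 0 t \<ge> 0"
proof -
  obtain lam z where lz: "lam > 0" "eigenchain A B lam z" "\<And>t. t \<in> {a..b} \<Longrightarrow> z 0 t \<ge> 0"
    using principal_eigenvalue_exists[OF P] by blast
  have "principal A B lam"
    unfolding principal_def using lz no_eigenvalue_below_positive_eigenchain[OF P lz(2,3)]
    by (meson not_le)
  then show thesis using that lz by blast
qed

text \<open>Reflection of the interval exchanges the two end points; the sign \<open>rho\<close> is adapted to the
  exchange because the numbers of conditions at the two ends add up to the order.\<close>

lemma reflection: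
  assumes P: "poised A B" and neg: "inverse_neg A B lam"
  shows "quasi_chain.inverse_neg (-b) (-a) n (\<lambda>i t. w i (- t)) B A lam"
    "quasi_chain.poised n B A"
    "\<And>A' mu z. card A' = card A \<Longrightarrow> eigenchain A B' mu z \<Longrightarrow> card B' = card B \<Longrightarrow> quasi_chain.eigenchain (-b) (-a) n (\<lambda>i t. w i (- t)) B' A mu (reflected z)"
proof -
  interpret R: quasi_chain "-b" "-a" n "\<lambda>i t. w i (- t)" by (rule quasi_chain_reflected)
  have sum: "card A + card B = n" using P by (auto simp: poised_def)
  have rho: "rho A * (-1) ^ n = R.rho B'" if "card B' = card B" for B'
  proof -
    have "even (n + card A + n) \<longleftrightarrow> even (n + card B)" using sum by presburger
    then have "(-1 :: real) ^ (n + card A + n) = (-1) ^ (n + card B)"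
      unfolding minus_one_power_iff by simp
    then show ?thesis by (simp add: rho_def R.rho_def that flip: power_add)
  qed
  show "R.poised B A" using P by (auto simp: poised_def R.poised_def nonresonant_def add.commute)
  show "R.inverse_neg B A lam" unfolding R.inverse_neg_def
  proof (intro allI impI ballI)
    fix y t assume y: "R.chain y" "R.bc B A y" "\<forall>t\<in>{-b..-a}. 0 \<le> R.rho B * y n t - lam * y 0 t"
      and t: "t \<in> {-b..-a}"
    have c: "chain (R.reflected y)" using R.chain_reflected[OF y(1)] by simp
    have "R.reflected y 0 (- t) \<le> 0"
    proof (rule inverse_negD[OF neg c])
      show "bc A B (R.reflected y)" using y(2) by (auto simp: bc_def R.bc_def R.reflected_def)
      fix x assume x: "x \<in> {a..b}"
      have "rho A * R.reflected y n x = R.rho B * y n (- x)"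
        using rho[of B] by (simp add: R.reflected_def flip: mult.assoc)
      then show "0 \<le> rho A * R.reflected y n x - lam * R.reflected y 0 x"
        unfolding \<open>rho A * R.reflected y n x = R.rho B * y n (- x)\<close> using y(3)[rule_format, of "- x"] x by (simp add: R.reflected_def)
    qed (use t in auto)
    then show "y 0 t \<le> 0" by (simp add: R.reflected_def)
  qed
  fix A' mu z assume "eigenchain A B' mu z" and cB: "card B' = card B"
  then have z: "chain z" "bc A B' z" "\<exists>t\<in>{a..b}. z 0 t \<noteq> 0" "\<And>t. t \<in> {a..b} \<Longrightarrow> rho A * z n t = mu * z 0 t"
    by (auto simp: eigenchain_def)
  show "R.eigenchain B' A mu (reflected z)"
    unfolding R.eigenchain_def
  proof (intro conjI ballI)
    show "R.chain (reflected z)" by (rule chain_reflected[OF z(1)])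
    show "R.bc B' A (reflected z)" using z(2) by (auto simp: bc_def R.bc_def reflected_def)
    obtain t where "t \<in> {a..b}" "z 0 t \<noteq> 0" using z(3) by blast
    then show "\<exists>t\<in>{-b..-a}. reflected z 0 t \<noteq> 0" by (intro bexI[of _ "- t"]) (auto simp: reflected_def)
    fix t assume t: "t \<in> {-b..-a}"
    have "R.rho B' * reflected z n t = (rho A * ((-1) ^ n * (-1) ^ n)) * z n (- t)"
      unfolding rho[OF cB, symmetric] reflected_def by (simp only: mult.assoc)
    also have "(-1 :: real) ^ n * (-1) ^ n = 1" by (simp flip: power_add)
    finally have "R.rho B' * reflected z n t = rho A * z n (- t)" by (simp only: mult_1_right)
    then show "R.rho B' * reflected z n t = mu * reflected z 0 t"
      unfolding \<open>R.rho B' * reflected z n t = rho A * z n (- t)\<close>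
      using z(4)[of "- t"] t by (simp add: reflected_def)
  qed
qed

theorem inverse_neg_range:
  assumes P: "poised A B" and neg: "inverse_neg A B lam"
  obtains l1 l3 l3' where "principal A B l1" "principal (swap_max n A) B l3" "principal A (swap_max n B) l3'"
    "l1 < lam" "lam \<le> l3" "lam \<le> l3'" "least_missing n A < Max A" "least_missing n B < Max B"
proof -
  interpret R: quasi_chain "-b" "-a" n "\<lambda>i t. w i (- t)" by (rule quasi_chain_reflected)
  note R = reflection[OF P neg]
  have gA: "least_missing n A < Max A" by (rule inverse_neg_imp_gap[OF P neg])
  have gB: "least_missing n B < Max B" by (rule R.inverse_neg_imp_gap[OF R(2,1)])
  obtain l1 z1 where l1: "principal A B l1" "eigenchain A B l1 z1" "\<And>t. t \<in> {a..b} \<Longrightarrow> z1 0 t \<ge> 0"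
    using principal_exists[OF P] by blast
  obtain l3 z3 where l3: "principal (swap_max n A) B l3" "eigenchain (swap_max n A) B l3 z3"
    "\<And>t. t \<in> {a..b} \<Longrightarrow> z3 0 t \<ge> 0"
    using principal_exists[OF poised_swap_max(1)[OF P gA]] by blast
  have "R.poised (swap_max n B) A" by (rule R.poised_swap_max(1)[OF R(2) gB])
  then have PB: "poised A (swap_max n B)"
    by (auto simp: poised_def R.poised_def nonresonant_def add.commute)
  obtain l3' z3' where l3': "principal A (swap_max n B) l3'" "eigenchain A (swap_max n B) l3' z3'"
    "\<And>t. t \<in> {a..b} \<Longrightarrow> z3' 0 t \<ge> 0"
    using principal_exists[OF PB] by blast
  have "lam \<le> l3'"
  proof (rule R.inverse_neg_below_swapped_eigenvalue[OF R(2,1)])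
    show "R.eigenchain (swap_max n B) A l3' (reflected z3')"
      by (rule R(3)[OF refl l3'(2)]) (rule R.poised_swap_max(2)[OF R(2) gB])
    show "reflected z3' 0 t \<ge> 0" if "t \<in> {-b..-a}" for t
      using l3'(3)[of "- t"] that by (simp add: reflected_def)
    show "l3' > 0" using l3'(1) by (simp add: principal_def)
  qed
  moreover have "lam \<le> l3"
    by (rule inverse_neg_below_swapped_eigenvalue[OF P neg l3(2,3)]) (use l3(1) in \<open>auto simp: principal_def\<close>)
  moreover have "l1 < lam" by (rule inverse_neg_beyond_principal_eigenvalue[OF neg l1(2,3)])
  ultimately show thesis using that l1(1) l3(1) l3'(1) gA gB by blast
qed

end

section \<open>Functions of class C_n on a compact interval\<close>

definition deriv_on :: "real set \<Rightarrow> (real \<Rightarrow> real) \<Rightarrow> real \<Rightarrow> real" where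
  "deriv_on I u = (\<lambda>t. vector_derivative u (at t within I))"

lemma nderiv_on_Suc': "nderiv_on I (Suc i) u = nderiv_on I i (deriv_on I u)"
  by (induction i) (auto simp: deriv_on_def)

declare nderiv_on.simps(2) [simp del]

lemma T_fac_Suc: "T_fac I v (Suc l) u = deriv_on I (\<lambda>s. T_fac I v l u s / v (Suc l) s)"
  by (simp add: deriv_on_def)

declare T_fac.simps(2) [simp del]

lemma T_fac_shift: "T_fac I v (Suc l) u = T_fac I (\<lambda>l. v (Suc l)) l (deriv_on I (\<lambda>s. u s / v 1 s))"
  by (induction l) (simp_all add: T_fac_Suc)

lemma deriv_on_cong:
  assumes "\<And>t. t \<in> I \<Longrightarrow> u t = v t" "t \<in> I"
  shows "deriv_on I u t = deriv_on I v t"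
  unfolding deriv_on_def by (rule vector_derivative_cong_eq) (use assms in auto)

lemma nderiv_on_cong:
  assumes "\<And>t. t \<in> I \<Longrightarrow> u t = v t" "t \<in> I"
  shows "nderiv_on I i u t = nderiv_on I i v t"
  using assms
proof (induction i arbitrary: u v t)
  case (Suc i)
  show ?case unfolding nderiv_on_Suc'
  proof (rule Suc.IH[OF _ Suc.prems(2)])
    show "deriv_on I u t = deriv_on I v t" if "t \<in> I" for t
      using deriv_on_cong[of I u v] Suc.prems(1) that by blast
  qed
qed auto

lemma C_n_0: "u \<in> C_n I 0 \<longleftrightarrow> continuous_on I u"
  by (simp add: C_n_def)

context
  fixes a b :: real
  assumes ab: "a < b"
begin

lemma deriv_on_eqI:
  "(u has_real_derivative d) (at t within {a..b}) \<Longrightarrow> t \<in> {a..b} \<Longrightarrow> deriv_on {a..b} u t = d"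
  unfolding deriv_on_def using ab
  by (intro vector_derivative_within_closed_interval) (auto simp: has_real_derivative_iff_has_vector_derivative)

lemma C_n_Suc:
  "u \<in> C_n {a..b} (Suc m) \<longleftrightarrow> (\<forall>t\<in>{a..b}. u differentiable (at t within {a..b})) \<and> deriv_on {a..b} u \<in> C_n {a..b} m"
  unfolding C_n_def by (auto simp: nderiv_on_Suc' All_less_Suc2)

lemma C_n_SucD:
  assumes "u \<in> C_n {a..b} (Suc m)"
  shows "t \<in> {a..b} \<Longrightarrow> (u has_real_derivative deriv_on {a..b} u t) (at t within {a..b})" "deriv_on {a..b} u \<in> C_n {a..b} m"
proof -
  show "deriv_on {a..b} u \<in> C_n {a..b} m" using assms by (simp add: C_n_Suc)
  assume "t \<in> {a..b}"
  then have "u differentiable (at t within {a..b})" using assms by (simp add: C_n_Suc)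
  then show "(u has_real_derivative deriv_on {a..b} u t) (at t within {a..b})"
    by (simp add: deriv_on_def has_real_derivative_iff_has_vector_derivative vector_derivative_works)
qed

lemma has_real_derivative_cong_on:
  assumes "(u has_real_derivative d) (at t within {a..b})" "\<And>t. t \<in> {a..b} \<Longrightarrow> u t = v t" "t \<in> {a..b}"
  shows "(v has_real_derivative d) (at t within {a..b})"
  by (rule has_field_derivative_transform_within[OF assms(1) zero_less_one]) (use assms in auto)

lemma C_n_cong:
  assumes "u \<in> C_n {a..b} m" "\<And>t. t \<in> {a..b} \<Longrightarrow> u t = v t"
  shows "v \<in> C_n {a..b} m"
  using assms
proof (induction m arbitrary: u v)
  case 0
  then show ?case unfolding C_n_0 using continuous_on_cong[of "{a..b}" "{a..b}" u v] by simp
next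
  case (Suc m)
  have "v differentiable (at t within {a..b})" if "t \<in> {a..b}" for t
    using has_real_derivative_cong_on[OF C_n_SucD(1)[OF Suc.prems(1) that] Suc.prems(2) that]
    by (auto simp: real_differentiable_def)
  moreover have "deriv_on {a..b} v \<in> C_n {a..b} m"
    by (rule Suc.IH[OF C_n_SucD(2)[OF Suc.prems(1)]]) (use deriv_on_cong Suc.prems(2) in blast)
  ultimately show ?case by (simp add: C_n_Suc)
qed

lemma C_n_SucI:
  assumes "\<And>t. t \<in> {a..b} \<Longrightarrow> (u has_real_derivative u' t) (at t within {a..b})" "u' \<in> C_n {a..b} m"
  shows "u \<in> C_n {a..b} (Suc m)"
  unfolding C_n_Suc
proof
  show "\<forall>t\<in>{a..b}. u differentiable (at t within {a..b})"
    using assms(1) real_differentiable_def by blast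
  show "deriv_on {a..b} u \<in> C_n {a..b} m"
    by (rule C_n_cong[OF assms(2)]) (use deriv_on_eqI assms(1) in force)
qed

lemma C_n_down: "u \<in> C_n {a..b} (Suc m) \<Longrightarrow> u \<in> C_n {a..b} m"
proof (induction m arbitrary: u)
  case 0
  show ?case unfolding C_n_0
    by (rule DERIV_continuous_on[OF C_n_SucD(1)[OF 0]])
next
  case (Suc m)
  show ?case
    by (rule C_n_SucI[OF C_n_SucD(1)[OF Suc.prems] Suc.IH[OF C_n_SucD(2)[OF Suc.prems]]])
qed

lemma C_n_mono:
  assumes "u \<in> C_n {a..b} m" "k \<le> m" shows "u \<in> C_n {a..b} k"
  using assms(2,1) by (induction k rule: inc_induct) (auto dest: C_n_down)

lemma C_n_lincomb:
  "u \<in> C_n {a..b} m \<Longrightarrow> v \<in> C_n {a..b} m \<Longrightarrow> (\<lambda>t. c * u t + d * v t) \<in> C_n {a..b} m"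
proof (induction m arbitrary: u v)
  case 0
  then show ?case unfolding C_n_0 by (intro continuous_intros)
next
  case (Suc m)
  show ?case
    by (rule C_n_SucI[where u' = "\<lambda>t. c * deriv_on {a..b} u t + d * deriv_on {a..b} v t"])
       (auto intro!: DERIV_add DERIV_cmult C_n_SucD(1)[OF Suc.prems(1)] C_n_SucD(1)[OF Suc.prems(2)]
         Suc.IH C_n_SucD(2)[OF Suc.prems(1)] C_n_SucD(2)[OF Suc.prems(2)])
qed

lemma deriv_on_lincomb:
  assumes "u \<in> C_n {a..b} (Suc m)" "v \<in> C_n {a..b} (Suc m)" "t \<in> {a..b}"
  shows "deriv_on {a..b} (\<lambda>t. c * u t + d * v t) t = c * deriv_on {a..b} u t + d * deriv_on {a..b} v t"
  using assms by (intro deriv_on_eqI DERIV_add DERIV_cmult C_n_SucD(1))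

lemma product_rule_on:
  assumes "u \<in> C_n {a..b} (Suc m)" "v \<in> C_n {a..b} (Suc m)" "t \<in> {a..b}"
  shows "((\<lambda>t. u t * v t) has_real_derivative
    1 * (deriv_on {a..b} u t * v t) + 1 * (u t * deriv_on {a..b} v t)) (at t within {a..b})"
  using DERIV_mult[OF C_n_SucD(1)[OF assms(1,3)] C_n_SucD(1)[OF assms(2,3)]]
  by (simp add: algebra_simps)

lemma C_n_mult: "u \<in> C_n {a..b} m \<Longrightarrow> v \<in> C_n {a..b} m \<Longrightarrow> (\<lambda>t. u t * v t) \<in> C_n {a..b} m"
proof (induction m arbitrary: u v)
  case 0
  then show ?case unfolding C_n_0 by (intro continuous_intros)
next
  case (Suc m)
  show ?case
    by (rule C_n_SucI[OF product_rule_on[OF Suc.prems]], assumption)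
       (intro C_n_lincomb Suc.IH C_n_SucD(2)[OF Suc.prems(1)] C_n_SucD(2)[OF Suc.prems(2)]
         C_n_down[OF Suc.prems(1)] C_n_down[OF Suc.prems(2)])
qed

lemma C_n_const: "(\<lambda>_. c) \<in> C_n {a..b} m"
proof (induction m arbitrary: c)
  case (Suc m)
  show ?case by (rule C_n_SucI[of _ "\<lambda>_. 0"]) (use Suc in auto)
qed (simp add: C_n_0)

lemma C_n_inverse:
  "v \<in> C_n {a..b} m \<Longrightarrow> (\<And>t. t \<in> {a..b} \<Longrightarrow> v t > 0) \<Longrightarrow> (\<lambda>t. 1 / v t) \<in> C_n {a..b} m"
proof (induction m)
  case 0
  then show ?case unfolding C_n_0 by (intro continuous_intros) force+
next
  case (Suc m)
  have inv: "(\<lambda>t. 1 / v t) \<in> C_n {a..b} m" by (rule Suc.IH) (use Suc.prems C_n_down in auto)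
  show ?case
  proof (rule C_n_SucI[where u' = "\<lambda>t. (-1) * (deriv_on {a..b} v t * (1 / v t * (1 / v t))) + 0 * 0"])
    fix t assume t: "t \<in> {a..b}"
    then have "v t \<noteq> 0" using Suc.prems(2) by force
    from DERIV_inverse'[OF C_n_SucD(1)[OF Suc.prems(1) t] this]
    show "((\<lambda>t. 1 / v t) has_real_derivative
       (-1) * (deriv_on {a..b} v t * (1 / v t * (1 / v t))) + 0 * 0) (at t within {a..b})"
      by (simp add: field_simps inverse_eq_divide)
  next
    show "(\<lambda>t. (-1) * (deriv_on {a..b} v t * (1 / v t * (1 / v t))) + 0 * 0) \<in> C_n {a..b} m"
      by (intro C_n_lincomb C_n_mult inv C_n_SucD(2)[OF Suc.prems(1)] C_n_const)
  qed
qed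

lemma C_n_divide:
  assumes "u \<in> C_n {a..b} m" "v \<in> C_n {a..b} m" "\<And>t. t \<in> {a..b} \<Longrightarrow> v t > 0"
  shows "(\<lambda>t. u t / v t) \<in> C_n {a..b} m"
  using C_n_mult[OF assms(1) C_n_inverse[OF assms(2,3)]] by simp

lemma C_n_prod:
  "finite J \<Longrightarrow> (\<And>l. l \<in> J \<Longrightarrow> v l \<in> C_n {a..b} m) \<Longrightarrow> (\<lambda>t. \<Prod>l\<in>J. v l t) \<in> C_n {a..b} m"
  by (induction J rule: finite_induct) (auto intro: C_n_const C_n_mult)

lemma nderiv_on_lincomb:
  assumes "u \<in> C_n {a..b} m" "v \<in> C_n {a..b} m" "i \<le> m" "t \<in> {a..b}"
  shows "nderiv_on {a..b} i (\<lambda>t. c * u t + d * v t) t = c * nderiv_on {a..b} i u t + d * nderiv_on {a..b} i v t"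
  using assms
proof (induction i arbitrary: u v m t)
  case (Suc i)
  then obtain k where k: "m = Suc k" "i \<le> k" by (cases m) auto
  have uv: "u \<in> C_n {a..b} (Suc k)" "v \<in> C_n {a..b} (Suc k)" using Suc.prems k by auto
  have "nderiv_on {a..b} (Suc i) (\<lambda>t. c * u t + d * v t) t
      = nderiv_on {a..b} i (\<lambda>t. c * deriv_on {a..b} u t + d * deriv_on {a..b} v t) t"
    unfolding nderiv_on_Suc' by (rule nderiv_on_cong) (use deriv_on_lincomb[OF uv] Suc.prems in auto)
  also have "\<dots> = c * nderiv_on {a..b} i (deriv_on {a..b} u) t + d * nderiv_on {a..b} i (deriv_on {a..b} v) t"
    by (rule Suc.IH[OF C_n_SucD(2)[OF uv(1)] C_n_SucD(2)[OF uv(2)] k(2) Suc.prems(4)])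
  finally show ?case by (simp add: nderiv_on_Suc')
qed auto

definition vanishes_to_order :: "nat \<Rightarrow> (real \<Rightarrow> real) \<Rightarrow> real \<Rightarrow> bool" where
  "vanishes_to_order m u c \<longleftrightarrow> (\<forall>i<m. nderiv_on {a..b} i u c = 0)"

lemma vanishes_to_order_Suc: "vanishes_to_order (Suc m) u c \<longleftrightarrow> u c = 0 \<and> vanishes_to_order m (deriv_on {a..b} u) c"
  by (auto simp: vanishes_to_order_def All_less_Suc2 nderiv_on_Suc')

lemma vanishes_to_order_down: "vanishes_to_order (Suc m) u c \<Longrightarrow> vanishes_to_order m u c"
  by (auto simp: vanishes_to_order_def)

lemma vanishes_to_order_cong: "c \<in> {a..b} \<Longrightarrow> (\<And>t. t \<in> {a..b} \<Longrightarrow> u t = v t) \<Longrightarrow> vanishes_to_order m u c \<Longrightarrow> vanishes_to_order m v c"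
  unfolding vanishes_to_order_def using nderiv_on_cong[of "{a..b}" u v c] by auto

lemma vanishes_to_order_mult:
  assumes "u \<in> C_n {a..b} m" "v \<in> C_n {a..b} m" "c \<in> {a..b}" "vanishes_to_order m u c"
  shows "vanishes_to_order m (\<lambda>t. u t * v t) c"
  using assms
proof (induction m arbitrary: u v)
  case 0
  then show ?case by (simp add: vanishes_to_order_def)
next
  case (Suc m)
  let ?p = "\<lambda>t. deriv_on {a..b} u t * v t" and ?q = "\<lambda>t. u t * deriv_on {a..b} v t"
  note D = C_n_SucD(2)[OF Suc.prems(1)] C_n_SucD(2)[OF Suc.prems(2)]
    C_n_down[OF Suc.prems(1)] C_n_down[OF Suc.prems(2)]
  have u: "u c = 0" "vanishes_to_order m (deriv_on {a..b} u) c" "vanishes_to_order m u c"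
    using Suc.prems(4) vanishes_to_order_down by (auto simp: vanishes_to_order_Suc)
  have "vanishes_to_order m ?p c" "vanishes_to_order m ?q c"
    by (rule Suc.IH[OF D(1,4) Suc.prems(3) u(2)], rule Suc.IH[OF D(3,2) Suc.prems(3) u(3)])
  then have "vanishes_to_order m (\<lambda>t. 1 * ?p t + 1 * ?q t) c"
    using nderiv_on_lincomb[OF C_n_mult[OF D(1,4)] C_n_mult[OF D(3,2)] less_imp_le Suc.prems(3), of _ 1 1]
    by (auto simp: vanishes_to_order_def)
  then have "vanishes_to_order m (deriv_on {a..b} (\<lambda>t. u t * v t)) c"
  proof (rule vanishes_to_order_cong[OF Suc.prems(3), rotated])
    fix t assume "t \<in> {a..b}"
    then show "1 * ?p t + 1 * ?q t = deriv_on {a..b} (\<lambda>t. u t * v t) t"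
      by (intro deriv_on_eqI[symmetric] product_rule_on[OF Suc.prems(1,2)])
  qed
  then show ?case using u(1) by (simp add: vanishes_to_order_Suc)
qed

lemma vanishes_to_order_divide_iff:
  assumes "u \<in> C_n {a..b} m" "v \<in> C_n {a..b} m" "\<And>t. t \<in> {a..b} \<Longrightarrow> v t > 0" "c \<in> {a..b}"
  shows "vanishes_to_order m (\<lambda>t. u t / v t) c \<longleftrightarrow> vanishes_to_order m u c"
proof
  assume "vanishes_to_order m u c"
  from vanishes_to_order_mult[OF assms(1) C_n_inverse[OF assms(2,3)] assms(4) this]
  show "vanishes_to_order m (\<lambda>t. u t / v t) c" by simp
next
  assume "vanishes_to_order m (\<lambda>t. u t / v t) c"
  from vanishes_to_order_mult[OF C_n_divide[OF assms(1-3)] assms(2,4) this]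
  have "vanishes_to_order m (\<lambda>t. u t / v t * v t) c" .
  then show "vanishes_to_order m u c"
  proof (rule vanishes_to_order_cong[OF assms(4), rotated])
    show "u t / v t * v t = u t" if "t \<in> {a..b}" for t using assms(3)[OF that] by simp
  qed
qed

text \<open>Division by a positive function does not change the order of vanishing, and neither does the
  passage from derivatives to quasi-derivatives, although the individual values differ.\<close>

lemma vanishes_to_order_iff_T_fac:
  assumes "u \<in> C_n {a..b} m" "\<And>l. l \<in> {1..m} \<Longrightarrow> v l \<in> C_n {a..b} m"
    "\<And>l t. l \<in> {1..m} \<Longrightarrow> t \<in> {a..b} \<Longrightarrow> v l t > 0" "c \<in> {a..b}"
  shows "vanishes_to_order m u c \<longleftrightarrow> (\<forall>i<m. T_fac {a..b} v i u c = 0)"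
  using assms
proof (induction m arbitrary: u v)
  case 0
  then show ?case by (simp add: vanishes_to_order_def)
next
  case (Suc m)
  let ?u = "\<lambda>t. u t / v 1 t"
  have v1: "v 1 \<in> C_n {a..b} (Suc m)" "\<And>t. t \<in> {a..b} \<Longrightarrow> v 1 t > 0" using Suc.prems(2,3)[of 1] by auto
  have uc: "?u \<in> C_n {a..b} (Suc m)" by (rule C_n_divide[OF Suc.prems(1) v1])
  have "vanishes_to_order (Suc m) u c \<longleftrightarrow> vanishes_to_order (Suc m) ?u c"
    using vanishes_to_order_divide_iff[OF Suc.prems(1) v1 Suc.prems(4)] by simp
  also have "\<dots> \<longleftrightarrow> u c = 0 \<and> vanishes_to_order m (deriv_on {a..b} ?u) c"
    using v1(2)[OF Suc.prems(4)] by (auto simp: vanishes_to_order_Suc)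
  also have "vanishes_to_order m (deriv_on {a..b} ?u) c \<longleftrightarrow> (\<forall>i<m. T_fac {a..b} (\<lambda>l. v (Suc l)) i (deriv_on {a..b} ?u) c = 0)"
    by (rule Suc.IH[OF C_n_SucD(2)[OF uc] C_n_down _ Suc.prems(4)]) (use Suc.prems in auto)
  also have "u c = 0 \<and> \<dots> \<longleftrightarrow> (\<forall>i<Suc m. T_fac {a..b} v i u c = 0)"
    by (simp add: All_less_Suc2 T_fac_shift del: One_nat_def)
  finally show ?case .
qed

lemma T_fac_C_n:
  assumes "u \<in> C_n {a..b} m" "\<And>l. l \<in> {1..m} \<Longrightarrow> v l \<in> C_n {a..b} m"
    "\<And>l t. l \<in> {1..m} \<Longrightarrow> t \<in> {a..b} \<Longrightarrow> v l t > 0" "l \<le> m"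
  shows "T_fac {a..b} v l u \<in> C_n {a..b} (m - l)"
  using assms(4)
proof (induction l)
  case (Suc l)
  have "v (Suc l) \<in> C_n {a..b} (m - l)" by (rule C_n_mono[OF assms(2)]) (use Suc in auto)
  then have "(\<lambda>t. T_fac {a..b} v l u t / v (Suc l) t) \<in> C_n {a..b} (m - l)"
    by (intro C_n_divide) (use Suc assms(3) in auto)
  also have "m - l = Suc (m - Suc l)" using Suc by simp
  finally show ?case unfolding T_fac_Suc by (rule C_n_SucD(2))
qed (use assms in auto)

lemma T_fac_quotient_deriv:
  assumes "u \<in> C_n {a..b} m" "\<And>l. l \<in> {1..m} \<Longrightarrow> v l \<in> C_n {a..b} m"
    "\<And>l t. l \<in> {1..m} \<Longrightarrow> t \<in> {a..b} \<Longrightarrow> v l t > 0" "l < m"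
  shows "(\<lambda>t. T_fac {a..b} v l u t / v (Suc l) t) \<in> C_n {a..b} (Suc (m - Suc l))"
proof -
  have "v (Suc l) \<in> C_n {a..b} (m - l)" by (rule C_n_mono[OF assms(2)]) (use assms(4) in auto)
  then have "(\<lambda>t. T_fac {a..b} v l u t / v (Suc l) t) \<in> C_n {a..b} (m - l)"
    by (intro C_n_divide T_fac_C_n assms) (use assms in auto)
  then show ?thesis using assms(4) by (simp add: Suc_diff_Suc)
qed

lemma T_fac_lincomb:
  assumes u: "u \<in> C_n {a..b} m" and z: "z \<in> C_n {a..b} m" and v: "\<And>l. l \<in> {1..m} \<Longrightarrow> v l \<in> C_n {a..b} m"
    "\<And>l t. l \<in> {1..m} \<Longrightarrow> t \<in> {a..b} \<Longrightarrow> v l t > 0" and l: "l \<le> m" and t: "t \<in> {a..b}"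
  shows "T_fac {a..b} v l (\<lambda>t. c * u t + d * z t) t = c * T_fac {a..b} v l u t + d * T_fac {a..b} v l z t"
  using l t
proof (induction l arbitrary: t)
  case (Suc l)
  have lm: "l < m" using Suc.prems by simp
  have "T_fac {a..b} v (Suc l) (\<lambda>t. c * u t + d * z t) t
      = deriv_on {a..b} (\<lambda>t. c * (T_fac {a..b} v l u t / v (Suc l) t) + d * (T_fac {a..b} v l z t / v (Suc l) t)) t"
    unfolding T_fac_Suc
  proof (rule deriv_on_cong)
    fix s assume s: "s \<in> {a..b}"
    show "T_fac {a..b} v l (\<lambda>t. c * u t + d * z t) s / v (Suc l) s
      = c * (T_fac {a..b} v l u s / v (Suc l) s) + d * (T_fac {a..b} v l z s / v (Suc l) s)"
      using Suc.IH[OF less_imp_le[OF lm] s] by (simp add: add_divide_distrib)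
  qed (rule Suc.prems)
  also have "\<dots> = c * T_fac {a..b} v (Suc l) u t + d * T_fac {a..b} v (Suc l) z t"
    unfolding T_fac_Suc
    by (rule deriv_on_lincomb[OF T_fac_quotient_deriv[OF u v lm] T_fac_quotient_deriv[OF z v lm] Suc.prems(2)])
  finally show ?case .
qed simp

lemma poly_C_n: "poly p \<in> C_n {a..b} m"
proof (induction m arbitrary: p)
  case (Suc m)
  show ?case
    by (rule C_n_SucI[OF _ Suc[of "pderiv p"]]) (rule DERIV_subset[OF poly_DERIV], simp)
qed (simp add: C_n_0 continuous_at_imp_continuous_on)

lemma nderiv_on_poly: "t \<in> {a..b} \<Longrightarrow> nderiv_on {a..b} j (poly p) t = poly ((pderiv ^^ j) p) t"
proof (induction j arbitrary: p)
  case (Suc j)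
  have "nderiv_on {a..b} (Suc j) (poly p) t = nderiv_on {a..b} j (poly (pderiv p)) t"
    unfolding nderiv_on_Suc'
    by (rule nderiv_on_cong[OF deriv_on_eqI Suc.prems]) (auto intro: DERIV_subset[OF poly_DERIV])
  then show ?case using Suc by (simp add: funpow_Suc_right del: funpow.simps)
qed simp

end

lemma pderiv_power_dvd:
  fixes c :: real
  assumes "[:-c, 1:] ^ m dvd p" "j < m"
  shows "poly ((pderiv ^^ j) p) c = 0"
  using assms
proof (induction j arbitrary: p m)
  case 0
  then have "[:-c, 1:] dvd p" by (metis dvd_power dvd_trans)
  then show ?case by (simp add: poly_eq_0_iff_dvd)
next
  case (Suc j)
  then obtain k where k: "m = Suc k" "j < k" by (cases m) auto
  obtain r where "p = [:-c, 1:] ^ Suc k * r" using Suc.prems k by auto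
  then have p': "pderiv p = [:-c, 1:] ^ Suc k * pderiv r +
      r * (smult (of_nat (Suc k)) ([:-c, 1:] ^ k) * pderiv [:-c, 1:])"
    by (simp only: pderiv_mult pderiv_power_Suc)
  have "[:-c, 1:] ^ k dvd pderiv p"
    unfolding p'
    by (intro dvd_add dvd_mult2[OF le_imp_power_dvd] dvd_mult[OF dvd_mult2[OF dvd_smult[OF dvd_refl]]]) simp
  from Suc.IH[OF this k(2)] show ?case by (simp add: funpow_Suc_right del: funpow.simps)
qed

lemma pderiv_funpow_linear_power:
  fixes c :: real
  shows "poly ((pderiv ^^ j) ([:-c, 1:] ^ i)) c = of_bool (i = j) * fact i"
proof (induction j arbitrary: i)
  case 0
  then show ?case by (cases i) auto
next
  case (Suc j)
  have smult: "(pderiv ^^ j) (smult x p) = smult x ((pderiv ^^ j) p)" for x :: real and p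
    by (induction j) (auto simp: pderiv_smult)
  show ?case
  proof (cases i)
    case 0
    have "(pderiv ^^ j) 0 = (0 :: real poly)" by (induction j) auto
    then show ?thesis using 0 by (simp add: funpow_Suc_right pderiv_1 del: funpow.simps)
  next
    case (Suc i')
    have "pderiv ([:-c, 1:] ^ i) = smult (of_nat i) ([:-c, 1:] ^ i')"
      unfolding Suc by (simp add: pderiv_power_Suc pderiv_pCons del: power_Suc of_nat_Suc)
    then show ?thesis
      using Suc.IH[of i'] by (simp add: funpow_Suc_right smult Suc del: funpow.simps)
  qed
qed

text \<open>Hermite interpolation: the factor \<open>1 - Z ^ n\<close> is \<open>1\<close> up to order \<open>n\<close> at \<open>c\<close> and \<open>0\<close> up to
  order \<open>n\<close> at \<open>d\<close>.\<close>

lemma dual_polynomials: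
  fixes c d :: real
  assumes "c \<noteq> d"
  shows "\<exists>p. \<forall>j<n. poly ((pderiv ^^ j) p) c = of_bool (i = j) \<and> poly ((pderiv ^^ j) p) d = 0"
proof -
  define X where "X = [:-c, 1:]"
  define Y where "Y = [:-d, 1:]"
  \<comment> \<open>Normalised so that \<open>Z\<close> vanishes at \<open>c\<close>.\<close>
  define s where "s = 1 / (c - d) ^ n"
  define Z where "Z = 1 - smult s (Y ^ n)"
  have "poly Z c = 0" using assms by (simp add: Z_def Y_def s_def)
  then have XZ: "X ^ n dvd Z ^ n" by (simp add: X_def poly_eq_0_iff_dvd dvd_power_same)
  have "1 - Z dvd 1 - Z ^ n" by (simp add: one_diff_power_eq)
  moreover have "Y ^ n dvd 1 - Z" by (simp add: Z_def dvd_smult)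
  ultimately have YZ: "Y ^ n dvd 1 - Z ^ n" by (rule dvd_trans[rotated])
  define p where "p = smult (1 / fact i) ((1 - Z ^ n) * X ^ i)"
  have lin: "(pderiv ^^ j) (smult x (q - r)) = smult x ((pderiv ^^ j) q - (pderiv ^^ j) r)"
    for x :: real and q r j
    by (induction j) (auto simp: pderiv_smult pderiv_diff)
  have "poly ((pderiv ^^ j) p) c = of_bool (i = j)" if "j < n" for j
  proof -
    have "p = smult (1 / fact i) (X ^ i - Z ^ n * X ^ i)" by (simp add: p_def algebra_simps)
    moreover have "poly ((pderiv ^^ j) (Z ^ n * X ^ i)) c = 0"
      by (rule pderiv_power_dvd[OF _ that]) (use XZ in \<open>simp add: X_def dvd_mult2\<close>)
    ultimately show ?thesis by (simp add: lin X_def pderiv_funpow_linear_power)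
  qed
  moreover have "poly ((pderiv ^^ j) p) d = 0" if "j < n" for j
    by (rule pderiv_power_dvd[OF _ that]) (use YZ in \<open>simp add: p_def Y_def dvd_smult dvd_mult2\<close>)
  ultimately show ?thesis by blast
qed

section \<open>From derivatives to quasi-derivatives\<close>

text \<open>Chains and functions of class \<open>C_n\<close> correspond to each other under \<open>u = v 1 * y 0\<close>. The last
  weight absorbs the product of the remaining factors, so that the last entry of a chain is the
  differential operator divided by \<open>v 1\<close> and the eigenvalue equation reads \<open>y n = lam * y 0\<close>.\<close>

locale factorization =
  fixes a b :: real and n :: nat and v :: "nat \<Rightarrow> real \<Rightarrow> real"
  assumes ab: "a < b" and n2: "n \<ge> 2"
    and v_C: "\<And>l. l \<in> {1..n} \<Longrightarrow> v l \<in> C_n {a..b} n"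
    and v_pos: "\<And>l t. l \<in> {1..n} \<Longrightarrow> t \<in> {a..b} \<Longrightarrow> v l t > 0"
begin

definition weight :: "nat \<Rightarrow> real \<Rightarrow> real" where
  "weight i = (if Suc i < n then v (i + 2) else (\<lambda>t. 1 / (\<Prod>l=2..n. v l t)))"

definition quasi :: "(real \<Rightarrow> real) \<Rightarrow> nat \<Rightarrow> real \<Rightarrow> real" where
  "quasi u i t = (if i < n then T_fac {a..b} v i u t / v (Suc i) t
     else (\<Prod>l=2..n. v l t) * T_fac {a..b} v n u t)"

lemma prod_pos': "t \<in> {a..b} \<Longrightarrow> (\<Prod>l=2..n. v l t) > 0"
  by (rule prod_pos) (use v_pos in auto)

lemma weight_C_n: "i < n \<Longrightarrow> weight i \<in> C_n {a..b} n"
  unfolding weight_def using C_n_inverse[OF ab C_n_prod[OF ab, of "{2..n}" v n] prod_pos'] v_C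
  by (auto simp: not_less)

sublocale quasi_chain a b n weight
proof
  fix i assume i: "i < n"
  show "continuous_on {a..b} (weight i)"
    using C_n_mono[OF ab weight_C_n[OF i], of 0] by (simp add: C_n_0)
  fix t assume "t \<in> {a..b}"
  then show "weight i t > 0" unfolding weight_def using i v_pos prod_pos' by auto
qed (use ab n2 in auto)

lemma chain_quasi:
  assumes u: "u \<in> C_n {a..b} n"
  shows "chain (quasi u)"
  unfolding chain_def
proof (intro conjI allI impI ballI)
  fix i t assume i: "i < n" and t: "t \<in> {a..b}"
  have "quasi u i = (\<lambda>t. T_fac {a..b} v i u t / v (Suc i) t)" using i by (auto simp: quasi_def)
  then have "(quasi u i has_real_derivative T_fac {a..b} v (Suc i) u t) (at t within {a..b})"
    using C_n_SucD(1)[OF ab T_fac_quotient_deriv[OF ab u v_C v_pos i] t] by (simp add: T_fac_Suc)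
  moreover have "T_fac {a..b} v (Suc i) u t = weight i t * quasi u (Suc i) t"
  proof (cases "Suc i < n")
    case True
    then show ?thesis using v_pos[of "i + 2" t] t by (auto simp: weight_def quasi_def)
  next
    case False
    then have "Suc i = n" using i by simp
    then show ?thesis using less_imp_neq[OF prod_pos'[OF t], symmetric]
      by (simp add: weight_def quasi_def del: prod_zero_iff)
  qed
  ultimately show "(quasi u i has_real_derivative weight i t * quasi u (Suc i) t) (at t within {a..b})"
    by simp
next
  have "T_fac {a..b} v n u \<in> C_n {a..b} (n - n)"
    by (rule T_fac_C_n[OF ab u v_C v_pos]) auto
  moreover have "continuous_on {a..b} (v l)" if "l \<in> {1..n}" for l
    using C_n_mono[OF ab v_C[OF that], of 0] by (simp add: C_n_0)
  ultimately show "continuous_on {a..b} (quasi u n)"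
    unfolding quasi_def by (auto simp: C_n_0 intro!: continuous_intros)
qed

lemma quasi_of_chain:
  assumes z: "chain z"
  defines "u \<equiv> (\<lambda>t. v 1 t * z 0 t)"
  shows "u \<in> C_n {a..b} n" "\<And>i t. i \<le> n \<Longrightarrow> t \<in> {a..b} \<Longrightarrow> quasi u i t = z i t"
proof -
  have zC: "z i \<in> C_n {a..b} (n - i)" if "i \<le> n" for i
    using that
  proof (induction i rule: inc_induct)
    case base
    then show ?case using chain_cont[OF z, of n] by (simp add: C_n_0)
  next
    case (step i)
    have w: "weight i \<in> C_n {a..b} (n - Suc i)"
      by (rule C_n_mono[OF ab weight_C_n]) (use step in auto)
    have "z i \<in> C_n {a..b} (Suc (n - Suc i))"
      by (rule C_n_SucI[OF ab chain_deriv[OF z] C_n_mult[OF ab w step.IH]]) (use step in auto)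
    then show ?case using step by (simp add: Suc_diff_Suc)
  qed
  show uC: "u \<in> C_n {a..b} n"
    unfolding u_def by (rule C_n_mult[OF ab]) (use zC[of 0] v_C[of 1] n2 in auto)
  have T: "T_fac {a..b} v (Suc i) u t = weight i t * z (Suc i) t" if "i < n" "t \<in> {a..b}"
    "\<And>s. s \<in> {a..b} \<Longrightarrow> T_fac {a..b} v i u s / v (Suc i) s = z i s" for i t
  proof -
    have "T_fac {a..b} v (Suc i) u t = deriv_on {a..b} (z i) t"
      unfolding T_fac_Suc by (rule deriv_on_cong) (use that in auto)
    then show ?thesis using deriv_on_eqI[OF ab chain_deriv[OF z that(1,2)] that(2)] by simp
  qed
  have q: "T_fac {a..b} v i u t / v (Suc i) t = z i t" if "i < n" "t \<in> {a..b}" for i t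
    using that
  proof (induction i arbitrary: t)
    case 0
    then show ?case using v_pos[of 1 t] n2 by (auto simp: u_def)
  next
    case (Suc i)
    then have "T_fac {a..b} v (Suc i) u t = weight i t * z (Suc i) t" by (intro T) auto
    then show ?case using Suc.prems v_pos[of "i + 2" t] by (auto simp: weight_def)
  qed
  fix i t assume i: "i \<le> n" and t: "t \<in> {a..b}"
  show "quasi u i t = z i t"
  proof (cases "i < n")
    case True
    then show ?thesis using q t by (simp add: quasi_def)
  next
    case False
    then have "i = Suc (n - 1)" using i n2 by simp
    moreover have "T_fac {a..b} v (Suc (n - 1)) u t = weight (n - 1) t * z (Suc (n - 1)) t"
      by (rule T) (use q[of "n - 1"] n2 t in auto)
    ultimately show ?thesis using n2 less_imp_neq[OF prod_pos'[OF t], symmetric]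
      by (simp add: quasi_def weight_def del: prod_zero_iff)
  qed
qed

lemma functional_sum:
  fixes m :: nat
  assumes lin: "\<And>u z c d. u \<in> C_n {a..b} n \<Longrightarrow> z \<in> C_n {a..b} n \<Longrightarrow>
      F (\<lambda>t. c * u t + d * z t) = c * F u + d * F z"
    and q: "\<And>i. i < m \<Longrightarrow> q i \<in> C_n {a..b} n"
  shows "(\<lambda>t. \<Sum>i<m. x i * q i t) \<in> C_n {a..b} n \<and> F (\<lambda>t. \<Sum>i<m. x i * q i t) = (\<Sum>i<m. x i * F (q i))"
  using q
proof (induction m)
  case 0
  show ?case using C_n_const[OF ab, of 0 n] lin[OF C_n_const[OF ab] C_n_const[OF ab], of 0 0 0 0] by simp
next
  case (Suc m)
  then have IH: "(\<lambda>t. \<Sum>i<m. x i * q i t) \<in> C_n {a..b} n"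
    "F (\<lambda>t. \<Sum>i<m. x i * q i t) = (\<Sum>i<m. x i * F (q i))" and qm: "q m \<in> C_n {a..b} n" by auto
  show ?case using C_n_lincomb[OF ab IH(1) qm, of 1 "x m"] lin[OF IH(1) qm, of 1 "x m"] IH(2) by simp
qed

text \<open>At \<open>c\<close> the quasi-derivatives are a lower triangular combination of the derivatives, with
  nonzero diagonal. The hypothesis, tested with functions that have one prescribed derivative at \<open>c\<close>
  and vanish to order \<open>n\<close> at \<open>d\<close>, says that for \<open>l \<in> S\<close> no derivative of index outside \<open>S\<close>
  contributes. So conditions on a set \<open>A\<close> of indices can be exchanged whenever every index missing
  below a member of \<open>A\<close> is of this kind.\<close>

lemma derivative_conditions_iff_T_fac_conditions:
  assumes cd: "c \<in> {a..b}" "d \<in> {a..b}" "c \<noteq> d" and S: "S \<subseteq> {..<n}"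
    and H: "\<And>u l. u \<in> C_n {a..b} n \<Longrightarrow> (\<And>i. i \<in> S \<Longrightarrow> nderiv_on {a..b} i u c = 0) \<Longrightarrow>
      (\<And>i. i < n \<Longrightarrow> nderiv_on {a..b} i u d = 0) \<Longrightarrow> l \<in> S \<Longrightarrow> T_fac {a..b} v l u c = 0"
    and A: "A \<subseteq> {..<n}" "\<And>l i. l \<in> A \<Longrightarrow> i < l \<Longrightarrow> i \<notin> A \<Longrightarrow> l \<in> S \<and> i \<notin> S"
    and u: "u \<in> C_n {a..b} n"
  shows "(\<forall>i\<in>A. nderiv_on {a..b} i u c = 0) \<longleftrightarrow> (\<forall>i\<in>A. T_fac {a..b} v i u c = 0)"
proof -
  obtain P where P: "\<And>i j. j < n \<Longrightarrow> poly ((pderiv ^^ j) (P i)) c = of_bool (i = j)"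
    "\<And>i j. j < n \<Longrightarrow> poly ((pderiv ^^ j) (P i)) d = 0"
    using dual_polynomials[OF cd(3), of n] by metis
  define q where "q i = poly (P i)" for i
  have qC: "q i \<in> C_n {a..b} n" for i unfolding q_def by (rule poly_C_n[OF ab])
  have qc: "nderiv_on {a..b} j (q i) c = of_bool (i = j)" and qd: "nderiv_on {a..b} j (q i) d = 0" if "j < n" for i j
    using P[OF that] cd by (simp_all add: q_def nderiv_on_poly[OF ab])
  define m where "m l i = T_fac {a..b} v l (q i) c" for l i
  have vanishes_to_order: "vanishes_to_order a b (Suc l) z c \<longleftrightarrow> (\<forall>i\<le>l. T_fac {a..b} v i z c = 0)" if "l < n" "z \<in> C_n {a..b} n" for l z
  proof -
    have "vanishes_to_order a b (Suc l) z c \<longleftrightarrow> (\<forall>i<Suc l. T_fac {a..b} v i z c = 0)"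
    proof (rule vanishes_to_order_iff_T_fac[OF ab _ _ _ cd(1)])
      show "z \<in> C_n {a..b} (Suc l)" by (rule C_n_mono[OF ab that(2)]) (use that in auto)
      show "v k \<in> C_n {a..b} (Suc l)" if "k \<in> {1..Suc l}" for k
        by (rule C_n_mono[OF ab v_C]) (use that \<open>l < n\<close> in auto)
    qed (use that v_pos in auto)
    then show ?thesis by (simp add: less_Suc_eq_le)
  qed
  have m_above: "m l i = 0" if "l < i" "i < n" for l i
  proof -
    have "vanishes_to_order a b (Suc l) (q i) c" using that qc by (auto simp: vanishes_to_order_def[OF ab])
    then show ?thesis using vanishes_to_order[of l "q i"] that qC by (auto simp: m_def)
  qed
  have m_diag: "m l l \<noteq> 0" if "l < n" for l
  proof
    assume "m l l = 0"
    moreover have "T_fac {a..b} v i (q l) c = 0" if "i < l" for i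
      using m_above[OF that \<open>l < n\<close>] by (simp add: m_def)
    ultimately have "vanishes_to_order a b (Suc l) (q l) c"
      using vanishes_to_order[OF that qC] by (auto simp: m_def le_less)
    then have "nderiv_on {a..b} l (q l) c = 0" by (simp add: vanishes_to_order_def[OF ab])
    then show False using qc[OF that, of l] by simp
  qed
  have m_S: "m l i = 0" if "l \<in> S" "i \<notin> S" "i < n" for l i
    unfolding m_def by (rule H[OF qC _ qd that(1)]) (use qc S that in auto)
  have expand: "T_fac {a..b} v l u c = (\<Sum>i<n. nderiv_on {a..b} i u c * m l i)" if "l < n" for l
  proof -
    define x where "x i = nderiv_on {a..b} i u c" for i
    define s where "s = (\<lambda>t. \<Sum>i<n. x i * q i t)"
    define r where "r = (\<lambda>t. 1 * u t + (-1) * s t)"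
    have sC: "s \<in> C_n {a..b} n" and sj: "nderiv_on {a..b} j s c = x j" if "j < n" for j
    proof -
      have "s \<in> C_n {a..b} n \<and> nderiv_on {a..b} j s c = (\<Sum>i<n. x i * nderiv_on {a..b} j (q i) c)"
        unfolding s_def
        by (rule functional_sum[where F = "\<lambda>u. nderiv_on {a..b} j u c"])
           (use nderiv_on_lincomb[OF ab _ _ _ cd(1)] that qC in auto)
      moreover have "(\<Sum>i<n. x i * nderiv_on {a..b} j (q i) c) = (\<Sum>i<n. if i = j then x j else 0)"
        by (rule sum.cong) (use qc[OF that] in auto)
      ultimately show "s \<in> C_n {a..b} n" "nderiv_on {a..b} j s c = x j" using that by auto
    qed
    have sC': "s \<in> C_n {a..b} n" using sC[of 0] n2 by simp
    have rC: "r \<in> C_n {a..b} n" unfolding r_def by (rule C_n_lincomb[OF ab u sC'])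
    have "vanishes_to_order a b (Suc l) r c"
      unfolding vanishes_to_order_def[OF ab] r_def
    proof (intro allI impI)
      fix i assume "i < Suc l"
      then have "i < n" using that by simp
      then show "nderiv_on {a..b} i (\<lambda>t. 1 * u t + (-1) * s t) c = 0"
        using nderiv_on_lincomb[OF ab u sC' less_imp_le cd(1), of i 1 "-1"] sj[of i] by (simp add: x_def)
    qed
    then have "T_fac {a..b} v l r c = 0" using vanishes_to_order[OF that rC] by auto
    then have "T_fac {a..b} v l u c = T_fac {a..b} v l s c"
      using T_fac_lincomb[OF ab u sC' v_C v_pos less_imp_le[OF that] cd(1), where c = 1 and d = "-1"] by (simp add: r_def)
    also have "\<dots> = (\<Sum>i<n. x i * m l i)"
      unfolding s_def m_def
      by (rule functional_sum[where F = "\<lambda>u. T_fac {a..b} v l u c", THEN conjunct2])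
         (use T_fac_lincomb[OF ab _ _ v_C v_pos less_imp_le[OF that] cd(1)] qC in auto)
    finally show ?thesis by (simp add: x_def)
  qed
  have m_A: "m l i = 0" if "l \<in> A" "i \<notin> A" "i < n" for l i
  proof (cases "l < i")
    case True
    then show ?thesis using m_above that by blast
  next
    case False
    then have "i < l" using that by (metis linorder_neqE_nat)
    then show ?thesis using A(2)[OF that(1) _ that(2)] m_S that(3) by blast
  qed
  show ?thesis
  proof
    assume *: "\<forall>i\<in>A. nderiv_on {a..b} i u c = 0"
    show "\<forall>i\<in>A. T_fac {a..b} v i u c = 0"
    proof
      fix l assume l: "l \<in> A"
      then have "l < n" using A(1) by auto
      moreover have "nderiv_on {a..b} i u c * m l i = 0" if "i < n" for i
        using * m_A[OF l _ that] by (cases "i \<in> A") auto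
      ultimately show "T_fac {a..b} v l u c = 0" by (simp only: expand) (rule sum.neutral, simp)
    qed
  next
    assume *: "\<forall>i\<in>A. T_fac {a..b} v i u c = 0"
    have "nderiv_on {a..b} l u c = 0" if "l \<in> A" for l
      using that
    proof (induction l rule: less_induct)
      case (less l)
      then have ln: "l < n" using A(1) by auto
      have "0 = (\<Sum>i<n. nderiv_on {a..b} i u c * m l i)"
        using * less.prems expand[OF ln] by simp
      also have "\<dots> = (\<Sum>i<n. if i = l then nderiv_on {a..b} l u c * m l l else 0)"
      proof (rule sum.cong[OF refl])
        fix i assume i: "i \<in> {..<n}"
        consider "i = l" | "l < i" | "i < l" "i \<in> A" | "i \<notin> A" by force
        then show "nderiv_on {a..b} i u c * m l i = (if i = l then nderiv_on {a..b} l u c * m l l else 0)"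
          by cases (use i m_above less m_A[OF less.prems] in auto)
      qed
      also have "\<dots> = nderiv_on {a..b} l u c * m l l" using ln by simp
      finally show ?case using m_diag[OF ln] by simp
    qed
    then show "\<forall>i\<in>A. nderiv_on {a..b} i u c = 0" by blast
  qed
qed

lemma quasi_eq_0_iff: "i < n \<Longrightarrow> t \<in> {a..b} \<Longrightarrow> quasi u i t = 0 \<longleftrightarrow> T_fac {a..b} v i u t = 0"
  using v_pos[of "Suc i" t] by (auto simp: quasi_def)

end

section \<open>The two-point boundary value problem\<close>

text \<open>The data of the theorem after choosing the functions \<open>v\<close> of property \<open>(T\<^sub>d)\<close>.\<close>

locale Td_problem = factorization +
  fixes p :: "nat \<Rightarrow> real \<Rightarrow> real" and Mbar :: real and S E :: "nat set"
  assumes S: "S \<subseteq> {..<n}" and E: "E \<subseteq> {..<n}"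
    and factor: "\<And>u t. u \<in> C_n {a..b} n \<Longrightarrow> t \<in> {a..b} \<Longrightarrow>
      T_op {a..b} n p Mbar u t = (\<Prod>l=1..n. v l t) * T_fac {a..b} v n u t"
    and Td: "\<And>u s. u \<in> X_space a b n S E \<Longrightarrow> s \<in> S \<Longrightarrow> T_fac {a..b} v s u a = 0"
      "\<And>u e. u \<in> X_space a b n S E \<Longrightarrow> e \<in> E \<Longrightarrow> T_fac {a..b} v e u b = 0"
begin

text \<open>The sets \<open>A\<close> for which conditions on derivatives can be exchanged for conditions on
  quasi-derivatives, given that \<open>R\<close> is the set of conditions in property \<open>(T\<^sub>d)\<close>.\<close>

definition compatible :: "nat set \<Rightarrow> nat set \<Rightarrow> bool" where
  "compatible R A \<longleftrightarrow> A \<subseteq> {..<n} \<and> (\<forall>l\<in>A. \<forall>i<l. i \<notin> A \<longrightarrow> l \<in> R \<and> i \<notin> R)"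

lemma compatible_refl: "R \<subseteq> {..<n} \<Longrightarrow> compatible R R"
  by (auto simp: compatible_def)

text \<open>Below the least missing index nothing is missing. Any other member of the new set is a member of
  \<open>R\<close> below \<open>Max R\<close>, and the indices missing below it are missing in \<open>R\<close> too.\<close>

lemma compatible_swap_max:
  assumes "R \<subseteq> {..<n}" "card R < n" "least_missing n R < Max R"
  shows "compatible R (swap_max n R)"
proof -
  note lm = least_missing_props[OF assms(1,2)]
  have "finite R" using assms(1) finite_subset by blast
  then have M: "i \<le> Max R" if "i \<in> R" for i using that by simp
  have "l \<in> R \<and> i \<notin> R" if l: "l \<in> swap_max n R" and i: "i < l" "i \<notin> swap_max n R" for l i
  proof (cases "l = least_missing n R")
    case True
    then show ?thesis using lm(3)[of i] i assms(3) by (auto simp: swap_max_def)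
  next
    case False
    then have "l \<in> R" "l \<noteq> Max R" using l by (auto simp: swap_max_def)
    moreover have "i \<noteq> Max R" using M[OF \<open>l \<in> R\<close>] i(1) by auto
    ultimately show ?thesis using i(2) by (auto simp: swap_max_def)
  qed
  moreover have "swap_max n R \<subseteq> {..<n}" using assms(1) lm(1) by (auto simp: swap_max_def)
  ultimately show ?thesis unfolding compatible_def by blast
qed

lemma X_space_iff_bc:
  assumes A: "compatible S A" and B: "compatible E B" and u: "u \<in> C_n {a..b} n"
  shows "u \<in> X_space a b n A B \<longleftrightarrow> bc A B (quasi u)"
proof -
  have AB: "A \<subseteq> {..<n}" "B \<subseteq> {..<n}" using A B by (auto simp: compatible_def)
  have "(\<forall>i\<in>A. nderiv_on {a..b} i u a = 0) \<longleftrightarrow> (\<forall>i\<in>A. T_fac {a..b} v i u a = 0)"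
  proof (rule derivative_conditions_iff_T_fac_conditions[of a b S, OF _ _ _ S _ AB(1) _ u])
    fix z l assume z: "z \<in> C_n {a..b} n" "\<And>i. i \<in> S \<Longrightarrow> nderiv_on {a..b} i z a = 0"
      "\<And>i. i < n \<Longrightarrow> nderiv_on {a..b} i z b = 0" "l \<in> S"
    then have "z \<in> X_space a b n S E" using E by (auto simp: X_space_def)
    then show "T_fac {a..b} v l z a = 0" using Td(1) z(4) by blast
  qed (use A ab in \<open>auto simp: compatible_def\<close>)
  moreover have "(\<forall>i\<in>B. nderiv_on {a..b} i u b = 0) \<longleftrightarrow> (\<forall>i\<in>B. T_fac {a..b} v i u b = 0)"
  proof (rule derivative_conditions_iff_T_fac_conditions[of b a E, OF _ _ _ E _ AB(2) _ u])
    fix z l assume z: "z \<in> C_n {a..b} n" "\<And>i. i \<in> E \<Longrightarrow> nderiv_on {a..b} i z b = 0"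
      "\<And>i. i < n \<Longrightarrow> nderiv_on {a..b} i z a = 0" "l \<in> E"
    then have "z \<in> X_space a b n S E" using S by (auto simp: X_space_def)
    then show "T_fac {a..b} v l z b = 0" using Td(2) z(4) by blast
  qed (use B ab in \<open>auto simp: compatible_def\<close>)
  moreover have "quasi u i a = 0 \<longleftrightarrow> T_fac {a..b} v i u a = 0" if "i \<in> A" for i
    by (rule quasi_eq_0_iff) (use that AB ab in auto)
  moreover have "quasi u i b = 0 \<longleftrightarrow> T_fac {a..b} v i u b = 0" if "i \<in> B" for i
    by (rule quasi_eq_0_iff) (use that AB ab in auto)
  ultimately show ?thesis using u by (auto simp: X_space_def bc_def)
qed

lemma quasi_0: "u t = v 1 t * quasi u 0 t" if "t \<in> {a..b}"
  using v_pos[of 1 t] n2 that by (auto simp: quasi_def)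

lemma T_op_eq_quasi:
  assumes "u \<in> C_n {a..b} n" "t \<in> {a..b}"
  shows "T_op {a..b} n p M u t = v 1 t * (quasi u n t - (Mbar - M) * quasi u 0 t)"
proof -
  have "(\<Prod>l=1..n. v l t) = v 1 t * (\<Prod>l=2..n. v l t)"
    using n2 by (subst prod.atLeast_Suc_atMost) (auto simp: numeral_2_eq_2)
  then have "T_op {a..b} n p Mbar u t = v 1 t * quasi u n t"
    using factor[OF assms] by (simp add: quasi_def)
  moreover have "T_op {a..b} n p M u t = T_op {a..b} n p Mbar u t - (Mbar - M) * u t"
    by (simp add: T_op_def algebra_simps)
  ultimately show ?thesis using quasi_0[OF assms(2), of u] by (simp add: algebra_simps)
qed

lemma chain_realised:
  assumes A: "compatible S A" and B: "compatible E B" and z: "chain z" "bc A B z"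
  obtains u where "u \<in> X_space a b n A B" "\<And>t. t \<in> {a..b} \<Longrightarrow> u t = v 1 t * z 0 t"
    "\<And>M t. t \<in> {a..b} \<Longrightarrow> T_op {a..b} n p M u t = v 1 t * (z n t - (Mbar - M) * z 0 t)"
proof -
  define u where "u = (\<lambda>t. v 1 t * z 0 t)"
  note q = quasi_of_chain[OF z(1), folded u_def]
  have AB: "A \<subseteq> {..<n}" "B \<subseteq> {..<n}" using A B by (auto simp: compatible_def)
  have "bc A B (quasi u)" using z(2) q(2)[of _ a] q(2)[of _ b] AB ab by (force simp: bc_def)
  then have "u \<in> X_space a b n A B" using X_space_iff_bc[OF A B q(1)] by simp
  then show thesis
    by (rule that) (use T_op_eq_quasi[OF q(1)] q(2) in \<open>auto simp: u_def\<close>)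
qed

lemma is_eigenvalue_iff:
  assumes A: "compatible S A" and B: "compatible E B"
  shows "is_eigenvalue a b n p Mbar A B l \<longleftrightarrow> (\<exists>z. eigenchain A B (rho A * l) z)"
proof
  assume "is_eigenvalue a b n p Mbar A B l"
  then obtain u where u: "u \<in> X_space a b n A B" "\<exists>t\<in>{a..b}. u t \<noteq> 0"
    "\<And>t. t \<in> {a..b} \<Longrightarrow> T_op {a..b} n p Mbar u t = l * u t" unfolding is_eigenvalue_def by blast
  have uC: "u \<in> C_n {a..b} n" using u(1) by (simp add: X_space_def)
  have "quasi u n t = l * quasi u 0 t" if t: "t \<in> {a..b}" for t
  proof -
    have "v 1 t * quasi u n t = l * u t"
      using T_op_eq_quasi[OF uC t, of Mbar] u(3)[OF t] by simp
    also have "\<dots> = l * (v 1 t * quasi u 0 t)" by (rule arg_cong[OF quasi_0[OF t]])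
    finally have "v 1 t * quasi u n t = v 1 t * (l * quasi u 0 t)" by (simp only: mult.left_commute)
    moreover have "v 1 t \<noteq> 0" using v_pos[of 1 t] n2 t by simp
    ultimately show ?thesis by (metis mult_left_cancel)
  qed
  moreover have "\<exists>t\<in>{a..b}. quasi u 0 t \<noteq> 0" using u(2) quasi_0[of _ u] by force
  ultimately have "eigenchain A B (rho A * l) (quasi u)"
    using chain_quasi[OF uC] X_space_iff_bc[OF A B uC] u(1) by (simp add: eigenchain_def)
  then show "\<exists>z. eigenchain A B (rho A * l) z" by blast
next
  assume "\<exists>z. eigenchain A B (rho A * l) z"
  then obtain z where z: "chain z" "bc A B z" "\<exists>t\<in>{a..b}. z 0 t \<noteq> 0"
    "\<And>t. t \<in> {a..b} \<Longrightarrow> rho A * z n t = rho A * l * z 0 t" unfolding eigenchain_def by blast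
  obtain u where u: "u \<in> X_space a b n A B" "\<And>t. t \<in> {a..b} \<Longrightarrow> u t = v 1 t * z 0 t"
    "\<And>M t. t \<in> {a..b} \<Longrightarrow> T_op {a..b} n p M u t = v 1 t * (z n t - (Mbar - M) * z 0 t)"
    using chain_realised[OF A B z(1,2)] by blast
  have "\<exists>t\<in>{a..b}. u t \<noteq> 0" using z(3) u(2) v_pos[of 1] n2 by force
  moreover have "T_op {a..b} n p Mbar u t = l * u t" if "t \<in> {a..b}" for t
    using u(2,3)[OF that] z(4)[OF that] by (simp add: mult.assoc)
  ultimately show "is_eigenvalue a b n p Mbar A B l" using u(1) by (auto simp: is_eigenvalue_def)
qed

lemma principal_imp_least_positive_eigenvalue:
  assumes "compatible S A" "compatible E B" "principal A B l" "rho A = 1"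
  shows "least_positive_eigenvalue a b n p Mbar A B l"
  using assms is_eigenvalue_iff[OF assms(1,2)]
  by (auto simp: least_positive_eigenvalue_def principal_def)

lemma principal_imp_biggest_negative_eigenvalue:
  assumes "compatible S A" "compatible E B" "principal A B l" "rho A = -1"
  shows "biggest_negative_eigenvalue a b n p Mbar A B (- l)"
proof -
  have "m \<le> - l" if m: "m < 0" and ev: "is_eigenvalue a b n p Mbar A B m" for m
  proof -
    obtain z where "eigenchain A B (- m) z"
      using is_eigenvalue_iff[OF assms(1,2)] ev assms(4) by auto
    then have "l \<le> - m" using assms(3) m unfolding principal_def by (metis neg_0_less_iff_less)
    then show ?thesis by simp
  qed
  then show ?thesis
    using assms(3,4) is_eigenvalue_iff[OF assms(1,2), of "- l"]
    by (auto simp: biggest_negative_eigenvalue_def principal_def)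
qed

text \<open>Multiplying the chain by \<open>rho S\<close> before realising it as a function treats both signs of \<open>rho S\<close>
  at once.\<close>

lemma sign_condition_imp_inverse_neg:
  assumes "\<And>u t. u \<in> X_space a b n S E \<Longrightarrow> (\<And>t. t \<in> {a..b} \<Longrightarrow> T_op {a..b} n p M u t \<ge> 0) \<Longrightarrow>
      t \<in> {a..b} \<Longrightarrow> rho S * u t \<le> 0"
  shows "inverse_neg S E (rho S * (Mbar - M))"
  unfolding inverse_neg_def
proof (intro allI impI ballI)
  fix z t assume z: "chain z" "bc S E z"
    and pos: "\<forall>t\<in>{a..b}. 0 \<le> rho S * z n t - rho S * (Mbar - M) * z 0 t" and t: "t \<in> {a..b}"
  obtain u where u: "u \<in> X_space a b n S E" "\<And>t. t \<in> {a..b} \<Longrightarrow> u t = v 1 t * (rho S * z 0 t)"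
    "\<And>M t. t \<in> {a..b} \<Longrightarrow> T_op {a..b} n p M u t = v 1 t * (rho S * z n t - (Mbar - M) * (rho S * z 0 t))"
    using chain_realised[OF compatible_refl[OF S] compatible_refl[OF E] chain_scale[OF z(1)] bc_scale[OF z(2)]]
    by blast
  have v1: "v 1 t > 0" if "t \<in> {a..b}" for t using v_pos[of 1 t] n2 that by simp
  have "rho S * u t \<le> 0"
  proof (rule assms[OF u(1) _ t])
    fix t assume t: "t \<in> {a..b}"
    have "0 \<le> rho S * z n t - (Mbar - M) * (rho S * z 0 t)"
      using pos t by (simp add: mult_ac)
    then show "T_op {a..b} n p M u t \<ge> 0" unfolding u(3)[OF t] using v1[OF t] by simp
  qed
  also have "rho S * u t = v 1 t * z 0 t" using u(2)[OF t] by (simp add: mult.left_commute)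
  finally show "z 0 t \<le> 0" using v1[OF t] by (simp add: mult_le_0_iff)
qed

lemma inverse_neg_imp_principal_eigenvalues:
  assumes P: "poised S E" and neg: "inverse_neg S E lam"
  obtains l1 l3 l3' where "principal S E l1" "principal (swap_max n S) E l3" "principal S (swap_max n E) l3'"
    "l1 < lam" "lam \<le> l3" "lam \<le> l3'" "compatible S (swap_max n S)" "compatible E (swap_max n E)"
    "rho (swap_max n S) = rho S"
proof -
  obtain l1 l3 l3' where l: "principal S E l1" "principal (swap_max n S) E l3" "principal S (swap_max n E) l3'"
    "l1 < lam" "lam \<le> l3" "lam \<le> l3'" and gap: "least_missing n S < Max S" "least_missing n E < Max E"
    using inverse_neg_range[OF P neg] by blast
  have "rho (swap_max n S) = rho S" unfolding rho_def poised_swap_max(2)[OF P gap(1)] ..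
  then show thesis
    using that[OF l] compatible_swap_max[OF S poised_card_less(1)[OF P] gap(1)]
      compatible_swap_max[OF E poised_card_less(2)[OF P] gap(2)] by blast
qed

end

theorem theorem8p1:
  fixes a b M Mbar :: real and n k :: nat and S E :: "nat set"
    and p :: "nat \<Rightarrow> real \<Rightarrow> real"
  assumes "n \<ge> 2" and "k \<in> {1..n - 1}" and "a < b"
    and "S \<subseteq> {0..<n}" and "card S = k"
    and "E \<subseteq> {0..<n}" and "card E = n - k"
    and "\<forall>j\<in>{1..n}. p j \<in> C_n {a..b} (n - j)"
    and "property_Td a b n p Mbar S E"
    and "cond_Na n S E"
  shows "(even (n - k) \<and> inverse_negative a b n p M S E \<longrightarrow>
            (\<exists>lam1 lam3a lam3b.
               least_positive_eigenvalue a b n p Mbar S E lam1 \<and>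
               least_positive_eigenvalue a b n p Mbar (swap_max n S) E lam3a \<and>
               least_positive_eigenvalue a b n p Mbar S (swap_max n E) lam3b \<and>
               M \<in> {Mbar - min lam3a lam3b ..< Mbar - lam1})) \<and>
         (odd (n - k) \<and> inverse_positive a b n p M S E \<longrightarrow>
            (\<exists>lam1 lam3a lam3b.
               biggest_negative_eigenvalue a b n p Mbar S E lam1 \<and>
               biggest_negative_eigenvalue a b n p Mbar (swap_max n S) E lam3a \<and>
               biggest_negative_eigenvalue a b n p Mbar S (swap_max n E) lam3b \<and>
               M \<in> {Mbar - lam1 <.. Mbar - max lam3a lam3b}))"
proof -
  obtain v where v: "\<forall>l\<in>{1..n}. v l \<in> C_n {a..b} n \<and> (\<forall>t\<in>{a..b}. v l t > 0)"
    "\<forall>u\<in>C_n {a..b} n. \<forall>t\<in>{a..b}. T_op {a..b} n p Mbar u t = (\<Prod>l=1..n. v l t) * T_fac {a..b} v n u t"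
    "\<forall>u\<in>X_space a b n S E.
            (\<forall>s\<in>S. T_fac {a..b} v s u a = 0) \<and> (\<forall>e\<in>E. T_fac {a..b} v e u b = 0)"
    using assms(9) unfolding property_Td_def by auto
  interpret Td_problem a b n v p Mbar S E
    by unfold_locales (use assms v in \<open>auto simp: atLeast0LessThan\<close>)
  have P: "poised S E"
    using assms S E unfolding poised_def nonresonant_def cond_Na_def count_below_def by auto
  have even_k: "even (n + k) \<longleftrightarrow> even (n - k)" using assms(2) by auto
  note refl = compatible_refl[OF S] compatible_refl[OF E]
  show ?thesis
  proof (intro conjI impI)
    assume A: "even (n - k) \<and> inverse_negative a b n p M S E"
    then have rho: "rho S = 1" using even_k assms(5) by (simp add: rho_def)
    then have "inverse_neg S E (rho S * (Mbar - M))"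
      using A by (intro sign_condition_imp_inverse_neg) (auto simp: inverse_negative_def)
    then have "inverse_neg S E (Mbar - M)" by (simp add: rho)
    then obtain l1 l3 l3' where l: "principal S E l1" "principal (swap_max n S) E l3"
      "principal S (swap_max n E) l3'" "l1 < Mbar - M" "Mbar - M \<le> l3" "Mbar - M \<le> l3'"
      "compatible S (swap_max n S)" "compatible E (swap_max n E)" "rho (swap_max n S) = rho S"
      using inverse_neg_imp_principal_eigenvalues[OF P] by blast
    show "\<exists>lam1 lam3a lam3b.
               least_positive_eigenvalue a b n p Mbar S E lam1 \<and>
               least_positive_eigenvalue a b n p Mbar (swap_max n S) E lam3a \<and>
               least_positive_eigenvalue a b n p Mbar S (swap_max n E) lam3b \<and>
               M \<in> {Mbar - min lam3a lam3b ..< Mbar - lam1}"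
      by (rule exI[of _ l1], rule exI[of _ l3], rule exI[of _ l3'])
         (use principal_imp_least_positive_eigenvalue[OF refl l(1) rho]
              principal_imp_least_positive_eigenvalue[OF l(7) refl(2) l(2)]
              principal_imp_least_positive_eigenvalue[OF refl(1) l(8) l(3) rho] rho l(4-6,9) in auto)
  next
    assume A: "odd (n - k) \<and> inverse_positive a b n p M S E"
    then have rho: "rho S = -1" using even_k assms(5) by (simp add: rho_def)
    then have "inverse_neg S E (rho S * (Mbar - M))"
      using A by (intro sign_condition_imp_inverse_neg) (auto simp: inverse_positive_def)
    then have "inverse_neg S E (M - Mbar)" by (simp add: rho)
    then obtain l1 l3 l3' where l: "principal S E l1" "principal (swap_max n S) E l3"
      "principal S (swap_max n E) l3'" "l1 < M - Mbar" "M - Mbar \<le> l3" "M - Mbar \<le> l3'"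
      "compatible S (swap_max n S)" "compatible E (swap_max n E)" "rho (swap_max n S) = rho S"
      using inverse_neg_imp_principal_eigenvalues[OF P] by blast
    show "\<exists>lam1 lam3a lam3b.
               biggest_negative_eigenvalue a b n p Mbar S E lam1 \<and>
               biggest_negative_eigenvalue a b n p Mbar (swap_max n S) E lam3a \<and>
               biggest_negative_eigenvalue a b n p Mbar S (swap_max n E) lam3b \<and>
               M \<in> {Mbar - lam1 <.. Mbar - max lam3a lam3b}"
      by (rule exI[of _ "- l1"], rule exI[of _ "- l3"], rule exI[of _ "- l3'"])
         (use principal_imp_biggest_negative_eigenvalue[OF refl l(1) rho]
              principal_imp_biggest_negative_eigenvalue[OF l(7) refl(2) l(2)]
              principal_imp_biggest_negative_eigenvalue[OF refl(1) l(8) l(3) rho] rho l(4-6,9) in auto)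
  qed
qed

end
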